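(* Let $\mathcal L=\mathrm{div}(A\nabla)+\langle Bx,\nabla\rangle-\partial_t$ be a Kolmogorov-type operator on $\mathbb R^{n+1}=\mathbb R^n_x\times\mathbb R_t$ with constant matrices $A,B$ of the block form described in the context, with associated group law $\circ$, homogeneous dimension $Q$, fundamental solution $\Gamma$, kernel $W$ and $\mathcal L$-balls $\Omega_r(z_0)$. Let $z_0\in\mathbb R^{n+1}$ and let $D$ be a bounded open subset of $\mathbb R^{n+1}$ such that, for a suitable $r>0$, $$\int_D \Gamma(\zeta,z)\,W(z_0^{-1}\circ\zeta)\,d\zeta = r\,\Gamma(z_0,z)\qquad\text{for every } z\in\mathbb R^{n+1}\setminus D.$$ If, moreover, the function $$\zeta\longmapsto \big(\mathbb 1_D-\mathbb 1_{\Omega_r(z_0)}\big)(\zeta)\,W(z_0^{-1}\circ\zeta)$$ belongs to $L^p(\mathbb R^{n+1})$ for some $p>\frac Q2$, then $D=\Omega_r(z_0)$.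
   Context: Setting. Let $n\ge 1$. Points of $\mathbb R^{n+1}$ are written $z=(x,t)$ or $\zeta=(\xi,\tau)$, with $x,\xi\in\mathbb R^n$ and $t,\tau\in\mathbb R$; $\nabla$, $\mathrm{div}$ and $\langle\cdot,\cdot\rangle$ are the gradient, divergence and inner product in $\mathbb R^n$ (with respect to $x$). $A$ and $B$ are $n\times n$ real constant matrices of the block form $$A=\begin{bmatrix} A_0 & 0 \\ 0 & 0 \end{bmatrix},\qquad B=\begin{bmatrix} 0 & 0 & \cdots & 0 & 0 \\ B_1 & 0 & \cdots & 0 & 0 \\ 0 & B_2 & \cdots & 0 & 0 \\ \vdots & \vdots & \ddots & \vdots & \vdots \\ 0 & 0 & \cdots & B_\kappa & 0 \end{bmatrix},$$ where $A_0$ is a $p_0\times p_0$ symmetric positive definite matrix ($1\le p_0\le n$), $B_j$ is a $p_j\times p_{j-1}$ block of rank $p_j$ for $j=1,\dots,\kappa$, $p_0\ge p_1\ge\dots\ge p_\kappa\ge1$ and $p_0+p_1+\dots+p_\kappa=n$. The case $\kappa=0$, i.e. $p_0=n$ and $B=0$, is allowed; $A=\mathbb I_n$, $B=0$ gives the heat operator. Group law. Let $E(\tau)=\exp(-\tau B)$. The composition law on $\mathbb R^{n+1}$ is $(x,t)\circ(\xi,\tau)=(\xi+E(\tau)x,\;t+\tau)$, with neutral element $0$ and inverse $(\xi,\tau)^{-1}=(-E(-\tau)\xi,-\tau)$. Homogeneous dimension. $Q=p_0+3p_1+\dots+(2\kappa+1)p_\kappa+2$; equivalently $\lambda^Q$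 is the determinant of $\mathrm{diag}(\lambda\mathbb I_{p_0},\lambda^3\mathbb I_{p_1},\dots,\lambda^{2\kappa+1}\mathbb I_{p_\kappa},\lambda^2)$ for $\lambda>0$. Fundamental solution. Let $C(t)=\int_0^tE(s)AE(s)^T\,ds$, which is positive definite for $t>0$ and negative definite for $t<0$. Define $$\gamma(x,t)=\begin{cases} 0, & t\le0, \\[2pt] \dfrac{(4\pi)^{-n/2}}{\sqrt{\det C(t)}}\exp\!\left(-\tfrac14\langle C^{-1}(t)x,x\rangle\right), & t>0, \end{cases}\qquad \Gamma(z,\zeta)=\gamma(\zeta^{-1}\circ z).$$ Kernel. For $(x,t)\in\mathbb R^{n+1}$ with $t\ne0$, $$W(x,t)=\tfrac14\langle AC^{-1}(t)x,\,C^{-1}(t)x\rangle .$$ It is nonnegative, and defined almost everywhere in $\mathbb R^{n+1}$. $\mathcal L$-balls. For $z_0\in\mathbb R^{n+1}$ and $r>0$, $\Omega_r(z_0)=\{z\in\mathbb R^{n+1}:\Gamma(z_0,z)>\tfrac1r\}$. Conventions. $\mathbb 1_E$ is the characteristic function of the set $E$; $d\zeta$ and $L^p$ refer to Lebesgue measure on $\mathbb R^{n+1}$. *)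

theory Defs
  imports "HOL-Analysis.Analysis"
begin

text \<open>
  The space R^(n+1) is the type \<open>(real^'n) \<times> real\<close> with \<open>n = CARD('n)\<close>. The type \<open>'n\<close> carries no
  order, so the coordinates are numbered by a bijection \<open>idx\<close> onto \<open>{0..<n}\<close>; only the block
  form of the matrices depends on it. Block sizes are \<open>p 0, ..., p \<kappa>\<close>.
\<close>

definition block :: "('n::finite \<Rightarrow> nat) \<Rightarrow> (nat \<Rightarrow> nat) \<Rightarrow> nat \<Rightarrow> 'n set" where
  "block idx p j = {i. (\<Sum>l<j. p l) \<le> idx i \<and> idx i < (\<Sum>l<Suc j. p l)}"

text \<open>
  The \<open>I \<times> J\<close> block of \<open>M\<close>, padded by zeros to a matrix of full size. The padding does not change
  the rank, so \<^const>\<open>rank\<close> of the padded matrix is the rank of the block.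
\<close>

definition submat :: "real^'n^'n \<Rightarrow> 'n set \<Rightarrow> 'n set \<Rightarrow> real^'n^'n" where
  "submat M I J = (\<chi> i k. if i \<in> I \<and> k \<in> J then M $ i $ k else 0)"

definition block_sizes :: "nat \<Rightarrow> (nat \<Rightarrow> nat) \<Rightarrow> nat \<Rightarrow> bool" where
  "block_sizes n p \<kappa> \<longleftrightarrow>
     (\<forall>j<\<kappa>. p (Suc j) \<le> p j) \<and> 1 \<le> p \<kappa> \<and> (\<Sum>j\<le>\<kappa>. p j) = n"

text \<open>
  In \<open>A_form\<close>, positive definiteness of the upper left block is tested on the vectors
  supported in the first \<open>p 0\<close> coordinates.
\<close>

definition A_form :: "('n::finite \<Rightarrow> nat) \<Rightarrow> (nat \<Rightarrow> nat) \<Rightarrow> real^'n^'n \<Rightarrow> bool" where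
  "A_form idx p A \<longleftrightarrow>
     A = submat A (block idx p 0) (block idx p 0) \<and>
     transpose A = A \<and>
     (\<forall>x. x \<noteq> 0 \<and> (\<forall>i. i \<notin> block idx p 0 \<longrightarrow> x $ i = 0) \<longrightarrow> 0 < (A *v x) \<bullet> x)"

definition B_form :: "('n::finite \<Rightarrow> nat) \<Rightarrow> (nat \<Rightarrow> nat) \<Rightarrow> nat \<Rightarrow> real^'n^'n \<Rightarrow> bool" where
  "B_form idx p \<kappa> B \<longleftrightarrow>
     (\<forall>i k. B $ i $ k \<noteq> 0 \<longrightarrow> (\<exists>j\<in>{1..\<kappa>}. i \<in> block idx p j \<and> k \<in> block idx p (j - 1))) \<and>
     (\<forall>j\<in>{1..\<kappa>}. rank (submat B (block idx p j) (block idx p (j - 1))) = p j)"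

definition kolmogorov_structure ::
    "('n::finite \<Rightarrow> nat) \<Rightarrow> (nat \<Rightarrow> nat) \<Rightarrow> nat \<Rightarrow> real^'n^'n \<Rightarrow> real^'n^'n \<Rightarrow> bool" where
  "kolmogorov_structure idx p \<kappa> A B \<longleftrightarrow>
     bij_betw idx UNIV {0..<CARD('n)} \<and> block_sizes CARD('n) p \<kappa> \<and>
     A_form idx p A \<and> B_form idx p \<kappa> B"

definition hom_dim :: "(nat \<Rightarrow> nat) \<Rightarrow> nat \<Rightarrow> nat" where
  "hom_dim p \<kappa> = (\<Sum>j\<le>\<kappa>. (2 * j + 1) * p j) + 2"

text \<open>
  The library function \<^const>\<open>exp\<close> does not apply to \<open>real^'n^'n\<close>, which is not an instance of
  \<^class>\<open>real_normed_algebra_1\<close>; hence the power series.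
\<close>

definition matrix_exp :: "real^'n^'n \<Rightarrow> real^'n^'n" where
  "matrix_exp M = (\<Sum>k. (1 / fact k) *\<^sub>R (((**) M ^^ k) (mat 1)))"

definition E_mat :: "real^'n^'n \<Rightarrow> real \<Rightarrow> real^'n^'n" where
  "E_mat B \<tau> = matrix_exp ((- \<tau>) *\<^sub>R B)"

definition gmult ::
    "real^'n^'n \<Rightarrow> (real^'n) \<times> real \<Rightarrow> (real^'n) \<times> real \<Rightarrow> (real^'n) \<times> real" where
  "gmult B z \<zeta> = (fst \<zeta> + E_mat B (snd \<zeta>) *v fst z, snd z + snd \<zeta>)"

definition ginv :: "real^'n^'n \<Rightarrow> (real^'n) \<times> real \<Rightarrow> (real^'n) \<times> real" where
  "ginv B \<zeta> = (- (E_mat B (- snd \<zeta>) *v fst \<zeta>), - snd \<zeta>)"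

text \<open>The interval integral is oriented, so negative \<open>t\<close> is covered.\<close>

definition C_mat :: "real^'n^'n \<Rightarrow> real^'n^'n \<Rightarrow> real \<Rightarrow> real^'n^'n" where
  "C_mat A B t = (LBINT s=0..t. E_mat B s ** A ** transpose (E_mat B s))"

definition fund_sol0 :: "real^'n^'n \<Rightarrow> real^'n^'n \<Rightarrow> (real^'n) \<times> real \<Rightarrow> real" where
  "fund_sol0 A B z = (case z of (x, t) \<Rightarrow>
     if t \<le> 0 then 0
     else (4 * pi) powr (- real CARD('n) / 2) / sqrt (det (C_mat A B t)) *
          exp (- (1/4) * ((matrix_inv (C_mat A B t) *v x) \<bullet> x)))"

definition fund_sol ::
    "real^'n^'n \<Rightarrow> real^'n^'n \<Rightarrow> (real^'n) \<times> real \<Rightarrow> (real^'n) \<times> real \<Rightarrow> real" where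
  "fund_sol A B z \<zeta> = fund_sol0 A B (gmult B (ginv B \<zeta>) z)"

text \<open>The kernel is undefined for \<open>t = 0\<close>; its value on this null set is set to \<open>0\<close>.\<close>

definition W_kernel :: "real^'n^'n \<Rightarrow> real^'n^'n \<Rightarrow> (real^'n) \<times> real \<Rightarrow> real" where
  "W_kernel A B z = (case z of (x, t) \<Rightarrow>
     if t = 0 then 0
     else (1/4) * ((A *v (matrix_inv (C_mat A B t) *v x)) \<bullet> (matrix_inv (C_mat A B t) *v x)))"

definition L_ball ::
    "real^'n^'n \<Rightarrow> real^'n^'n \<Rightarrow> (real^'n) \<times> real \<Rightarrow> real \<Rightarrow> ((real^'n) \<times> real) set" where
  "L_ball A B z0 r = {z. fund_sol A B z0 z > 1 / r}"

text \<open>Membership in \<open>L^q\<close>; the exponent \<open>q = \<infinity>\<close> (essential boundedness) is included.\<close>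

definition in_Lp :: "ennreal \<Rightarrow> 'a measure \<Rightarrow> ('a \<Rightarrow> real) \<Rightarrow> bool" where
  "in_Lp q M f \<longleftrightarrow> f \<in> borel_measurable M \<and>
     (if q = \<infinity> then \<exists>c. AE x in M. \<bar>f x\<bar> \<le> c
      else integrable M (\<lambda>x. \<bar>f x\<bar> powr enn2real q))"

end

theory Submission
  imports Defs "HOL-Probability.Distributions"
begin

text \<open>
  In coordinates that are centred at \<open>z0\<close> and move with the flow of the drift, \<open>\<Gamma>\<close> is a Gaussian
  kernel whose covariance is the increment of a matrix path \<open>C\<close>, and the ball is
  \<open>\<Omega> = {r psi > 1}\<close> for \<open>psi = \<Gamma>(z0, \<cdot>)\<close>. Integration by parts shows that the potential of
  \<open>W\<close> restricted to \<open>\<Omega>\<close> is \<open>r psi\<close> off \<open>\<Omega>\<close> and \<open>1 + ln (r psi) < r psi\<close> on \<open>\<Omega>\<close>. Let \<open>f1\<close> and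
  \<open>f2\<close> be the restrictions of \<open>W\<close> to \<open>\<Omega> - D\<close> and \<open>D - \<Omega>\<close>. The potential of \<open>f1\<close> is at most
  that of \<open>f2\<close> on \<open>\<Omega> - D\<close>, hence everywhere by the domination principle, and the two potentials
  agree at late times. Testing this against the reverse Gaussians
  \<open>exp (\<langle>(C + \<delta> I)\<^sup>-\<^sup>1 y, y\<rangle> / 4) / sqrt (det (C + \<delta> I))\<close>, which are invariant under the kernel,
  with a power of the time as weight, and letting \<open>\<delta> \<rightarrow> 0\<close>, gives \<open>\<integral> f1 = \<integral> f2\<close> and
  \<open>\<integral> f2 / psi \<le> \<integral> f1 / psi\<close>. Since \<open>1 / psi < r\<close> on \<open>\<Omega>\<close> and \<open>1 / psi \<ge> r\<close> off \<open>\<Omega>\<close>, the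
  function \<open>f1\<close> vanishes almost everywhere and \<open>f2\<close> lives on \<open>r psi = 1\<close>; as \<open>D\<close> is open and \<open>psi\<close>
  decreases along rays, \<open>D \<subseteq> \<Omega>\<close>. At a point of \<open>\<Omega> - D\<close> the potentials of \<open>D\<close> and \<open>\<Omega>\<close> would agree,
  although they are \<open>r psi\<close> and \<open>1 + ln (r psi)\<close>.
\<close>

section \<open>Linear changes of variables in Lebesgue integrals\<close>

text \<open>Weight and regularisation are forced together. Up to a constant, 1 / psi is det C times
  the reverse Gaussian of C. That reverse Gaussian is invariant under the kernel, but its pairing
  with psi diverges, because their product is constant on each time slice. The shift by \<delta>
  makes the pairing finite, and the invariance then reaches down to the pole, where the test
  function has a finite value. The factor det C is a multiple of t^N by homogeneity, so it increases
  in time, and this decides the sign: tested against the reverse Gaussian, f1 and f2 have equal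
  total mass, and by domination f1 has no more mass than f2 before any given time, so f1 sits later
  and has the larger weighted moment. The function kappa comes from asking that x - kappa x with x =
  r psi have the source W on the ball. The chain rule gives the source kappa''(x) x^2 W, since W is
  the squared gradient of ln psi in the form P. Hence kappa'' = 1 / x^2 for x > 1, with kappa =
  kappa' = 0 at 1, and kappa x = x - 1 - ln x.\<close>

lemma nn_integral_lborel_slice:
  fixes f :: "'a::euclidean_space \<Rightarrow> ennreal"
  assumes "e \<in> Basis" and [measurable]: "f \<in> borel_measurable borel"
  shows "(\<integral>\<^sup>+x. f x \<partial>lborel) =
    (\<integral>\<^sup>+x. (\<integral>\<^sup>+t. f ((\<Sum>b\<in>Basis - {e}. x b *\<^sub>R b) + t *\<^sub>R e) \<partial>lborel)
      \<partial>(\<Pi>\<^sub>M b\<in>Basis - {e}. lborel))"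
proof -
  interpret product_sigma_finite "\<lambda>_::'a. lborel :: real measure" ..
  have "(\<integral>\<^sup>+x. f x \<partial>lborel) = (\<integral>\<^sup>+x. f (\<Sum>b\<in>Basis. x b *\<^sub>R b) \<partial>(\<Pi>\<^sub>M b\<in>Basis. lborel))"
    by (subst lborel_eq, subst nn_integral_distr) auto
  also have "Basis = insert e (Basis - {e})" using assms by auto
  also have "(\<integral>\<^sup>+x. f (\<Sum>b\<in>insert e (Basis - {e}). x b *\<^sub>R b) \<partial>(\<Pi>\<^sub>M b\<in>insert e (Basis - {e}). lborel))
     = (\<integral>\<^sup>+x. (\<integral>\<^sup>+t. f (\<Sum>b\<in>insert e (Basis - {e}). (x(e := t)) b *\<^sub>R b) \<partial>lborel)
      \<partial>(\<Pi>\<^sub>M b\<in>Basis - {e}. lborel))"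
    by (rule product_nn_integral_insert) auto
  also have "\<dots> = (\<integral>\<^sup>+x. (\<integral>\<^sup>+t. f ((\<Sum>b\<in>Basis - {e}. x b *\<^sub>R b) + t *\<^sub>R e) \<partial>lborel)
      \<partial>(\<Pi>\<^sub>M b\<in>Basis - {e}. lborel))"
  proof (intro nn_integral_cong)
    fix x :: "'a \<Rightarrow> real" and t :: real
    have "(\<Sum>b\<in>Basis - {e}. (x(e := t)) b *\<^sub>R b) = (\<Sum>b\<in>Basis - {e}. x b *\<^sub>R b)"
      by (intro sum.cong) auto
    then show "f (\<Sum>b\<in>insert e (Basis - {e}). (x(e := t)) b *\<^sub>R b) =
       f ((\<Sum>b\<in>Basis - {e}. x b *\<^sub>R b) + t *\<^sub>R e)"
      by (subst sum.insert) (auto simp: add.commute)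
  qed
  finally show ?thesis .
qed

lemma nn_integral_lborel_translation:
  fixes f :: "'a::euclidean_space \<Rightarrow> ennreal"
  assumes [measurable]: "f \<in> borel_measurable borel"
  shows "(\<integral>\<^sup>+x. f (x + a) \<partial>lborel) = (\<integral>\<^sup>+x. f x \<partial>lborel)"
  by (subst (2) lborel_distr_plus[of a, symmetric], subst nn_integral_distr) (auto simp: add.commute)

text \<open>On every line in the direction \<open>e\<close> the product
  \<open>x \<bullet> e'\<close> is constant, so there the shear is a translation.\<close>

lemma nn_integral_lborel_shear:
  fixes f :: "'a::euclidean_space \<Rightarrow> ennreal"
  assumes e: "e \<in> Basis" "e' \<in> Basis" "e \<noteq> e'" and [measurable]: "f \<in> borel_measurable borel"
  shows "(\<integral>\<^sup>+x. f (x + (x \<bullet> e') *\<^sub>R e) \<partial>lborel) = (\<integral>\<^sup>+x. f x \<partial>lborel)"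
proof -
  have "(\<integral>\<^sup>+t. f ((v + t *\<^sub>R e) + ((v + t *\<^sub>R e) \<bullet> e') *\<^sub>R e) \<partial>lborel) = (\<integral>\<^sup>+t. f (v + t *\<^sub>R e) \<partial>lborel)"
    for v
  proof -
    have "(v + t *\<^sub>R e) + ((v + t *\<^sub>R e) \<bullet> e') *\<^sub>R e = v + (t + v \<bullet> e') *\<^sub>R e" for t
      using e by (simp add: inner_add_left inner_Basis algebra_simps)
    then have "(\<integral>\<^sup>+t. f ((v + t *\<^sub>R e) + ((v + t *\<^sub>R e) \<bullet> e') *\<^sub>R e) \<partial>lborel) =
       (\<integral>\<^sup>+t. f (v + (t + v \<bullet> e') *\<^sub>R e) \<partial>lborel)"
      by (simp only:)
    also have "\<dots> = (\<integral>\<^sup>+t. f (v + t *\<^sub>R e) \<partial>lborel)"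
      by (rule nn_integral_lborel_translation) measurable
    finally show ?thesis .
  qed
  then show ?thesis
    by (subst (1 2) nn_integral_lborel_slice[OF e(1)]) auto
qed

lemma borel_measurable_mult_vec [measurable]:
  fixes M :: "real^'n^'m"
  shows "(*v) M \<in> borel_measurable borel"
  by (intro borel_measurable_continuous_onI linear_continuous_on)
    simp

text \<open>Induction over products of elementary matrices. The implication from
  \<open>det M \<noteq> 0\<close> makes the generators with a zero row vacuous, and \<open>f\<close>
  is quantified inside the induction because the product case applies the claim for \<open>B\<close>
  to \<open>f\<close> composed with \<open>A\<close>.\<close>

theorem nn_integral_linear_change:
  fixes M :: "real^'n^'n" and f :: "real^'n \<Rightarrow> ennreal"
  assumes "det M \<noteq> 0" "f \<in> borel_measurable borel"
  shows "ennreal \<bar>det M\<bar> * (\<integral>\<^sup>+x. f (M *v x) \<partial>lborel) = (\<integral>\<^sup>+x. f x \<partial>lborel)"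
proof -
  let ?P = "\<lambda>M::real^'n^'n. det M \<noteq> 0 \<longrightarrow> (\<forall>f\<in>borel_measurable borel.
    ennreal \<bar>det M\<bar> * (\<integral>\<^sup>+x. f (M *v x) \<partial>lborel) = (\<integral>\<^sup>+x. f x \<partial>lborel))"
  have "?P M"
  proof (induction M rule: induct_matrix_elementary_alt[case_names mult zero_row diagonal swap1 idplus])
    case (mult A B)
    show ?case
    proof (intro impI ballI)
      fix f :: "real^'n \<Rightarrow> ennreal" assume [measurable]: "f \<in> borel_measurable borel"
        and d: "det (A ** B) \<noteq> 0"
      have "(\<integral>\<^sup>+x. f x \<partial>lborel) = ennreal \<bar>det A\<bar> * (\<integral>\<^sup>+x. f (A *v x) \<partial>lborel)"
        using mult d by (auto simp: det_mul)
      also have "(\<integral>\<^sup>+x. f (A *v x) \<partial>lborel) = ennreal \<bar>det B\<bar> * (\<integral>\<^sup>+x. f (A *v (B *v x)) \<partial>lborel)"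
        using mult(2)[THEN mp, THEN bspec, of "\<lambda>x. f (A *v x)"] d by (simp add: det_mul)
      finally show "ennreal \<bar>det (A ** B)\<bar> * (\<integral>\<^sup>+x. f ((A ** B) *v x) \<partial>lborel) = (\<integral>\<^sup>+x. f x \<partial>lborel)"
        by (simp add: det_mul abs_mult ennreal_mult mult.assoc matrix_vector_mul_assoc)
    qed
  next
    case (zero_row A i)
    then show ?case by (metis det_zero_row(1))
  next
    case (diagonal A)
    show ?case
    proof (intro impI ballI)
      fix f :: "real^'n \<Rightarrow> ennreal" assume f[measurable]: "f \<in> borel_measurable borel" and d: "det A \<noteq> 0"
      have det: "det A = (\<Prod>i\<in>UNIV. A $ i $ i)" using diagonal by (rule det_diagonal)
      then have nz: "A $ i $ i \<noteq> 0" for i using d by auto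
      define c where "c j = (\<Sum>i\<in>UNIV. if j = axis i 1 then A $ i $ i else 0)" for j :: "real^'n"
      have c: "c (axis i 1) = A $ i $ i" for i by (simp add: c_def axis_eq_axis)
      have B: "(Basis :: (real^'n) set) = range (\<lambda>i. axis i 1)" by (auto simp: Basis_vec_def)
      have inj: "inj (\<lambda>i::'n. axis i (1::real))" by (auto simp: inj_def axis_eq_axis)
      have T: "(\<Sum>j\<in>Basis. (c j * (x \<bullet> j)) *\<^sub>R j) = A *v x" for x
      proof -
        have "(A *v x) $ k = A $ k $ k * x $ k" for k
          using diagonal by (simp add: matrix_vector_mult_def comm_monoid_add_class.sum.remove[where x=k])
        moreover have "(\<Sum>j\<in>Basis. (c j * (x \<bullet> j)) *\<^sub>R j) $ k = A $ k $ k * x $ k" for k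
        proof -
          have "(\<Sum>j\<in>Basis. (c j * (x \<bullet> j)) *\<^sub>R j) $ k = (\<Sum>i\<in>UNIV. A $ i $ i * x $ i * axis i 1 $ k)"
            unfolding B by (subst sum.reindex[OF inj]) (simp add: c inner_axis)
          also have "\<dots> = (\<Sum>i\<in>UNIV. if i = k then A $ i $ i * x $ i else 0)"
            by (intro sum.cong) (auto simp: axis_def)
          finally show ?thesis by simp
        qed
        ultimately show ?thesis by (simp add: vec_eq_iff)
      qed
      have p: "(\<Prod>j\<in>Basis. \<bar>c j\<bar>) = \<bar>det A\<bar>"
        unfolding B by (subst prod.reindex[OF inj]) (simp add: c det abs_prod)
      have "(lborel :: (real^'n) measure) = density (distr lborel borel (\<lambda>x. 0 + (\<Sum>j\<in>Basis. (c j * (x \<bullet> j)) *\<^sub>R j)))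
          (\<lambda>_. (\<Prod>j\<in>Basis. \<bar>c j\<bar>))"
        by (rule lborel_affine_euclidean) (auto simp: B c nz)
      then have "(lborel :: (real^'n) measure) = density (distr lborel borel ((*v) A)) (\<lambda>_. ennreal \<bar>det A\<bar>)"
        by (simp add: T p)
      then have "(\<integral>\<^sup>+x. f x \<partial>lborel) = (\<integral>\<^sup>+x. f x \<partial>density (distr lborel borel ((*v) A)) (\<lambda>_. ennreal \<bar>det A\<bar>))"
        by simp
      also have "\<dots> = ennreal \<bar>det A\<bar> * (\<integral>\<^sup>+x. f (A *v x) \<partial>lborel)"
        by (simp add: nn_integral_density nn_integral_distr nn_integral_cmult)
      finally show "ennreal \<bar>det A\<bar> * (\<integral>\<^sup>+x. f (A *v x) \<partial>lborel) = (\<integral>\<^sup>+x. f x \<partial>lborel)" by simp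
    qed
  next
    case (swap1 m n)
    let ?t = "Transposition.transpose m n"
    let ?S = "(\<chi> i j. mat 1 $ i $ ?t j) :: real^'n^'n"
    have tt: "i = ?t j \<longleftrightarrow> j = ?t i" for i j by (metis transpose_involutory)
    have Sx: "?S *v x = (\<chi> i. x $ ?t i)" for x
    proof -
      have "(?S *v x) $ i = x $ ?t i" for i
      proof -
        have "(?S *v x) $ i = (\<Sum>j\<in>UNIV. if j = ?t i then x $ j else 0)"
          unfolding matrix_vector_mult_def by (simp add: mat_def tt[of i] mult_delta_left)
        then show ?thesis by simp
      qed
      then show ?thesis by (simp add: vec_eq_iff)
    qed
    have d: "\<bar>det ?S\<bar> = 1"
      using swap1 by (simp add: det_permute_columns permutes_swap_id sign_swap_id abs_mult)
    \<comment> \<open>A transposition of coordinates only permutes the sides of a box, and Lebesgue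
      measure is determined by its values on boxes.\<close>
    have "(lborel :: (real^'n) measure) = distr lborel borel ((*v) ?S)"
    proof (rule lborel_eqI)
      fix l u :: "real^'n" assume lu: "\<And>b. b \<in> Basis \<Longrightarrow> l \<bullet> b \<le> u \<bullet> b"
      have lu': "l $ i \<le> u $ i" for i using lu[of "axis i 1"] by (simp add: inner_axis axis_in_Basis_iff)
      have B: "(Basis :: (real^'n) set) = range (\<lambda>i. axis i 1)" by (auto simp: Basis_vec_def)
      have inj: "inj (\<lambda>i::'n. axis i (1::real))" by (auto simp: inj_def axis_eq_axis)
      have pr: "(\<Prod>b\<in>Basis. (u - l) \<bullet> b) = (\<Prod>i\<in>UNIV. (u - l) $ i)" for u l :: "real^'n"
        unfolding B by (subst prod.reindex[OF inj]) (simp add: inner_axis)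
      have vim: "(*v) ?S -` box l u = box (\<chi> i. l $ ?t i) (\<chi> i. u $ ?t i)"
      proof -
        have "(\<forall>i. l $ i < x $ ?t i \<and> x $ ?t i < u $ i) \<longleftrightarrow> (\<forall>i. l $ ?t i < x $ i \<and> x $ i < u $ ?t i)" for x
          using transpose_involutory[of m n] by metis
        then show ?thesis unfolding Sx by (auto simp: mem_box_cart)
      qed
      have "emeasure (distr lborel borel ((*v) ?S)) (box l u) = emeasure lborel (box (\<chi> i. l $ ?t i) (\<chi> i. u $ ?t i))"
        by (subst emeasure_distr) (auto simp: vim)
      also have "\<dots> = (\<Prod>b\<in>Basis. ((\<chi> i. u $ ?t i) - (\<chi> i. l $ ?t i)) \<bullet> b)"
        by (rule emeasure_lborel_box) (auto simp: B inner_axis lu')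
      also have "\<dots> = (\<Prod>b\<in>Basis. (u - l) \<bullet> b)"
        unfolding pr using prod.permute[OF permutes_swap_id, where S=UNIV and g="\<lambda>i. (u - l)$i"]
        by (simp add: o_def)
      finally show "emeasure (distr lborel borel ((*v) ?S)) (box l u) = (\<Prod>b\<in>Basis. (u - l) \<bullet> b)" .
    qed simp
    note eq = this
    have "(\<integral>\<^sup>+x. f (?S *v x) \<partial>lborel) = (\<integral>\<^sup>+x. f x \<partial>lborel)" if "f \<in> borel_measurable borel" for f
    proof -
      have "(\<integral>\<^sup>+x. f (?S *v x) \<partial>lborel) = (\<integral>\<^sup>+x. f x \<partial>distr lborel borel ((*v) ?S))"
        using that by (subst nn_integral_distr) simp_all
      then show ?thesis unfolding eq[symmetric] .
    qed
    then show ?case using d by simp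
  next
    case (idplus m n)
    let ?S = "(\<chi> i j. of_bool (i = m \<and> j = n \<or> i = j)) :: real^'n^'n"
    have S: "?S *v x = x + (x \<bullet> axis n 1) *\<^sub>R axis m 1" for x
    proof -
      have "(?S *v x) $ i = (x + (x \<bullet> axis n 1) *\<^sub>R axis m 1) $ i" for i
      proof -
        have "(?S *v x) $ i = (\<Sum>j\<in>UNIV. (if j = i then x $ j else 0) + (if j = n then (if i = m then x $ j else 0) else 0))"
          unfolding matrix_vector_mult_def using idplus by (auto intro!: sum.cong)
        also have "\<dots> = x $ i + (if i = m then x $ n else 0)" by (simp add: sum.distrib)
        also have "\<dots> = (x + (x $ n) *\<^sub>R axis m 1) $ i" by (simp add: axis_def)
        finally show ?thesis by (simp add: inner_axis)
      qed
      then show ?thesis by (simp add: vec_eq_iff)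
    qed
    have "?S = (\<chi> k. if k = m then row m (mat 1) + 1 *s row n (mat 1) else row k (mat 1 :: real^'n^'n))"
      using idplus by (auto simp: vec_eq_iff row_def mat_def)
    then have d: "det ?S = 1" using det_row_operation[OF idplus, where c=1 and A="mat 1 :: real^'n^'n"] by (simp only: det_I)
    show ?case
      unfolding S d using idplus
      by (auto intro!: nn_integral_lborel_shear simp: axis_eq_axis Basis_vec_def)
  qed
  then show ?thesis using assms by blast
qed

section \<open>Symmetric positive definite matrices\<close>

definition spd :: "real^'n^'n \<Rightarrow> bool" where
  "spd M \<longleftrightarrow> transpose M = M \<and> (\<forall>x. x \<noteq> 0 \<longrightarrow> 0 < (M *v x) \<bullet> x)"

lemma inner_matrix_transpose: "(M *v x) \<bullet> y = x \<bullet> (transpose M *v y)"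
  for M :: "real^'n^'m"
  by (metis dot_lmul_matrix inner_commute vector_transpose_matrix)

lemma symmetric_inner: "transpose M = M \<Longrightarrow> (M *v x) \<bullet> y = (M *v y) \<bullet> x"
  for M :: "real^'n^'n"
  by (metis inner_commute inner_matrix_transpose)

lemma spd_inner: "spd M \<Longrightarrow> (M *v x) \<bullet> y = (M *v y) \<bullet> x"
  by (simp add: spd_def symmetric_inner)

lemma spd_nonneg: "spd M \<Longrightarrow> 0 \<le> (M *v x) \<bullet> x"
  by (cases "x = 0") (auto simp: spd_def order_less_imp_le)

lemma matrix_inv_mult:
  fixes M :: "real^'n^'n"
  assumes "invertible M"
  shows "M ** matrix_inv M = mat 1" "matrix_inv M ** M = mat 1"
proof -
  have "\<exists>A. M ** A = mat 1 \<and> A ** M = mat 1" using assms by (simp add: invertible_def)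
  from someI_ex[OF this] show "M ** matrix_inv M = mat 1" "matrix_inv M ** M = mat 1"
    by (auto simp: matrix_inv_def)
qed

lemma matrix_inv_mult_vec:
  fixes M :: "real^'n^'n"
  assumes "invertible M"
  shows "M *v (matrix_inv M *v x) = x" "matrix_inv M *v (M *v x) = x"
  by (simp_all add: matrix_vector_mul_assoc matrix_inv_mult[OF assms])

lemma matrix_inv_unique:
  fixes M N :: "real^'n^'n"
  assumes "M ** N = mat 1"
  shows "matrix_inv M = N" "invertible M"
proof -
  have "N ** M = mat 1" using assms matrix_left_right_inverse by blast
  then show "invertible M" using assms invertible_def by blast
  then show "matrix_inv M = N"
    by (metis assms matrix_inv_mult(2) matrix_mul_assoc matrix_mul_lid matrix_mul_rid)
qed

lemma matrix_mult_uminus: "(- M) *v x = - (M *v x)" for M :: "real^'n^'m"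
  by (simp add: matrix_vector_mult_def vec_eq_iff sum_negf)

lemma spd_invertible:
  assumes "spd M" shows "invertible M"
proof -
  have "inj ((*v) M)"
  proof (rule injI)
    fix x y assume "M *v x = M *v y"
    then have "(M *v (x - y)) \<bullet> (x - y) = 0" by (simp add: matrix_vector_mult_diff_distrib)
    then show "x = y" using assms by (metis less_irrefl right_minus_eq spd_def)
  qed
  then show ?thesis by (simp add: invertible_left_inverse matrix_left_invertible_injective)
qed

lemma transpose_matrix_inv:
  fixes M :: "real^'n^'n"
  assumes "invertible M" "transpose M = M"
  shows "transpose (matrix_inv M) = matrix_inv M"
proof -
  have "M ** transpose (matrix_inv M) = mat 1"
    by (metis assms matrix_inv_mult(2) matrix_transpose_mul transpose_mat)
  then show ?thesis using matrix_inv_unique(1) by metis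
qed

lemma spd_matrix_inv:
  fixes M :: "real^'n^'n"
  assumes "spd M" shows "spd (matrix_inv M)"
  unfolding spd_def
proof (intro conjI allI impI)
  note inv = spd_invertible[OF assms]
  show "transpose (matrix_inv M) = matrix_inv M"
    using assms inv transpose_matrix_inv spd_def by blast
  fix x :: "real^'n" assume "x \<noteq> 0"
  then have "matrix_inv M *v x \<noteq> 0" by (metis inv matrix_inv_mult_vec(1) matrix_vector_mult_0_right)
  then have "0 < (M *v (matrix_inv M *v x)) \<bullet> (matrix_inv M *v x)" using assms spd_def by blast
  then show "0 < (matrix_inv M *v x) \<bullet> x" by (simp add: matrix_inv_mult_vec[OF inv] inner_commute)
qed

lemma transpose_add: "transpose (A + B) = transpose A + transpose B" for A B :: "real^'n^'m"
  by (simp add: transpose_def vec_eq_iff)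

lemma transpose_diff: "transpose (A - B) = transpose A - transpose B" for A B :: "real^'n^'m"
  by (simp add: transpose_def vec_eq_iff)

lemma transpose_uminus: "transpose (- A) = - transpose A" for A :: "real^'n^'m"
  by (simp add: transpose_def vec_eq_iff)

lemma transpose_scaleR: "transpose (c *\<^sub>R A) = c *\<^sub>R transpose A" for A :: "real^'n^'m"
  by (simp add: transpose_def vec_eq_iff)

lemma spd_add: "spd M \<Longrightarrow> spd K \<Longrightarrow> spd (M + K)"
  by (simp add: spd_def transpose_add matrix_vector_mult_add_rdistrib inner_add_left add_pos_pos)

lemma spd_scaleR: "spd M \<Longrightarrow> 0 < c \<Longrightarrow> spd (c *\<^sub>R M)"
  by (simp add: spd_def transpose_scaleR scaleR_matrix_vector_assoc[symmetric])

lemma spd_mat_1: "spd (mat 1)"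
  by (simp add: spd_def transpose_mat)

lemma spd_congruence:
  fixes M E :: "real^'n^'n"
  assumes "spd M" "invertible E"
  shows "spd (E ** M ** transpose E)"
  unfolding spd_def
proof (intro conjI allI impI)
  show "transpose (E ** M ** transpose E) = E ** M ** transpose E"
    using assms(1) by (simp add: spd_def matrix_transpose_mul matrix_mul_assoc)
  fix x :: "real^'n" assume "x \<noteq> 0"
  have eq: "((E ** M ** transpose E) *v x) \<bullet> x = (M *v (transpose E *v x)) \<bullet> (transpose E *v x)"
    by (simp add: matrix_vector_mul_assoc[symmetric] inner_matrix_transpose)
  have "transpose E *v x \<noteq> 0"
    using \<open>x \<noteq> 0\<close> matrix_inv_mult(1)[OF assms(2)]
    by (metis matrix_transpose_mul transpose_mat matrix_vector_mul_assoc matrix_vector_mul_lid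
        matrix_vector_mult_0_right)
  then show "0 < ((E ** M ** transpose E) *v x) \<bullet> x"
    unfolding eq using assms(1) spd_def by blast
qed

text \<open>Legendre duality: \<open>\<langle>M\<^sup>-\<^sup>1 y, y\<rangle>\<close> is the supremum over \<open>x\<close> of the left-hand side.\<close>

lemma spd_legendre:
  assumes "spd M"
  shows "2 * (x \<bullet> y) - (M *v x) \<bullet> x \<le> (matrix_inv M *v y) \<bullet> y"
proof -
  note inv = spd_invertible[OF assms]
  define v where "v = matrix_inv M *v y"
  have y: "y = M *v v" by (simp add: v_def matrix_inv_mult_vec[OF inv])
  have "0 \<le> (M *v (x - v)) \<bullet> (x - v)" using assms by (rule spd_nonneg)
  also have "\<dots> = (M *v x) \<bullet> x - 2 * (x \<bullet> y) + v \<bullet> y"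
    using spd_inner[OF assms, of x v]
    by (simp add: y matrix_vector_mult_diff_distrib inner_diff_left inner_diff_right inner_commute)
  finally show ?thesis by (simp add: v_def)
qed

text \<open>The maximiser of the Legendre supremum for \<open>K\<close> is used as a test vector in
  the one for \<open>M\<close>.\<close>

lemma spd_inv_antimono:
  assumes "spd M" "spd K" "\<And>x. (M *v x) \<bullet> x \<le> (K *v x) \<bullet> x"
  shows "(matrix_inv K *v y) \<bullet> y \<le> (matrix_inv M *v y) \<bullet> y"
proof -
  define x where "x = matrix_inv K *v y"
  have y: "K *v x = y" by (simp add: x_def matrix_inv_mult_vec spd_invertible assms)
  have "x \<bullet> y = 2 * (x \<bullet> y) - (K *v x) \<bullet> x" by (simp add: y inner_commute)
  also have "\<dots> \<le> 2 * (x \<bullet> y) - (M *v x) \<bullet> x" using assms(3) by simp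
  also have "\<dots> \<le> (matrix_inv M *v y) \<bullet> y" using assms(1) by (rule spd_legendre)
  finally show ?thesis by (simp add: x_def)
qed

lemma spd_inv_strict_antimono:
  fixes M K :: "real^'n^'n"
  assumes "spd M" "spd (K - M)"
  shows "spd (matrix_inv M - matrix_inv K)"
  unfolding spd_def
proof (intro conjI allI impI)
  have K: "spd K" using spd_add[OF assms] by simp
  show "transpose (matrix_inv M - matrix_inv K) = matrix_inv M - matrix_inv K"
    using spd_matrix_inv[OF K] spd_matrix_inv[OF assms(1)] by (simp add: transpose_diff spd_def)
  fix y :: "real^'n" assume "y \<noteq> 0"
  define x where "x = matrix_inv K *v y"
  have y: "K *v x = y" by (simp add: x_def matrix_inv_mult_vec spd_invertible K)
  then have "x \<noteq> 0" using \<open>y \<noteq> 0\<close> by auto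
  then have "(M *v x) \<bullet> x < (K *v x) \<bullet> x"
    using assms(2) by (simp add: spd_def matrix_vector_mult_diff_rdistrib inner_diff_left)
  then have "x \<bullet> y < 2 * (x \<bullet> y) - (M *v x) \<bullet> x" by (simp add: y inner_commute)
  also have "\<dots> \<le> (matrix_inv M *v y) \<bullet> y" using assms(1) by (rule spd_legendre)
  finally show "0 < ((matrix_inv M - matrix_inv K) *v y) \<bullet> y"
    by (simp add: x_def matrix_vector_mult_diff_rdistrib inner_diff_left)
qed

text \<open>Gram-Schmidt for the inner product \<open>\<langle>M x, y\<rangle>\<close>; the columns of \<open>T\<close> are the orthonormal basis.\<close>

lemma spd_orthonormalize:
  fixes M :: "real^'n^'n"
  assumes "spd M"
  obtains T :: "real^'n^'n" where "transpose T ** M ** T = mat 1"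
proof -
  have "\<exists>b :: 'n \<Rightarrow> real^'n. \<forall>i\<in>I. \<forall>j\<in>I. (M *v b i) \<bullet> b j = (if i = j then 1 else 0)" for I :: "'n set"
  proof (induction I rule: finite_induct[OF finite])
    case 1
    then show ?case by simp
  next
    case (2 k I)
    then obtain b where b: "\<And>i j. i \<in> I \<Longrightarrow> j \<in> I \<Longrightarrow> (M *v b i) \<bullet> b j = (if i = j then 1 else 0)" by blast
    \<comment> \<open>As \<open>k\<close> lies outside \<open>I\<close>, there are fewer
      orthogonality conditions than dimensions, so a nonzero vector satisfies them all.\<close>
    let ?S = "(\<lambda>i. M *v b i) ` I"
    have "dim ?S \<le> card ?S" by (rule dim_le_card') simp
    also have "\<dots> \<le> card I" by (rule card_image_le) simp
    also have "\<dots> < CARD('n)" using 2 by (metis UNIV_I finite psubsetI psubset_card_mono subset_UNIV)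
    finally have "dim ?S < DIM(real^'n)" by simp
    then obtain v where v: "v \<noteq> 0" "\<And>y. y \<in> span ?S \<Longrightarrow> orthogonal v y"
      using orthogonal_to_subspace_exists by blast
    define c where "c = sqrt ((M *v v) \<bullet> v)"
    have c: "c > 0" "c * c = (M *v v) \<bullet> v" using v assms by (auto simp: c_def spd_def)
    define b' where "b' = b(k := (1/c) *\<^sub>R v)"
    have o: "(M *v b i) \<bullet> v = 0" "(M *v v) \<bullet> b i = 0" if "i \<in> I" for i
    proof -
      show "(M *v b i) \<bullet> v = 0"
        using v(2)[of "M *v b i"] that by (simp add: span_base orthogonal_def inner_commute)
      then show "(M *v v) \<bullet> b i = 0" using spd_inner[OF assms] by metis
    qed
    have "\<forall>i\<in>insert k I. \<forall>j\<in>insert k I. (M *v b' i) \<bullet> b' j = (if i = j then 1 else 0)"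
      using b o c 2(2) by (auto simp: b'_def matrix_vector_mult_scaleR field_simps)
    then show ?case by blast
  qed
  from this[of UNIV] obtain b :: "'n \<Rightarrow> real^'n"
    where b: "\<And>i j. (M *v b i) \<bullet> b j = (if i = j then 1 else 0)" by auto
  define T where "T = (\<chi> i j. b j $ i)"
  have "(transpose T ** M ** T) $ i $ j = (mat 1 :: real^'n^'n) $ i $ j" for i j
  proof -
    have "(M *v b j) \<bullet> b i = (\<Sum>k\<in>UNIV. (\<Sum>l\<in>UNIV. M $ k $ l * b j $ l) * b i $ k)"
      by (simp add: inner_vec_def matrix_vector_mult_def)
    also have "\<dots> = (transpose T ** (M ** T)) $ i $ j"
      by (simp add: matrix_matrix_mult_def transpose_def T_def mult.commute)
    finally show ?thesis using b[of j i] by (auto simp: matrix_mul_assoc mat_def)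
  qed
  then have "transpose T ** M ** T = mat 1" by (simp add: vec_eq_iff)
  then show ?thesis by (rule that)
qed

lemma det_spd_pos:
  fixes M :: "real^'n^'n"
  assumes "spd M" shows "0 < det M"
proof -
  obtain T :: "real^'n^'n" where T: "transpose T ** M ** T = mat 1" using spd_orthonormalize[OF assms] .
  have "det T * det M * det T = 1" using arg_cong[OF T, of det] by (simp add: det_mul)
  then have *: "(det T)\<^sup>2 * det M = 1" by (simp add: power2_eq_square mult_ac)
  show ?thesis
  proof (rule ccontr)
    assume "\<not> 0 < det M"
    then have "(det T)\<^sup>2 * det M \<le> 0" by (simp add: mult_nonneg_nonpos)
    then show False using * by simp
  qed
qed

section \<open>Gaussian integrals\<close>

lemma nn_integral_exp_quarter_square: "(\<integral>\<^sup>+x. ennreal (exp (- (x\<^sup>2 / 4))) \<partial>(lborel :: real measure)) = ennreal (sqrt (4 * pi))"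
proof -
  \<comment> \<open>The exponent belongs to the centred normal density of variance 2.\<close>
  have eq: "exp (- (x\<^sup>2 / 4)) = sqrt (4 * pi) * normal_density 0 (sqrt 2) x" for x
    by (simp add: normal_density_def real_sqrt_mult)
  have "(\<integral>\<^sup>+x. ennreal (exp (- (x\<^sup>2 / 4))) \<partial>(lborel :: real measure)) =
    (\<integral>\<^sup>+x. ennreal (sqrt (4 * pi)) * ennreal (normal_density 0 (sqrt 2) x) \<partial>lborel)"
    by (simp add: eq ennreal_mult)
  also have "\<dots> = ennreal (sqrt (4 * pi)) * (\<integral>\<^sup>+x. ennreal (normal_density 0 (sqrt 2) x) \<partial>lborel)"
    by (rule nn_integral_cmult) simp
  also have "(\<integral>\<^sup>+x. ennreal (normal_density 0 (sqrt 2) x) \<partial>lborel) = 1"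
    by (subst nn_integral_eq_integral) (auto simp: integrable_normal_density integral_normal_density)
  finally show ?thesis by simp
qed

lemma nn_integral_exp_norm:
  "(\<integral>\<^sup>+x. ennreal (exp (- ((x \<bullet> x) / 4))) \<partial>(lborel :: (real^'n) measure)) = ennreal (sqrt (4 * pi) ^ CARD('n))"
proof -
  have eq: "ennreal (exp (- ((x \<bullet> x) / 4))) = (\<Prod>b\<in>Basis. ennreal (exp (- ((x \<bullet> b)\<^sup>2 / 4))))" for x :: "real^'n"
  proof -
    have "x \<bullet> x = (\<Sum>b\<in>Basis. (x \<bullet> b)\<^sup>2)" by (simp add: euclidean_inner[of x x] power2_eq_square)
    then have "exp (- ((x \<bullet> x) / 4)) = (\<Prod>b\<in>Basis. exp (- ((x \<bullet> b)\<^sup>2 / 4)))"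
      by (simp add: sum_divide_distrib sum_negf[symmetric] exp_sum)
    then show ?thesis by (simp add: prod_ennreal)
  qed
  have "(\<integral>\<^sup>+x. ennreal (exp (- ((x \<bullet> x) / 4))) \<partial>(lborel :: (real^'n) measure)) =
     (\<Prod>b\<in>(Basis::(real^'n) set). (\<integral>\<^sup>+x. ennreal (exp (- (x\<^sup>2 / 4))) \<partial>lborel))"
    unfolding eq by (rule nn_integral_lborel_prod) auto
  then show ?thesis by (simp add: nn_integral_exp_quarter_square ennreal_power)
qed

lemma borel_measurable_quadratic [measurable]:
  fixes M :: "real^'n^'n"
  shows "(\<lambda>x. (M *v x) \<bullet> x) \<in> borel_measurable borel"
  by measurable

lemma nn_integral_gaussian:
  fixes M :: "real^'n^'n"
  assumes "spd M"
  shows "(\<integral>\<^sup>+x. ennreal (exp (- ((M *v x) \<bullet> x / 4))) \<partial>lborel) = ennreal (sqrt (4 * pi) ^ CARD('n) / sqrt (det M))"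
proof -
  obtain T :: "real^'n^'n" where T: "transpose T ** M ** T = mat 1" using spd_orthonormalize[OF assms] .
  have "det T * det M * det T = 1" using arg_cong[OF T, of det] by (simp add: det_mul)
  then have d: "(det T)\<^sup>2 * det M = 1" by (simp add: power2_eq_square mult_ac)
  have dM: "0 < det M" using assms by (rule det_spd_pos)
  from d have dT: "det T \<noteq> 0" by auto
  have "\<bar>det T\<bar> * sqrt (det M) = sqrt ((det T)\<^sup>2 * det M)" by (simp add: real_sqrt_mult)
  then have aT: "\<bar>det T\<bar> = 1 / sqrt (det M)" using dM d by (simp add: field_simps)
  have q: "(M *v (T *v x)) \<bullet> (T *v x) = x \<bullet> x" for x
  proof -
    have "(M *v (T *v x)) \<bullet> (T *v x) = (transpose T *v (M *v (T *v x))) \<bullet> x"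
      by (metis inner_commute inner_matrix_transpose)
    then show ?thesis by (simp add: matrix_vector_mul_assoc T matrix_mul_assoc)
  qed
  have "(\<integral>\<^sup>+x. ennreal (exp (- ((M *v x) \<bullet> x / 4))) \<partial>lborel)
    = ennreal \<bar>det T\<bar> * (\<integral>\<^sup>+x. ennreal (exp (- ((M *v (T *v x)) \<bullet> (T *v x) / 4))) \<partial>lborel)"
    by (rule nn_integral_linear_change[symmetric]) (use dT in auto)
  also have "\<dots> = ennreal (1 / sqrt (det M)) * ennreal (sqrt (4 * pi) ^ CARD('n))"
    unfolding q nn_integral_exp_norm aT ..
  also have "\<dots> = ennreal (sqrt (4 * pi) ^ CARD('n) / sqrt (det M))"
    using dM by (subst ennreal_mult[symmetric]) auto
  finally show ?thesis .
qed

text \<open>Comparing Gaussian integrals avoids eigenvalues: the larger form has the smaller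
  integral, and the integral is a constant over the square root of the determinant.\<close>

lemma det_spd_mono:
  fixes M K :: "real^'n^'n"
  assumes "spd M" "spd K" "\<And>x. (M *v x) \<bullet> x \<le> (K *v x) \<bullet> x"
  shows "det M \<le> det K"
proof -
  have "ennreal (sqrt (4 * pi) ^ CARD('n) / sqrt (det K)) \<le> ennreal (sqrt (4 * pi) ^ CARD('n) / sqrt (det M))"
    unfolding nn_integral_gaussian[OF assms(1), symmetric] nn_integral_gaussian[OF assms(2), symmetric]
    by (intro nn_integral_mono) (use assms(3) in auto)
  moreover have "sqrt (4 * pi) ^ CARD('n) > 0" by simp
  ultimately show ?thesis
    using det_spd_pos[OF assms(1)] det_spd_pos[OF assms(2)]
    by (simp add: ennreal_le_iff divide_le_cancel frac_le_eq field_simps)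
qed

text \<open>The normal density with covariance 2 M, that is, with the normalisation of the heat
  kernel.\<close>

definition gauss :: "real^'n^'n \<Rightarrow> real^'n \<Rightarrow> real" where
  "gauss M y = (4 * pi) powr (- real CARD('n) / 2) / sqrt (det M) *
     exp (- (1/4) * ((matrix_inv M *v y) \<bullet> y))"

text \<open>Formally the Gaussian of - M, up to the constant and the sign of the determinant: a heat
  kernel run backwards in time.\<close>

definition reverse_gauss :: "real^'n^'n \<Rightarrow> real^'n \<Rightarrow> real" where
  "reverse_gauss M y = exp ((matrix_inv M *v y) \<bullet> y / 4) / sqrt (det M)"

lemma powr_half_card: "(4 * pi) powr (- real CARD('n) / 2) = 1 / sqrt (4 * pi) ^ CARD('n::finite)"
proof -
  have "(4 * pi) powr (- real CARD('n) / 2) = ((4 * pi) powr (1/2)) powr (- real CARD('n))"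
    by (simp add: powr_powr)
  also have "(4 * pi) powr (1/2) = sqrt (4 * pi)" by (rule powr_half_sqrt) simp
  also have "sqrt (4 * pi) powr (- real CARD('n)) = 1 / sqrt (4 * pi) ^ CARD('n)"
    by (simp add: powr_minus powr_realpow divide_inverse)
  finally show ?thesis .
qed

lemma matrix_add_rdistrib: "(A + B) ** C = A ** C + B ** C" for A B :: "real^'n^'m"
  by (simp add: matrix_matrix_mult_def vec_eq_iff distrib_right sum.distrib)

lemma gauss_alt:
  "gauss (M :: real^'n^'n) y = 1 / sqrt (4 * pi) ^ CARD('n) / sqrt (det M) * exp (- ((matrix_inv M *v y) \<bullet> y / 4))"
  unfolding gauss_def powr_half_card by simp

lemma gauss_pos: "spd M \<Longrightarrow> 0 < gauss M y"
  by (simp add: gauss_def det_spd_pos)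

lemma reverse_gauss_pos: "spd M \<Longrightarrow> 0 < reverse_gauss M y"
  by (simp add: reverse_gauss_def det_spd_pos)

lemma matrix_mult_vec_minus: "M *v (- x) = - (M *v x)" for M :: "real^'n^'m"
  by (simp add: matrix_vector_mult_def vec_eq_iff sum_negf)

lemma gauss_minus [simp]: "gauss M (- y) = gauss M y"
  by (simp add: gauss_def matrix_mult_vec_minus)

lemma gauss_commute: "gauss M (x - y) = gauss M (y - x)"
  by (metis gauss_minus minus_diff_eq)

lemma borel_measurable_gauss [measurable]: "gauss M \<in> borel_measurable borel"
  unfolding gauss_def by measurable

lemma borel_measurable_reverse_gauss [measurable]: "reverse_gauss M \<in> borel_measurable borel"
  unfolding reverse_gauss_def by measurable

text \<open>The minimum of \<open>\<langle>M\<^sup>-\<^sup>1 (y - \<eta>), y - \<eta>\<rangle> + \<langle>K\<^sup>-\<^sup>1 y, y\<rangle>\<close> is attained at \<open>y = K u\<close> with \<open>u = (M + K)\<^sup>-\<^sup>1 \<eta>\<close>.\<close>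

lemma complete_square:
  fixes M K :: "real^'n^'n" and \<eta> w :: "real^'n"
  assumes M: "invertible M" "transpose M = M" and K: "invertible K" "transpose K = K"
    and MK: "invertible (M + K)"
  defines "u \<equiv> matrix_inv (M + K) *v \<eta>"
  shows "(matrix_inv M *v (K *v u + w - \<eta>)) \<bullet> (K *v u + w - \<eta>)
       + (matrix_inv K *v (K *v u + w)) \<bullet> (K *v u + w)
     = ((matrix_inv M + matrix_inv K) *v w) \<bullet> w + (matrix_inv (M + K) *v \<eta>) \<bullet> \<eta>"
proof -
  have eta: "\<eta> = M *v u + K *v u"
    using matrix_inv_mult_vec(1)[OF MK, of \<eta>] by (simp add: u_def matrix_vector_mult_add_rdistrib)
  have 1: "K *v u + w - \<eta> = w - M *v u" by (simp add: eta)
  have 2: "(matrix_inv M *v w) \<bullet> (M *v u) = w \<bullet> u" "(M *v u) \<bullet> (matrix_inv M *v w) = w \<bullet> u"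
    by (metis M inner_matrix_transpose inner_commute matrix_inv_mult_vec(1))+
  have 3: "(matrix_inv K *v w) \<bullet> (K *v u) = w \<bullet> u" "(K *v u) \<bullet> (matrix_inv K *v w) = w \<bullet> u"
    by (metis K inner_matrix_transpose inner_commute matrix_inv_mult_vec(1))+
  show ?thesis
    unfolding 1 u_def[symmetric]
    by (simp add: eta matrix_vector_mult_diff_distrib matrix_vector_right_distrib inner_diff_left
        inner_diff_right inner_add_left inner_add_right matrix_vector_mult_add_rdistrib
        matrix_inv_mult_vec[OF M(1)] matrix_inv_mult_vec[OF K(1)] 2 3 inner_commute[of u w])
qed

text \<open>\<open>K\<close> may be indefinite as long as the sum of the inverses is positive
  definite. Thus the same computation serves the convolution of two Gaussians and, with a negative
  definite \<open>K\<close>, the reverse Gaussians. The determinants come from M + K = M (inverse M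
  + inverse K) K.\<close>

lemma nn_integral_gaussian_product:
  fixes M K :: "real^'n^'n"
  assumes M: "spd M" and K: "invertible K" "transpose K = K"
    and S: "spd (matrix_inv M + matrix_inv K)"
  shows "(\<integral>\<^sup>+y. ennreal (exp (- ((matrix_inv M *v (y - \<eta>)) \<bullet> (y - \<eta>) / 4))
            * exp (- ((matrix_inv K *v y) \<bullet> y / 4))) \<partial>lborel)
     = ennreal (sqrt (4 * pi) ^ CARD('n) / sqrt (det (matrix_inv M + matrix_inv K))
         * exp (- ((matrix_inv (M + K) *v \<eta>) \<bullet> \<eta> / 4)))"
    and "det (M + K) = det M * det (matrix_inv M + matrix_inv K) * det K"
proof -
  note iM = spd_invertible[OF M] and iS = spd_invertible[OF S]
  have MSK: "M ** (matrix_inv M + matrix_inv K) ** K = M + K"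
    by (simp add: matrix_add_ldistrib matrix_add_rdistrib matrix_inv_mult[OF iM] matrix_mul_assoc[symmetric]
        matrix_inv_mult[OF K(1)] add.commute)
  then show "det (M + K) = det M * det (matrix_inv M + matrix_inv K) * det K"
    by (metis det_mul)
  have MK: "invertible (M + K)" unfolding MSK[symmetric] by (intro invertible_mult iM iS K)
  define u where "u = matrix_inv (M + K) *v \<eta>"
  let ?S = "matrix_inv M + matrix_inv K"
  let ?c = "exp (- ((matrix_inv (M + K) *v \<eta>) \<bullet> \<eta> / 4))"
  let ?f = "\<lambda>y. ennreal (exp (- ((matrix_inv M *v (y - \<eta>)) \<bullet> (y - \<eta>) / 4))
            * exp (- ((matrix_inv K *v y) \<bullet> y / 4)))"
  have sM: "transpose M = M" using M by (simp add: spd_def)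
  have eq: "exp (- ((matrix_inv M *v (w + K *v u - \<eta>)) \<bullet> (w + K *v u - \<eta>) / 4))
            * exp (- ((matrix_inv K *v (w + K *v u)) \<bullet> (w + K *v u) / 4))
        = exp (- ((?S *v w) \<bullet> w / 4)) * ?c" for w
    using complete_square[OF iM sM K MK, of \<eta> w]
    unfolding u_def[symmetric] exp_add[symmetric] add.commute[of w] by (simp add: add_divide_distrib[symmetric])
  have "(\<integral>\<^sup>+y. ?f y \<partial>lborel) = (\<integral>\<^sup>+w. ?f (w + K *v u) \<partial>lborel)"
    by (rule nn_integral_lborel_translation[symmetric]) measurable
  also have "\<dots> = (\<integral>\<^sup>+w. ennreal (exp (- ((?S *v w) \<bullet> w / 4))) * ennreal ?c \<partial>lborel)"
    unfolding eq by (simp add: ennreal_mult)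
  also have "\<dots> = ennreal (sqrt (4 * pi) ^ CARD('n) / sqrt (det ?S)) * ennreal ?c"
    by (subst nn_integral_multc) (simp_all add: nn_integral_gaussian[OF S])
  also have "\<dots> = ennreal (sqrt (4 * pi) ^ CARD('n) / sqrt (det ?S) * ?c)"
    using det_spd_pos[OF S] by (intro ennreal_mult[symmetric]) auto
  finally show "(\<integral>\<^sup>+y. ?f y \<partial>lborel) = ennreal (sqrt (4 * pi) ^ CARD('n) / sqrt (det ?S) * ?c)" .
qed

lemma nn_integral_gauss:
  fixes M :: "real^'n^'n"
  assumes "spd M"
  shows "(\<integral>\<^sup>+y. ennreal (gauss M (y - \<eta>)) \<partial>lborel) = 1"
proof -
  note i = spd_matrix_inv[OF assms] and d = det_spd_pos[OF assms]
  have dd: "det (matrix_inv M) * det M = 1"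
    using matrix_inv_mult(2)[OF spd_invertible[OF assms]] by (metis det_I det_mul)
  have "(\<integral>\<^sup>+y. ennreal (gauss M (y - \<eta>)) \<partial>lborel) = (\<integral>\<^sup>+y. ennreal (gauss M y) \<partial>lborel)"
    using nn_integral_lborel_translation[of "\<lambda>y. ennreal (gauss M y)" "- \<eta>"] by simp
  also have "\<dots> = (\<integral>\<^sup>+y. ennreal (1 / sqrt (4 * pi) ^ CARD('n) / sqrt (det M)) *
        ennreal (exp (- ((matrix_inv M *v y) \<bullet> y / 4))) \<partial>lborel)"
    using d by (simp add: gauss_alt ennreal_mult[symmetric])
  also have "\<dots> = ennreal (1 / sqrt (4 * pi) ^ CARD('n) / sqrt (det M)) *
      ennreal (sqrt (4 * pi) ^ CARD('n) / sqrt (det (matrix_inv M)))"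
    by (subst nn_integral_cmult) (simp_all add: nn_integral_gaussian[OF i])
  also have "\<dots> = ennreal (1 / sqrt (det (matrix_inv M) * det M))"
    using d det_spd_pos[OF i] by (simp add: ennreal_mult[symmetric] real_sqrt_mult)
  finally show ?thesis by (simp add: dd)
qed

lemma gauss_convolution:
  fixes M K :: "real^'n^'n"
  assumes M: "spd M" and K: "spd K"
  shows "(\<integral>\<^sup>+y. ennreal (gauss M (\<eta> - y)) * ennreal (gauss K (y - x)) \<partial>lborel) = ennreal (gauss (M + K) (\<eta> - x))"
proof -
  let ?p = "1 / sqrt (4 * pi) ^ CARD('n)"
  have S: "spd (matrix_inv M + matrix_inv K)" using M K by (intro spd_add spd_matrix_inv)
  note d = det_spd_pos[OF M] det_spd_pos[OF K] det_spd_pos[OF S] det_spd_pos[OF spd_add[OF M K]]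
  have inv: "invertible K" "transpose K = K" using spd_invertible[OF K] K by (auto simp: spd_def)
  note P = nn_integral_gaussian_product[OF M inv S]
  let ?f = "\<lambda>y. ennreal (exp (- ((matrix_inv M *v (y - (\<eta> - x))) \<bullet> (y - (\<eta> - x)) / 4))
            * exp (- ((matrix_inv K *v y) \<bullet> y / 4)))"
  have "(\<integral>\<^sup>+y. ennreal (gauss M (\<eta> - y)) * ennreal (gauss K (y - x)) \<partial>lborel)
    = (\<integral>\<^sup>+y. ennreal (gauss M (\<eta> - (y + x))) * ennreal (gauss K (y + x - x)) \<partial>lborel)"
    by (rule nn_integral_lborel_translation[symmetric]) measurable
  also have "\<dots> = (\<integral>\<^sup>+y. ennreal (gauss M (y - (\<eta> - x))) * ennreal (gauss K y) \<partial>lborel)"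
    by (subst gauss_commute) (simp add: algebra_simps)
  also have "\<dots> = (\<integral>\<^sup>+y. ennreal (?p\<^sup>2 / (sqrt (det M) * sqrt (det K))) * ?f y \<partial>lborel)"
    using d by (simp add: gauss_alt ennreal_mult[symmetric] power2_eq_square mult_ac)
  also have "\<dots> = ennreal (?p\<^sup>2 / (sqrt (det M) * sqrt (det K))) * ennreal (sqrt (4 * pi) ^ CARD('n) / sqrt (det (matrix_inv M + matrix_inv K))
         * exp (- ((matrix_inv (M + K) *v (\<eta> - x)) \<bullet> (\<eta> - x) / 4)))"
    by (subst nn_integral_cmult) (simp_all only: P(1), measurable)
  also have "\<dots> = ennreal (gauss (M + K) (\<eta> - x))"
  proof -
    have "sqrt (det (M + K)) = sqrt (det M) * sqrt (det (matrix_inv M + matrix_inv K)) * sqrt (det K)"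
      by (simp only: P(2) real_sqrt_mult)
    then show ?thesis
      using d by (simp only: gauss_alt) (simp add: ennreal_mult[symmetric] power2_eq_square)
  qed
  finally show ?thesis .
qed

lemma matrix_inv_uminus:
  fixes K :: "real^'n^'n"
  assumes "invertible K"
  shows "matrix_inv (- K) = - matrix_inv K" "invertible (- K)"
proof -
  have "(- K) ** (- matrix_inv K) = K ** matrix_inv K"
    by (simp add: matrix_matrix_mult_def vec_eq_iff)
  then have "(- K) ** (- matrix_inv K) = mat 1" by (simp add: matrix_inv_mult[OF assms])
  then show "matrix_inv (- K) = - matrix_inv K" "invertible (- K)" using matrix_inv_unique by blast+
qed

lemma det_uminus: "det (- K) = (- 1) ^ CARD('n) * det (K :: real^'n^'n)"
proof -
  have "- K = (\<chi> i. (- 1) *s K $ i)" by (simp add: vec_eq_iff)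
  then show ?thesis using det_rows_mul[of "\<lambda>_. - 1" "\<lambda>i. K $ i"] by simp
qed

text \<open>Covariances add: M and - K give - (K - M). The integral converges because
  \<open>spd (K - M)\<close> makes the difference of the inverses of M and K positive
  definite.\<close>

lemma gauss_reverse_gauss:
  fixes M K :: "real^'n^'n"
  assumes M: "spd M" and KM: "spd (K - M)"
  shows "(\<integral>\<^sup>+y. ennreal (gauss M (\<eta> - y)) * ennreal (reverse_gauss K y) \<partial>lborel) = ennreal (reverse_gauss (K - M) \<eta>)"
proof -
  let ?p = "1 / sqrt (4 * pi) ^ CARD('n)"
  have K: "spd K" using spd_add[OF M KM] by simp
  note iK = spd_invertible[OF K] and iKM = spd_invertible[OF KM]
  have S: "spd (matrix_inv M + matrix_inv (- K))"
    using spd_inv_strict_antimono[OF M KM] by (simp add: matrix_inv_uminus[OF iK])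
  have inv: "invertible (- K)" "transpose (- K) = - K"
    using matrix_inv_uminus[OF iK] K by (auto simp: spd_def transpose_uminus)
  note P = nn_integral_gaussian_product[OF M inv S]
  note d = det_spd_pos[OF M] det_spd_pos[OF K] det_spd_pos[OF S] det_spd_pos[OF KM]
  have MK: "M + - K = - (K - M)" by simp
  \<comment> \<open>The signs (-1)^n of \<open>det (- K)\<close> and \<open>det (- (K - M))\<close>
    cancel.\<close>
  have dd: "det (K - M) = det M * det (matrix_inv M + matrix_inv (- K)) * det K"
    using P(2) unfolding MK det_uminus by simp
  let ?f = "\<lambda>y. ennreal (exp (- ((matrix_inv M *v (y - \<eta>)) \<bullet> (y - \<eta>) / 4))
            * exp (- ((matrix_inv (- K) *v y) \<bullet> y / 4)))"
  have "(\<integral>\<^sup>+y. ennreal (gauss M (\<eta> - y)) * ennreal (reverse_gauss K y) \<partial>lborel)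
    = (\<integral>\<^sup>+y. ennreal (?p / (sqrt (det M) * sqrt (det K))) * ?f y \<partial>lborel)"
    unfolding gauss_commute[of M \<eta>]
    using d by (simp add: gauss_alt reverse_gauss_def ennreal_mult[symmetric] mult_ac
        matrix_inv_uminus[OF iK] matrix_mult_uminus)
  also have "\<dots> = ennreal (?p / (sqrt (det M) * sqrt (det K))) * ennreal (sqrt (4 * pi) ^ CARD('n) / sqrt (det (matrix_inv M + matrix_inv (- K)))
         * exp (- ((matrix_inv (M + - K) *v \<eta>) \<bullet> \<eta> / 4)))"
    by (subst nn_integral_cmult) (simp_all only: P(1), measurable)
  also have "\<dots> = ennreal (reverse_gauss (K - M) \<eta>)"
    unfolding MK matrix_inv_uminus[OF iKM]
    using d by (simp add: reverse_gauss_def ennreal_mult[symmetric] dd real_sqrt_mult matrix_mult_uminus field_simps)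
  finally show ?thesis .
qed

section \<open>A domination principle for causal kernels\<close>

text \<open>The assumption \<open>k_resolvent\<close> is the resolvent equation for the kernels
  \<open>exp (- \<beta> (\<tau> z - \<tau> \<zeta>)) k z \<zeta>\<close>.\<close>

locale causal_kernel = sigma_finite_measure M for M :: "'a measure" +
  fixes k :: "'a \<Rightarrow> 'a \<Rightarrow> ennreal" and \<tau> :: "'a \<Rightarrow> real" and S :: real
  assumes k_meas [measurable]: "case_prod k \<in> borel_measurable (M \<Otimes>\<^sub>M M)"
    and tau_meas [measurable]: "\<tau> \<in> borel_measurable M"
    and S_pos: "0 < S"
    and k_mass: "\<And>z. (\<integral>\<^sup>+\<zeta>. k z \<zeta> \<partial>M) \<le> ennreal S"
    and k_resolvent: "\<And>\<beta> z \<zeta>. 0 < \<beta> \<Longrightarrow>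
      (\<integral>\<^sup>+w. ennreal (\<beta> * exp (- \<beta> * (\<tau> z - \<tau> w))) * k z w * k w \<zeta> \<partial>M) + ennreal (exp (- \<beta> * (\<tau> z - \<tau> \<zeta>))) * k z \<zeta> = k z \<zeta>"
    and k_resolvent_mass: "\<And>\<beta> z. 0 < \<beta> \<Longrightarrow>
      (\<integral>\<^sup>+w. ennreal (\<beta> * exp (- \<beta> * (\<tau> z - \<tau> w))) * k z w \<partial>M) \<le> ennreal (1 - exp (- \<beta> * S))"
begin

definition potential :: "('a \<Rightarrow> ennreal) \<Rightarrow> 'a \<Rightarrow> ennreal" where
  "potential f z = (\<integral>\<^sup>+\<zeta>. k z \<zeta> * f \<zeta> \<partial>M)"

text \<open>If G is the potential operator and G_\<beta> its resolvent, with kernel exp (- \<beta>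
  (\<tau> z - \<tau> w)) k z w, then \<open>step \<beta>\<close> is \<beta> G_\<beta>, an averaging
  operator of mass less than one.\<close>

definition step :: "real \<Rightarrow> ('a \<Rightarrow> ennreal) \<Rightarrow> 'a \<Rightarrow> ennreal" where
  "step \<beta> f z = (\<integral>\<^sup>+w. ennreal (\<beta> * exp (- \<beta> * (\<tau> z - \<tau> w))) * k z w * f w \<partial>M)"

lemma k_meas1 [measurable]: "z \<in> space M \<Longrightarrow> k z \<in> borel_measurable M"
  by measurable

lemma potential_measurable [measurable]:
  assumes [measurable]: "f \<in> borel_measurable M" shows "potential f \<in> borel_measurable M"
  unfolding potential_def by measurable

lemma step_measurable [measurable]:
  assumes [measurable]: "f \<in> borel_measurable M" shows "step \<beta> f \<in> borel_measurable M"
  unfolding step_def by measurable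

lemma step_mono: "(\<And>w. w \<in> space M \<Longrightarrow> f w \<le> g w) \<Longrightarrow> step \<beta> f z \<le> step \<beta> g z"
  unfolding step_def by (intro nn_integral_mono mult_left_mono) auto

lemma step_add:
  assumes "f \<in> borel_measurable M" "g \<in> borel_measurable M" "z \<in> space M"
  shows "step \<beta> (\<lambda>w. f w + g w) z = step \<beta> f z + step \<beta> g z"
  unfolding step_def using assms by (subst nn_integral_add[symmetric]) (auto simp: distrib_left)

lemma step_cmult:
  assumes "f \<in> borel_measurable M" "z \<in> space M"
  shows "step \<beta> (\<lambda>w. c * f w) z = c * step \<beta> f z"
  unfolding step_def using assms by (subst nn_integral_cmult[symmetric]) (auto simp: mult_ac)

lemma step_const:
  assumes "0 < \<beta>" "z \<in> space M"
  shows "step \<beta> (\<lambda>w. c) z \<le> c * ennreal (1 - exp (- \<beta> * S))"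
proof -
  have "step \<beta> (\<lambda>w. c) z = c * step \<beta> (\<lambda>w. 1) z" using step_cmult[of "\<lambda>_. 1" z \<beta> c] assms by simp
  also have "\<dots> \<le> c * ennreal (1 - exp (- \<beta> * S))"
    using k_resolvent_mass[OF assms(1), of z] by (intro mult_left_mono) (auto simp: step_def)
  finally show ?thesis .
qed

lemma step_potential:
  assumes [measurable]: "f \<in> borel_measurable M" and z: "z \<in> space M" and l: "0 < \<beta>"
  shows "step \<beta> (potential f) z + (\<integral>\<^sup>+\<zeta>. ennreal (exp (- \<beta> * (\<tau> z - \<tau> \<zeta>))) * k z \<zeta> * f \<zeta> \<partial>M) = potential f z"
proof -
  note [measurable] = k_meas1[OF z]
  have "step \<beta> (potential f) z =
    (\<integral>\<^sup>+w. \<integral>\<^sup>+\<zeta>. ennreal (\<beta> * exp (- \<beta> * (\<tau> z - \<tau> w))) * k z w * k w \<zeta> * f \<zeta> \<partial>M \<partial>M)"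
    unfolding step_def potential_def
    by (intro nn_integral_cong) (subst nn_integral_cmult[symmetric], auto simp: mult_ac)
  also have "\<dots> = (\<integral>\<^sup>+\<zeta>. \<integral>\<^sup>+w. ennreal (\<beta> * exp (- \<beta> * (\<tau> z - \<tau> w))) * k z w * k w \<zeta> * f \<zeta> \<partial>M \<partial>M)"
  proof -
    interpret pair_sigma_finite M M ..
    show ?thesis by (rule Fubini') measurable
  qed
  also have "\<dots> = (\<integral>\<^sup>+\<zeta>. (\<integral>\<^sup>+w. ennreal (\<beta> * exp (- \<beta> * (\<tau> z - \<tau> w))) * k z w * k w \<zeta> \<partial>M) * f \<zeta> \<partial>M)"
    by (intro nn_integral_cong nn_integral_multc) measurable
  finally have "step \<beta> (potential f) z + (\<integral>\<^sup>+\<zeta>. ennreal (exp (- \<beta> * (\<tau> z - \<tau> \<zeta>))) * k z \<zeta> * f \<zeta> \<partial>M)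
    = (\<integral>\<^sup>+\<zeta>. (\<integral>\<^sup>+w. ennreal (\<beta> * exp (- \<beta> * (\<tau> z - \<tau> w))) * k z w * k w \<zeta> \<partial>M) * f \<zeta>
         + ennreal (exp (- \<beta> * (\<tau> z - \<tau> \<zeta>))) * k z \<zeta> * f \<zeta> \<partial>M)"
    by (simp, subst nn_integral_add) measurable
  also have "\<dots> = potential f z"
    unfolding distrib_right[symmetric] k_resolvent[OF l] potential_def ..
  finally show ?thesis .
qed

lemma step_potential_add:
  assumes [measurable]: "f \<in> borel_measurable M" and z: "z \<in> space M" and l: "0 < \<beta>"
  shows "step \<beta> (\<lambda>w. potential f w + ennreal (1 / \<beta>) * f w) z = potential f z"
proof -
  have "ennreal (1 / \<beta>) * step \<beta> f z = (\<integral>\<^sup>+\<zeta>. ennreal (1 / \<beta>) * (ennreal (\<beta> * exp (- \<beta> * (\<tau> z - \<tau> \<zeta>))) * k z \<zeta> * f \<zeta>) \<partial>M)"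
    unfolding step_def using k_meas1[OF z] by (subst nn_integral_cmult[symmetric]) auto
  also have "\<dots> = (\<integral>\<^sup>+\<zeta>. ennreal (exp (- \<beta> * (\<tau> z - \<tau> \<zeta>))) * k z \<zeta> * f \<zeta> \<partial>M)"
  proof (rule nn_integral_cong)
    fix \<zeta>
    have "ennreal (1 / \<beta>) * ennreal (\<beta> * exp (- \<beta> * (\<tau> z - \<tau> \<zeta>))) = ennreal (exp (- \<beta> * (\<tau> z - \<tau> \<zeta>)))"
      using l by (simp add: ennreal_mult[symmetric])
    then show "ennreal (1 / \<beta>) * (ennreal (\<beta> * exp (- \<beta> * (\<tau> z - \<tau> \<zeta>))) * k z \<zeta> * f \<zeta>) =
        ennreal (exp (- \<beta> * (\<tau> z - \<tau> \<zeta>))) * k z \<zeta> * f \<zeta>"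
      by (simp only: mult.assoc[symmetric])
  qed
  finally show ?thesis
    using step_potential[OF assms] by (simp add: step_add step_cmult z)
qed

text \<open>The finite time horizon \<open>S\<close> bounds the mass of \<open>step \<beta>\<close>
  by \<theta> = 1 - exp (- \<beta> S) < 1, so iterating the inequality forces
  \<open>e \<le> K * \<theta> ^ n\<close> for every n.\<close>

lemma step_subinvariant_eq_0:
  assumes [measurable]: "e \<in> borel_measurable M" and l: "0 < \<beta>"
    and e: "\<And>z. z \<in> space M \<Longrightarrow> e z \<le> step \<beta> e z" and K: "\<And>z. z \<in> space M \<Longrightarrow> e z \<le> ennreal K" "0 \<le> K"
    and z: "z \<in> space M"
  shows "e z = 0"
proof -
  define \<theta> where "\<theta> = 1 - exp (- \<beta> * S)"
  have th: "0 \<le> \<theta>" "\<theta> < 1" using l S_pos by (auto simp: \<theta>_def)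
  have bd: "e z \<le> ennreal (K * \<theta> ^ n)" if "z \<in> space M" for n z
    using that
  proof (induction n arbitrary: z)
    case 0
    then show ?case using K by simp
  next
    case (Suc n)
    have "e z \<le> step \<beta> e z" using e Suc by blast
    also have "\<dots> \<le> step \<beta> (\<lambda>_. ennreal (K * \<theta> ^ n)) z" by (rule step_mono) (rule Suc)
    also have "\<dots> \<le> ennreal (K * \<theta> ^ n) * ennreal \<theta>" unfolding \<theta>_def by (rule step_const[OF l Suc(2)])
    also have "\<dots> = ennreal (K * \<theta> ^ Suc n)" using K th by (simp add: ennreal_mult[symmetric] mult_ac)
    finally show ?case .
  qed
  have "(\<lambda>n. K * \<theta> ^ n) \<longlonglongrightarrow> K * 0" using th by (intro tendsto_intros LIMSEQ_realpow_zero) auto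
  then have "(\<lambda>n. ennreal (K * \<theta> ^ n)) \<longlonglongrightarrow> ennreal 0" by (intro tendsto_ennrealI) simp
  then have "e z \<le> ennreal 0" by (rule LIMSEQ_le_const) (use bd z in auto)
  then show ?thesis by simp
qed

text \<open>With \<open>F h = potential h + h / \<beta>\<close> one has \<open>step \<beta> (F h) = potential h\<close>. The positive part of
  \<open>F f - (F g + C / \<beta>)\<close> vanishes where \<open>f > 0\<close> and is subinvariant under \<open>step \<beta>\<close> elsewhere,
  so it is zero; then \<open>\<beta> \<rightarrow> \<infinity>\<close>.\<close>

lemma domination_bounded:
  assumes [measurable]: "f \<in> borel_measurable M" "g \<in> borel_measurable M"
    and f: "\<And>z. z \<in> space M \<Longrightarrow> f z \<le> ennreal C" and C: "0 \<le> C"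
    and g: "\<And>z. z \<in> space M \<Longrightarrow> g z < \<infinity>"
    and le: "\<And>z. z \<in> space M \<Longrightarrow> 0 < f z \<Longrightarrow> potential f z \<le> potential g z"
    and z: "z \<in> space M"
  shows "potential f z \<le> potential g z"
proof -
  have main: "potential f z \<le> potential g z + ennreal (1 / \<beta>) * g z + ennreal (C / \<beta>)"
    if l: "0 < \<beta>" and z: "z \<in> space M" for \<beta> z
  proof -
    define F where "F h w = potential h w + ennreal (1 / \<beta>) * h w" for h w
    define e where "e w = F f w - (F g w + ennreal (C / \<beta>))" for w
    have Fm [measurable]: "F f \<in> borel_measurable M" "F g \<in> borel_measurable M"
      unfolding F_def by measurable
    have em [measurable]: "e \<in> borel_measurable M" unfolding e_def by measurable
    have fl: "ennreal (1 / \<beta>) * f w \<le> ennreal (C / \<beta>)" if "w \<in> space M" for w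
    proof -
      have "ennreal (1 / \<beta>) * f w \<le> ennreal (1 / \<beta>) * ennreal C" by (intro mult_left_mono f that) auto
      then show ?thesis using l C by (simp add: ennreal_mult[symmetric])
    qed
    have Ff: "F f w \<le> ennreal (S * C + C / \<beta>)" if w: "w \<in> space M" for w
    proof -
      have "potential f w \<le> (\<integral>\<^sup>+\<zeta>. k w \<zeta> * ennreal C \<partial>M)"
        unfolding potential_def by (intro nn_integral_mono mult_left_mono f) auto
      also have "\<dots> = (\<integral>\<^sup>+\<zeta>. k w \<zeta> \<partial>M) * ennreal C" using k_meas1[OF w] by (rule nn_integral_multc)
      also have "\<dots> \<le> ennreal S * ennreal C" by (intro mult_right_mono k_mass) auto
      finally have "F f w \<le> ennreal (S * C) + ennreal (C / \<beta>)"
        unfolding F_def using fl[OF w] S_pos C by (intro add_mono) (auto simp: ennreal_mult)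
      then show ?thesis using S_pos C l by simp
    qed
    have sub: "F f w \<le> F g w + ennreal (C / \<beta>) + e w" if "w \<in> space M" for w
      unfolding e_def using ennreal_minus_le_iff[THEN iffD1, OF order_refl, THEN conjunct1] by blast
    have "e w = 0" if w: "w \<in> space M" for w
    proof (rule step_subinvariant_eq_0[OF em l _ _ _ w])
      show "e z \<le> ennreal (S * C + C / \<beta>)" if "z \<in> space M" for z
        unfolding e_def using Ff[OF that] diff_le_self_ennreal order_trans by blast
      show "0 \<le> S * C + C / \<beta>" using S_pos C l by simp
      fix z assume z: "z \<in> space M"
      show "e z \<le> step \<beta> e z"
      proof (cases "f z = 0")
        case False
        then have "0 < f z" by (simp add: zero_less_iff_neq_zero)
        then have "F f z \<le> F g z + ennreal (C / \<beta>)"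
          unfolding F_def using le[OF z] fl[OF z] by (intro add_mono order_trans[OF le]) (auto simp: z add_increasing2)
        then have "e z = 0" unfolding e_def using Ff[OF z] by (intro diff_eq_0_ennreal) (auto simp: le_less_trans)
        then show ?thesis by simp
      next
        case True
        \<comment> \<open>Where \<open>f\<close> vanishes, \<open>F f\<close> equals its own
          average, while averaging increases neither \<open>F g\<close> nor the constant. The excess
          \<open>e\<close> is therefore at most its average.\<close>
        have "F f z = step \<beta> (F f) z"
          using step_potential_add[OF assms(1) z l] True unfolding F_def by simp
        also have "\<dots> \<le> step \<beta> (\<lambda>w. F g w + (ennreal (C / \<beta>) + e w)) z"
          using sub by (intro step_mono) (simp add: add.assoc)
        also have "\<dots> = step \<beta> (F g) z + (step \<beta> (\<lambda>_. ennreal (C / \<beta>)) z + step \<beta> e z)"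
          by (simp add: step_add z)
        also have "step \<beta> (F g) z \<le> F g z"
          using step_potential_add[OF assms(2) z l] unfolding F_def by (simp add: add_increasing2)
        also have "step \<beta> (\<lambda>_. ennreal (C / \<beta>)) z \<le> ennreal (C / \<beta>)"
        proof -
          have "step \<beta> (\<lambda>_. ennreal (C / \<beta>)) z \<le> ennreal (C / \<beta>) * ennreal (1 - exp (- \<beta> * S))" by (rule step_const[OF l z])
          also have "\<dots> \<le> ennreal (C / \<beta>) * 1" by (intro mult_left_mono) auto
          finally show ?thesis by simp
        qed
        finally have "F f z \<le> (F g z + ennreal (C / \<beta>)) + step \<beta> e z" by (simp add: add.assoc add_mono)
        moreover have "F f z < \<infinity>" using Ff[OF z] by (simp add: le_less_trans)
        ultimately show ?thesis unfolding e_def by (auto simp: ennreal_minus_le_iff)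
      qed
    qed
    then have "F f z \<le> F g z + ennreal (C / \<beta>)" using sub[OF z] z by simp
    then show ?thesis unfolding F_def by (meson order_trans add_increasing2 zero_le order_refl)
  qed
  obtain G where G: "g z = ennreal G" "0 \<le> G" using g[OF z] by (cases "g z") auto
  show ?thesis
  proof (rule ennreal_le_epsilon)
    fix \<epsilon> :: real assume e: "0 < \<epsilon>"
    define \<beta> where "\<beta> = (G + C + 1) / \<epsilon>"
    have l: "0 < \<beta>" using e C G by (simp add: \<beta>_def)
    have "ennreal (1 / \<beta>) * g z + ennreal (C / \<beta>) = ennreal ((G + C) / \<beta>)"
      using l G C by (simp add: ennreal_mult[symmetric] ennreal_plus[symmetric] add_divide_distrib del: ennreal_plus)
    also have "\<dots> \<le> ennreal \<epsilon>"
      using e C G l by (intro ennreal_leI) (simp add: \<beta>_def field_simps)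
    finally show "potential f z \<le> potential g z + ennreal \<epsilon>"
      using main[OF l z] by (simp add: add.assoc) (meson add_left_mono order_trans)
  qed
qed

text \<open>The truncations \<open>min f n\<close> increase to \<open>f\<close>. Each inherits the
  hypothesis, being positive only where \<open>f\<close> is and having the smaller
  potential.\<close>

theorem domination:
  assumes [measurable]: "f \<in> borel_measurable M" "g \<in> borel_measurable M"
    and f: "\<And>z. z \<in> space M \<Longrightarrow> f z < \<infinity>" and g: "\<And>z. z \<in> space M \<Longrightarrow> g z < \<infinity>"
    and le: "\<And>z. z \<in> space M \<Longrightarrow> 0 < f z \<Longrightarrow> potential f z \<le> potential g z"
    and z: "z \<in> space M"
  shows "potential f z \<le> potential g z"
proof -
  define fn where "fn n w = min (f w) (ennreal (real n))" for n w
  have [measurable]: "fn n \<in> borel_measurable M" for n unfolding fn_def by measurable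
  have fn: "potential (fn n) z \<le> potential g z" if z: "z \<in> space M" for n z
  proof (rule domination_bounded[OF _ _ _ _ g _ z, where C="real n"])
    fix w assume w: "w \<in> space M" "0 < fn n w"
    have "potential (fn n) w \<le> potential f w"
      unfolding potential_def fn_def by (intro nn_integral_mono mult_left_mono) auto
    also have "\<dots> \<le> potential g w" using w by (intro le) (auto simp: fn_def)
    finally show "potential (fn n) w \<le> potential g w" .
  qed (auto simp: fn_def)
  have sup: "f w = (SUP n. fn n w)" if w: "w \<in> space M" for w
  proof (rule antisym)
    obtain r where r: "f w = ennreal r" "0 \<le> r" using f[OF w] by (cases "f w") auto
    obtain n where "r \<le> real n" using real_arch_simple by blast
    then have "f w = fn n w" by (simp add: fn_def r min_def ennreal_leI)
    then show "f w \<le> (SUP n. fn n w)" by (metis SUP_upper UNIV_I)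
    show "(SUP n. fn n w) \<le> f w" by (intro SUP_least) (simp add: fn_def)
  qed
  have "potential f z = (\<integral>\<^sup>+\<zeta>. (SUP n. k z \<zeta> * fn n \<zeta>) \<partial>M)"
    unfolding potential_def by (intro nn_integral_cong) (simp add: sup SUP_mult_left_ennreal)
  also have "\<dots> = (SUP n. \<integral>\<^sup>+\<zeta>. k z \<zeta> * fn n \<zeta> \<partial>M)"
  proof (rule nn_integral_monotone_convergence_SUP)
    show "incseq (\<lambda>n \<zeta>. k z \<zeta> * fn n \<zeta>)"
      unfolding fn_def by (intro monoI le_funI mult_left_mono min.mono ennreal_leI) auto
  qed (use k_meas1[OF z] in measurable)
  also have "\<dots> \<le> potential g z"
    using fn[OF z] unfolding potential_def by (intro SUP_least)
  finally show ?thesis .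
qed

end

section \<open>Gaussian kernels with increasing covariance\<close>

lemma borel_measurable_fst_comp [measurable (raw)]:
  fixes f :: "'a \<Rightarrow> 'b::second_countable_topology \<times> 'c::second_countable_topology"
  assumes "f \<in> borel_measurable M" shows "(\<lambda>x. fst (f x)) \<in> borel_measurable M"
  using measurable_compose[OF assms, of fst borel] by (simp add: borel_prod[symmetric])

lemma borel_measurable_snd_comp [measurable (raw)]:
  fixes f :: "'a \<Rightarrow> 'b::second_countable_topology \<times> 'c::second_countable_topology"
  assumes "f \<in> borel_measurable M" shows "(\<lambda>x. snd (f x)) \<in> borel_measurable M"
  using measurable_compose[OF assms, of snd borel] by (simp add: borel_prod[symmetric])

section \<open>Continuous dependence of determinants, inverses and Gaussians on the matrix\<close>

lemma continuous_on_det: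
  fixes M :: "'a::topological_space \<Rightarrow> real^'n^'n"
  assumes "continuous_on X M"
  shows "continuous_on X (\<lambda>x. det (M x))"
  unfolding det_def using assms by (intro continuous_intros) auto

text \<open>Cramer's rule expresses the inverse through determinants, which reduces its continuity
  to that of polynomials.\<close>

lemma matrix_inv_cramer:
  fixes M :: "real^'n^'n"
  assumes "det M \<noteq> 0"
  shows "matrix_inv M *v b = (\<chi> k. det (\<chi> i j. if j = k then b $ i else M $ i $ j) / det M)"
proof -
  have "invertible M" using assms by (simp add: invertible_det_nz)
  then have "M *v (matrix_inv M *v b) = b" by (rule matrix_inv_mult_vec)
  then show ?thesis using cramer[OF assms] by blast
qed

lemma continuous_on_matrix_inv_vec:
  fixes M :: "'a::topological_space \<Rightarrow> real^'n^'n"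
  assumes M: "continuous_on X M" and b: "continuous_on X b" and nz: "\<And>x. x \<in> X \<Longrightarrow> det (M x) \<noteq> 0"
  shows "continuous_on X (\<lambda>x. matrix_inv (M x) *v b x)"
proof -
  have "continuous_on X (\<lambda>x. if j = k then b x $ i else M x $ i $ j)" for i j k
    using M b by (cases "j = k") (auto intro!: continuous_intros)
  then have "continuous_on X (\<lambda>x. \<chi> i j. if j = k then b x $ i else M x $ i $ j)" for k
    by (intro continuous_on_vec_lambda)
  note d = continuous_on_det[OF this]
  have "continuous_on X (\<lambda>x. det (\<chi> i j. if j = k then b x $ i else M x $ i $ j) / det (M x))" for k
    using nz by (rule continuous_on_divide[OF d continuous_on_det[OF M], rule_format])
  then have "continuous_on X (\<lambda>x. \<chi> k. det (\<chi> i j. if j = k then b x $ i else M x $ i $ j) / det (M x))"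
    by (rule continuous_on_vec_lambda)
  moreover have "continuous_on X (\<lambda>x. matrix_inv (M x) *v b x) \<longleftrightarrow>
      continuous_on X (\<lambda>x. \<chi> k. det (\<chi> i j. if j = k then b x $ i else M x $ i $ j) / det (M x))"
    using nz by (intro continuous_on_cong) (auto simp: matrix_inv_cramer)
  ultimately show ?thesis by simp
qed

lemma continuous_on_mult_vec:
  fixes M :: "'a::topological_space \<Rightarrow> real^'n^'m"
  assumes "continuous_on X M" "continuous_on X b"
  shows "continuous_on X (\<lambda>x. M x *v b x)"
  unfolding matrix_vector_mult_def using assms by (intro continuous_intros continuous_on_vec_lambda)

lemma continuous_on_gauss:
  fixes M :: "'a::topological_space \<Rightarrow> real^'n^'n"
  assumes M: "continuous_on X M" and b: "continuous_on X b" and pos: "\<And>x. x \<in> X \<Longrightarrow> spd (M x)"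
  shows "continuous_on X (\<lambda>x. gauss (M x) (b x))"
proof -
  have d: "0 < det (M x)" if "x \<in> X" for x using det_spd_pos pos that by blast
  have "continuous_on X (\<lambda>x. matrix_inv (M x) *v b x)"
    using d by (intro continuous_on_matrix_inv_vec M b) force
  moreover have "det (M x) \<noteq> 0" if "x \<in> X" for x using d[OF that] by simp
  ultimately show ?thesis unfolding gauss_def
    by (intro continuous_intros continuous_on_det M b) auto
qed

lemma nn_integral_exp_interval:
  assumes "a \<le> b" "0 < \<beta>"
  shows "(\<integral>\<^sup>+u. ennreal (\<beta> * exp (- \<beta> * (b - u))) * indicator {a<..<b} u \<partial>lborel) = ennreal (1 - exp (- \<beta> * (b - a)))"
proof -
  have "(\<integral>\<^sup>+u. ennreal (\<beta> * exp (- \<beta> * (b - u))) * indicator {a<..<b} u \<partial>lborel) =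
     (\<integral>\<^sup>+u. ennreal (\<beta> * exp (- \<beta> * (b - u))) * indicator {a..b} u \<partial>lborel)"
  proof (rule nn_integral_cong_AE)
    show "AE u in lborel. ennreal (\<beta> * exp (- \<beta> * (b - u))) * indicator {a<..<b} u =
       ennreal (\<beta> * exp (- \<beta> * (b - u))) * indicator {a..b} u"
      using AE_lborel_singleton[of a] AE_lborel_singleton[of b]
      by eventually_elim (auto simp: indicator_def)
  qed
  also have "\<dots> = ennreal (exp (- \<beta> * (b - b)) - exp (- \<beta> * (b - a)))"
    by (rule nn_integral_FTC_Icc) (use assms in \<open>auto intro!: derivative_eq_intros\<close>)
  finally show ?thesis by simp
qed

lemma nn_integral_lborel_pair:
  fixes f :: "'a::euclidean_space \<times> 'b::euclidean_space \<Rightarrow> ennreal"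
  assumes [measurable]: "f \<in> borel_measurable borel"
  shows "(\<integral>\<^sup>+z. f z \<partial>lborel) = (\<integral>\<^sup>+t. \<integral>\<^sup>+x. f (x, t) \<partial>lborel \<partial>lborel)"
proof -
  have [measurable]: "f \<in> borel_measurable (lborel \<Otimes>\<^sub>M lborel)" by (simp add: lborel_prod)
  show ?thesis
    unfolding lborel_prod[symmetric] by (rule lborel_pair.nn_integral_snd[symmetric]) measurable
qed

text \<open>The operator with its drift removed. \<open>P\<close> is the time-dependent diffusion
  matrix and may be degenerate; nondegeneracy survives only in the increments of its primitive
  \<open>C\<close>. For the Kolmogorov matrices \<open>N\<close> is the homogeneous dimension minus
  2.\<close>

locale frame =
  fixes C P :: "real \<Rightarrow> real^'n^'n" and N :: nat
  assumes C_0: "C 0 = 0"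
    and C_deriv: "\<And>t. (C has_vector_derivative P t) (at t)"
    and P_cont: "continuous_on UNIV P"
    and P_sym: "\<And>t. transpose (P t) = P t"
    and P_nonneg: "\<And>t x. 0 \<le> (P t *v x) \<bullet> x"
    and C_spd: "\<And>s t. s < t \<Longrightarrow> spd (C t - C s)"
    and N_pos: "0 < N"
    and det_C: "\<And>t. 0 < t \<Longrightarrow> det (C t) = det (C 1) * t ^ N"
begin

lemma C_cont: "continuous_on X C"
  using C_deriv has_vector_derivative_continuous continuous_at_imp_continuous_on by blast

lemma C_spd0: "0 < t \<Longrightarrow> spd (C t)"
  using C_spd[of 0 t] by (simp add: C_0)

text \<open>Frame time runs against the original time: \<open>kern z \<zeta>\<close> stands for
  \<Gamma>(\<zeta>, z) and is nonzero when \<open>z\<close> has the later frame time.\<close>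

definition kern :: "(real^'n) \<times> real \<Rightarrow> (real^'n) \<times> real \<Rightarrow> real" where
  "kern z \<zeta> = (if snd \<zeta> < snd z then gauss (C (snd z) - C (snd \<zeta>)) (fst \<zeta> - fst z) else 0)"

lemma kern_nonneg: "0 \<le> kern z \<zeta>"
  by (simp add: kern_def gauss_pos C_spd less_imp_le)

lemma kern_pos: "snd \<zeta> < snd z \<Longrightarrow> 0 < kern z \<zeta>"
  by (simp add: kern_def gauss_pos C_spd)

lemma kern_measurable [measurable]: "case_prod kern \<in> borel_measurable borel"
proof -
  let ?A = "{x :: ((real^'n) \<times> real) \<times> (real^'n) \<times> real. snd (snd x) < snd (fst x)}"
  have op: "open ?A" by (intro open_Collect_less continuous_intros)
  have "(\<lambda>x. if x \<in> ?A then gauss (C (snd (fst x)) - C (snd (snd x))) (fst (snd x) - fst (fst x)) else 0) \<in> borel_measurable borel"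
  proof (rule borel_measurable_continuous_on_if)
    show "?A \<in> sets borel" using op by (rule borel_open)
    have c: "continuous_on X (\<lambda>x. C (f x))" if "continuous_on X f" for X and f :: "((real^'n) \<times> real) \<times> (real^'n) \<times> real \<Rightarrow> real"
      using continuous_on_compose2[OF C_cont[of UNIV] that] by simp
    show "continuous_on ?A (\<lambda>x. gauss (C (snd (fst x)) - C (snd (snd x))) (fst (snd x) - fst (fst x)))"
      by (intro continuous_on_gauss continuous_intros c) (auto intro: C_spd)
  qed simp
  also have "(\<lambda>x. if x \<in> ?A then gauss (C (snd (fst x)) - C (snd (snd x))) (fst (snd x) - fst (fst x)) else 0) = case_prod kern"
    by (auto simp: kern_def fun_eq_iff)
  finally show ?thesis .
qed

lemma kern_measurable' [measurable (raw)]: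
  assumes "f \<in> borel_measurable M" "g \<in> borel_measurable M"
  shows "(\<lambda>x. kern (f x) (g x)) \<in> borel_measurable M"
proof -
  have "(\<lambda>x. (f x, g x)) \<in> M \<rightarrow>\<^sub>M borel"
    using assms by (simp add: borel_prod[symmetric])
  from measurable_compose[OF this kern_measurable] show ?thesis by simp
qed

lemma nn_integral_kern_source:
  assumes "snd z > s"
  shows "(\<integral>\<^sup>+\<eta>. ennreal (kern z (\<eta>, s)) \<partial>lborel) = 1"
  using nn_integral_gauss[OF C_spd[OF assms], of "fst z"] assms by (simp add: kern_def)

lemma nn_integral_kern_target:
  assumes "snd \<zeta> < t"
  shows "(\<integral>\<^sup>+y. ennreal (kern (y, t) \<zeta>) \<partial>lborel) = 1"
  using nn_integral_gauss[OF C_spd[OF assms], of "fst \<zeta>"] assms by (simp add: kern_def gauss_commute[of _ "fst \<zeta>"])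

lemma kern_chapman_kolmogorov:
  assumes "snd \<zeta> < u" "u < snd z"
  shows "(\<integral>\<^sup>+y. ennreal (kern z (y, u)) * ennreal (kern (y, u) \<zeta>) \<partial>lborel) = ennreal (kern z \<zeta>)"
proof -
  have "(\<integral>\<^sup>+y. ennreal (gauss (C u - C (snd \<zeta>)) (fst \<zeta> - y)) * ennreal (gauss (C (snd z) - C u) (y - fst z)) \<partial>lborel)
     = ennreal (gauss ((C u - C (snd \<zeta>)) + (C (snd z) - C u)) (fst \<zeta> - fst z))"
    using assms by (intro gauss_convolution C_spd)
  then show ?thesis using assms by (simp add: kern_def mult.commute)
qed

text \<open>A positive solution of the same backward equation as \<open>kern z\<close>, whose level surfaces are
  close to those of the fundamental solution with pole \<open>0\<close>.\<close>

definition revg :: "real \<Rightarrow> (real^'n) \<times> real \<Rightarrow> real" where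
  "revg \<delta> z = (if 0 \<le> snd z then reverse_gauss (C (snd z) + \<delta> *\<^sub>R mat 1) (fst z) else 0)"

lemma C_shift_spd: "0 \<le> s \<Longrightarrow> 0 < \<delta> \<Longrightarrow> spd (C s + \<delta> *\<^sub>R mat 1)"
  by (cases "s = 0") (auto simp: C_0 intro!: spd_add spd_scaleR spd_mat_1 C_spd0)

lemma revg_nonneg: "0 < \<delta> \<Longrightarrow> 0 \<le> revg \<delta> z"
  by (simp add: revg_def reverse_gauss_pos C_shift_spd less_imp_le)

lemma revg_measurable [measurable]:
  assumes "0 < \<delta>" shows "revg \<delta> \<in> borel_measurable borel"
proof -
  let ?A = "{z :: (real^'n) \<times> real. 0 \<le> snd z}"
  have cl: "closed ?A" by (intro closed_Collect_le continuous_intros)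
  have "(\<lambda>z. if z \<in> ?A then reverse_gauss (C (snd z) + \<delta> *\<^sub>R mat 1) (fst z) else 0) \<in> borel_measurable borel"
  proof (rule borel_measurable_continuous_on_if)
    show "?A \<in> sets borel" using cl by (rule borel_closed)
    have d: "0 < det (C (snd z) + \<delta> *\<^sub>R mat 1)" if "z \<in> ?A" for z
      using C_shift_spd[of "snd z" \<delta>] det_spd_pos assms that by blast
    have c: "continuous_on ?A (\<lambda>z. C (snd z) + \<delta> *\<^sub>R mat 1)"
      by (intro continuous_intros continuous_on_compose2[OF C_cont[of UNIV]]) auto
    have "continuous_on ?A (\<lambda>z. matrix_inv (C (snd z) + \<delta> *\<^sub>R mat 1) *v fst z)"
      using d by (intro continuous_on_matrix_inv_vec c continuous_intros) force
    moreover have "det (C (snd z) + \<delta> *\<^sub>R mat 1) \<noteq> 0" if "z \<in> ?A" for z using d[OF that] by simp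
    ultimately show "continuous_on ?A (\<lambda>z. reverse_gauss (C (snd z) + \<delta> *\<^sub>R mat 1) (fst z))"
      unfolding reverse_gauss_def by (intro continuous_intros continuous_on_det c) auto
  qed simp
  also have "(\<lambda>z. if z \<in> ?A then reverse_gauss (C (snd z) + \<delta> *\<^sub>R mat 1) (fst z) else 0) = revg \<delta>"
    by (auto simp: revg_def fun_eq_iff)
  finally show ?thesis .
qed

text \<open>The covariance C t + \<delta> I loses the increment C t - C s and becomes C s + \<delta>
  I. The shift keeps this positive definite at s = 0 as well, so the pole (0, 0) is
  included.\<close>

lemma nn_integral_kern_revg:
  assumes "0 < \<delta>" "0 \<le> snd \<zeta>" "snd \<zeta> < t"
  shows "(\<integral>\<^sup>+y. ennreal (kern (y, t) \<zeta>) * ennreal (revg \<delta> (y, t)) \<partial>lborel) = ennreal (revg \<delta> \<zeta>)"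
proof -
  let ?K = "C t + \<delta> *\<^sub>R mat 1"
  have eq: "?K - (C t - C (snd \<zeta>)) = C (snd \<zeta>) + \<delta> *\<^sub>R mat 1" by simp
  have "(\<integral>\<^sup>+y. ennreal (gauss (C t - C (snd \<zeta>)) (fst \<zeta> - y)) * ennreal (reverse_gauss ?K y) \<partial>lborel)
     = ennreal (reverse_gauss (?K - (C t - C (snd \<zeta>))) (fst \<zeta>))"
    by (rule gauss_reverse_gauss) (unfold eq, use assms in \<open>auto intro: C_spd C_shift_spd\<close>)
  then show ?thesis unfolding eq using assms by (simp add: kern_def revg_def)
qed

text \<open>Targets at times \<open>\<le> 0\<close> and starting points at times \<open>\<ge> S\<close> are cut off, so that the mass is
  at most \<open>S\<close>.\<close>

definition kernS :: "real \<Rightarrow> (real^'n) \<times> real \<Rightarrow> (real^'n) \<times> real \<Rightarrow> ennreal" where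
  "kernS S z \<zeta> = (if 0 < snd \<zeta> \<and> snd z < S then ennreal (kern z \<zeta>) else 0)"

lemma kernS_measurable [measurable]: "case_prod (kernS S) \<in> borel_measurable borel"
proof -
  have "case_prod (kernS S) = (\<lambda>x. if 0 < snd (snd x) \<and> snd (fst x) < S then ennreal (kern (fst x) (snd x)) else 0)"
    by (auto simp: fun_eq_iff kernS_def)
  moreover have "\<dots> \<in> borel_measurable borel"
    by measurable
  ultimately show ?thesis by simp
qed

lemma kernS_measurable' [measurable (raw)]:
  assumes "f \<in> borel_measurable M" "g \<in> borel_measurable M"
  shows "(\<lambda>x. kernS S (f x) (g x)) \<in> borel_measurable M"
proof -
  have "(\<lambda>x. (f x, g x)) \<in> M \<rightarrow>\<^sub>M borel"
    using assms by (simp add: borel_prod[symmetric])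
  from measurable_compose[OF this kernS_measurable] show ?thesis by simp
qed

lemma kernS_mass:
  assumes "0 < \<beta>" "snd z < S"
  shows "(\<integral>\<^sup>+w. ennreal (\<beta> * exp (- \<beta> * (snd z - snd w))) * kernS S z w \<partial>lborel) =
    (if 0 < snd z then ennreal (1 - exp (- \<beta> * snd z)) else 0)"
proof -
  have "(\<integral>\<^sup>+w. ennreal (\<beta> * exp (- \<beta> * (snd z - snd w))) * kernS S z w \<partial>lborel) =
    (\<integral>\<^sup>+u. \<integral>\<^sup>+\<eta>. ennreal (\<beta> * exp (- \<beta> * (snd z - u))) * kernS S z (\<eta>, u) \<partial>lborel \<partial>lborel)"
    by (subst nn_integral_lborel_pair) auto
  also have "\<dots> = (\<integral>\<^sup>+u. ennreal (\<beta> * exp (- \<beta> * (snd z - u))) * indicator {0<..<snd z} u \<partial>lborel)"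
  proof (rule nn_integral_cong)
    fix u
    have "(\<integral>\<^sup>+\<eta>. kernS S z (\<eta>, u) \<partial>lborel) = indicator {0<..<snd z} u"
    proof (cases "0 < u \<and> u < snd z")
      case True
      then show ?thesis using nn_integral_kern_source[of u z] assms by (simp add: kernS_def)
    next
      case False
      then have "kernS S z (\<eta>, u) = 0" for \<eta> by (auto simp: kernS_def kern_def)
      then show ?thesis using False by simp
    qed
    then show "(\<integral>\<^sup>+\<eta>. ennreal (\<beta> * exp (- \<beta> * (snd z - u))) * kernS S z (\<eta>, u) \<partial>lborel) =
      ennreal (\<beta> * exp (- \<beta> * (snd z - u))) * indicator {0<..<snd z} u"
      by (subst nn_integral_cmult) auto
  qed
  also have "\<dots> = (if 0 < snd z then ennreal (1 - exp (- \<beta> * snd z)) else 0)"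
    using nn_integral_exp_interval[of 0 "snd z" \<beta>] assms by auto
  finally show ?thesis .
qed

text \<open>By Chapman-Kolmogorov the spatial integral in the resolvent equation does not depend on
  the intermediate time. What remains is the integral of \<beta> exp (- \<beta> (t - u)) between the
  two times, and it complements exp (- \<beta> (t - s)) to 1.\<close>

lemma causal_kernel_kernS:
  assumes S: "0 < S"
  shows "causal_kernel lborel (kernS S) snd S"
proof
  show "case_prod (kernS S) \<in> borel_measurable (lborel \<Otimes>\<^sub>M lborel)"
    by (simp add: lborel_prod)
  show "0 < S" by fact
  show "(\<integral>\<^sup>+w. ennreal (\<beta> * exp (- \<beta> * (snd z - snd w))) * kernS S z w \<partial>lborel) \<le> ennreal (1 - exp (- \<beta> * S))"
    if b: "0 < \<beta>" for \<beta> z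
  proof (cases "snd z < S")
    case True
    then show ?thesis using b by (subst kernS_mass) (auto intro!: ennreal_leI)
  next
    case False
    then show ?thesis by (simp add: kernS_def)
  qed
  show "(\<integral>\<^sup>+\<zeta>. kernS S z \<zeta> \<partial>lborel) \<le> ennreal S" for z
  proof -
    have "(\<integral>\<^sup>+\<zeta>. kernS S z \<zeta> \<partial>lborel) = (\<integral>\<^sup>+u. \<integral>\<^sup>+\<eta>. kernS S z (\<eta>, u) \<partial>lborel \<partial>lborel)"
      by (subst nn_integral_lborel_pair) auto
    also have "\<dots> \<le> (\<integral>\<^sup>+u. indicator {0..S} u \<partial>lborel)"
    proof (rule nn_integral_mono)
      fix u
      show "(\<integral>\<^sup>+\<eta>. kernS S z (\<eta>, u) \<partial>lborel) \<le> indicator {0..S} u"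
      proof (cases "0 < u \<and> u < snd z \<and> snd z < S")
        case True
        then show ?thesis using nn_integral_kern_source[of u z] by (simp add: kernS_def)
      next
        case False
        then have "kernS S z (\<eta>, u) = 0" for \<eta> by (auto simp: kernS_def kern_def)
        then show ?thesis by simp
      qed
    qed
    also have "\<dots> = ennreal S" using S by simp
    finally show ?thesis .
  qed
  show "(\<integral>\<^sup>+w. ennreal (\<beta> * exp (- \<beta> * (snd z - snd w))) * kernS S z w * kernS S w \<zeta> \<partial>lborel)
      + ennreal (exp (- \<beta> * (snd z - snd \<zeta>))) * kernS S z \<zeta> = kernS S z \<zeta>" if b: "0 < \<beta>" for \<beta> z \<zeta>
  proof (cases "0 < snd \<zeta> \<and> snd \<zeta> < snd z \<and> snd z < S")
    case True
    have "(\<integral>\<^sup>+w. ennreal (\<beta> * exp (- \<beta> * (snd z - snd w))) * kernS S z w * kernS S w \<zeta> \<partial>lborel) =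
      (\<integral>\<^sup>+u. \<integral>\<^sup>+y. ennreal (\<beta> * exp (- \<beta> * (snd z - u))) * kernS S z (y, u) * kernS S (y, u) \<zeta> \<partial>lborel \<partial>lborel)"
      by (subst nn_integral_lborel_pair) auto
    also have "\<dots> = (\<integral>\<^sup>+u. ennreal (\<beta> * exp (- \<beta> * (snd z - u))) * indicator {snd \<zeta><..<snd z} u * ennreal (kern z \<zeta>) \<partial>lborel)"
    proof (rule nn_integral_cong)
      fix u
      have "(\<integral>\<^sup>+y. kernS S z (y, u) * kernS S (y, u) \<zeta> \<partial>lborel) = indicator {snd \<zeta><..<snd z} u * ennreal (kern z \<zeta>)"
      proof (cases "snd \<zeta> < u \<and> u < snd z")
        case in_range: True
        then show ?thesis using kern_chapman_kolmogorov[of \<zeta> u z] True by (simp add: kernS_def)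
      next
        case False
        then have "kernS S z (y, u) * kernS S (y, u) \<zeta> = 0" for y by (auto simp: kernS_def kern_def)
        then have "(\<integral>\<^sup>+y. kernS S z (y, u) * kernS S (y, u) \<zeta> \<partial>lborel) = (\<integral>\<^sup>+y. 0 \<partial>(lborel :: (real^'n) measure))"
          by (intro nn_integral_cong)
        then show ?thesis using False by (auto simp: indicator_def)
      qed
      then show "(\<integral>\<^sup>+y. ennreal (\<beta> * exp (- \<beta> * (snd z - u))) * kernS S z (y, u) * kernS S (y, u) \<zeta> \<partial>lborel)
        = ennreal (\<beta> * exp (- \<beta> * (snd z - u))) * indicator {snd \<zeta><..<snd z} u * ennreal (kern z \<zeta>)"
        by (simp add: mult.assoc, subst nn_integral_cmult) auto
    qed
    also have "\<dots> = ennreal (1 - exp (- \<beta> * (snd z - snd \<zeta>))) * ennreal (kern z \<zeta>)"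
      using nn_integral_exp_interval[of "snd \<zeta>" "snd z" \<beta>] True b by (subst nn_integral_multc) auto
    finally have "(\<integral>\<^sup>+w. ennreal (\<beta> * exp (- \<beta> * (snd z - snd w))) * kernS S z w * kernS S w \<zeta> \<partial>lborel)
      + ennreal (exp (- \<beta> * (snd z - snd \<zeta>))) * kernS S z \<zeta>
      = ennreal (1 - exp (- \<beta> * (snd z - snd \<zeta>))) * ennreal (kern z \<zeta>) + ennreal (exp (- \<beta> * (snd z - snd \<zeta>))) * ennreal (kern z \<zeta>)"
      using True by (simp add: kernS_def)
    also have "\<dots> = (ennreal (1 - exp (- \<beta> * (snd z - snd \<zeta>))) + ennreal (exp (- \<beta> * (snd z - snd \<zeta>)))) * ennreal (kern z \<zeta>)"
      by (simp only: distrib_right)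
    also have "ennreal (1 - exp (- \<beta> * (snd z - snd \<zeta>))) + ennreal (exp (- \<beta> * (snd z - snd \<zeta>))) = 1"
      using True b by (subst ennreal_plus[symmetric]) auto
    finally show ?thesis using True by (simp add: kernS_def)
  next
    case False
    then have "kernS S z w * kernS S w \<zeta> = 0" for w by (auto simp: kernS_def kern_def)
    then have "(\<integral>\<^sup>+w. ennreal (\<beta> * exp (- \<beta> * (snd z - snd w))) * kernS S z w * kernS S w \<zeta> \<partial>lborel) =
        (\<integral>\<^sup>+w. 0 \<partial>(lborel :: ((real^'n) \<times> real) measure))"
      by (intro nn_integral_cong) (simp only: mult.assoc mult_zero_right)
    then have "(\<integral>\<^sup>+w. ennreal (\<beta> * exp (- \<beta> * (snd z - snd w))) * kernS S z w * kernS S w \<zeta> \<partial>lborel) = 0"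
      by simp
    moreover have "kernS S z \<zeta> = 0" using False by (auto simp: kernS_def kern_def)
    ultimately show ?thesis by simp
  qed
qed simp_all

end

section \<open>Derivatives of Gaussians\<close>

lemma DERIV_matrix_entry:
  fixes X :: "real \<Rightarrow> real^'n^'m"
  assumes "(X has_vector_derivative X') (at s)"
  shows "((\<lambda>t. X t $ i $ j) has_real_derivative X' $ i $ j) (at s)"
proof -
  have X: "(X has_derivative (\<lambda>h. h *\<^sub>R X')) (at s)" using assms by (simp add: has_vector_derivative_def)
  show ?thesis
    by (rule has_derivative_imp_has_field_derivative[OF bounded_linear.has_derivative[OF bounded_linear_vec_nth,
          OF bounded_linear.has_derivative[OF bounded_linear_vec_nth, OF X]]]) simp
qed

text \<open>In the Leibniz formula a permutation other than the identity moves at least two indices.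
  Differentiating one factor leaves another off-diagonal one, which vanishes at the
  identity.\<close>

lemma DERIV_det_at_identity:
  fixes X :: "real \<Rightarrow> real^'n^'n"
  assumes X: "(X has_vector_derivative X') (at s)" and I: "X s = mat 1"
  shows "((\<lambda>t. det (X t)) has_real_derivative trace X') (at s)"
proof -
  have comp: "((\<lambda>t. X t $ i $ j) has_derivative (\<lambda>h. h * X' $ i $ j)) (at s)" for i j
  proof -
    have "(\<lambda>h. h * X' $ i $ j) = (*) (X' $ i $ j)" by (auto simp: mult.commute)
    then show ?thesis using DERIV_matrix_entry[OF X, of i j] by (simp add: has_field_derivative_def)
  qed
  let ?U = "UNIV :: 'n set"
  have prod: "((\<lambda>t. \<Prod>i\<in>?U. X t $ i $ p i) has_derivative
      (\<lambda>h. \<Sum>i\<in>?U. h * X' $ i $ p i * (\<Prod>j\<in>?U - {i}. X s $ j $ p j))) (at s)" for p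
    by (rule has_derivative_prod) (rule comp)
  have moved: "(\<Prod>j\<in>?U - {i}. X s $ j $ p j) = 0" if p: "p permutes ?U" "p \<noteq> id" for p i
  proof -
    obtain j where j: "p j \<noteq> j" using p(2) by (auto simp: fun_eq_iff)
    have "\<exists>k\<in>?U - {i}. p k \<noteq> k"
    proof (cases "j = i")
      case True
      then have "p (p j) \<noteq> p j" using j p(1) by (metis permutes_inverses(2))
      then show ?thesis using True j by auto
    qed (use j in auto)
    then obtain k where "k \<in> ?U - {i}" "p k \<noteq> k" by blast
    then show ?thesis by (auto simp: I mat_def intro!: prod_zero bexI[of _ k])
  qed
  have id: "(\<Prod>j\<in>?U - {i}. X s $ j $ id j) = 1" for i by (simp add: I mat_def)
  have "((\<lambda>t. det (X t)) has_derivative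
      (\<lambda>h. \<Sum>p | p permutes ?U. of_int (sign p) * (\<Sum>i\<in>?U. h * X' $ i $ p i * (\<Prod>j\<in>?U - {i}. X s $ j $ p j)))) (at s)"
    unfolding det_def by (intro has_derivative_sum has_derivative_mult_right prod)
  also have "(\<lambda>h. \<Sum>p | p permutes ?U. of_int (sign p) * (\<Sum>i\<in>?U. h * X' $ i $ p i * (\<Prod>j\<in>?U - {i}. X s $ j $ p j)))
     = (\<lambda>h. h * trace X')"
  proof
    fix h
    have "(\<Sum>p | p permutes ?U. of_int (sign p) * (\<Sum>i\<in>?U. h * X' $ i $ p i * (\<Prod>j\<in>?U - {i}. X s $ j $ p j)))
       = (\<Sum>p\<in>{id}. of_int (sign p) * (\<Sum>i\<in>?U. h * X' $ i $ p i * (\<Prod>j\<in>?U - {i}. X s $ j $ p j)))"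
      by (rule sum.mono_neutral_right) (auto simp: moved finite_permutations permutes_id)
    also have "\<dots> = h * trace X'"
      using id by (simp add: sign_id trace_def sum_distrib_left)
    finally show "(\<Sum>p | p permutes ?U. of_int (sign p) * (\<Sum>i\<in>?U. h * X' $ i $ p i * (\<Prod>j\<in>?U - {i}. X s $ j $ p j))) = h * trace X'" .
  qed
  finally show ?thesis by (simp add: has_field_derivative_def mult.commute[of _ "trace X'"])
qed

lemma bounded_linear_matrix_mult_left: "bounded_linear (\<lambda>X. A ** X)" for A :: "real^'n^'m"
  by (intro linear_conv_bounded_linear[THEN iffD1] linearI)
    (simp_all add: vec_eq_iff matrix_matrix_mult_def sum_distrib_left distrib_left sum.distrib mult_ac)

text \<open>Jacobi's formula: multiplying by the fixed inverse of \<open>M s\<close> reduces it to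
  the derivative at the identity.\<close>

lemma DERIV_det:
  fixes M :: "real \<Rightarrow> real^'n^'n"
  assumes M: "(M has_vector_derivative M') (at s)" and inv: "invertible (M s)"
  shows "((\<lambda>t. det (M t)) has_real_derivative det (M s) * trace (matrix_inv (M s) ** M')) (at s)"
proof -
  let ?X = "\<lambda>t. matrix_inv (M s) ** M t"
  have "(?X has_vector_derivative matrix_inv (M s) ** M') (at s)"
    by (rule bounded_linear.has_vector_derivative[OF bounded_linear_matrix_mult_left M])
  then have "((\<lambda>t. det (?X t)) has_real_derivative trace (matrix_inv (M s) ** M')) (at s)"
    by (rule DERIV_det_at_identity) (simp add: matrix_inv_mult[OF inv])
  then have "((\<lambda>t. det (M s) * det (?X t)) has_real_derivative det (M s) * trace (matrix_inv (M s) ** M')) (at s)"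
    by (rule DERIV_cmult)
  moreover have "det (M s) * det (?X t) = det (M t)" for t
    by (simp add: det_mul[symmetric] matrix_mul_assoc matrix_inv_mult[OF inv])
  ultimately show ?thesis by simp
qed

text \<open>The difference of the inverses of M t and M s is - (inverse of M t) (M t - M s) (inverse
  of M s). Hence continuity of the inverse suffices to pass to the limit in the difference
  quotient.\<close>

lemma DERIV_inverse_quadratic:
  fixes M :: "real \<Rightarrow> real^'n^'n"
  assumes M: "(M has_vector_derivative M') (at s)" and I: "open I" "s \<in> I" and pos: "\<And>t. t \<in> I \<Longrightarrow> spd (M t)"
    and cont: "continuous_on I M"
  shows "((\<lambda>t. (matrix_inv (M t) *v v) \<bullet> v) has_real_derivative
     - ((M' *v (matrix_inv (M s) *v v)) \<bullet> (matrix_inv (M s) *v v))) (at s)"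
proof -
  let ?p = "\<lambda>t. matrix_inv (M t) *v v"
  have dnz: "det (M t) \<noteq> 0" if "t \<in> I" for t using det_spd_pos[OF pos[OF that]] by simp
  have "continuous_on I ?p" by (intro continuous_on_matrix_inv_vec cont dnz) auto
  then have pc: "(?p \<longlongrightarrow> ?p s) (at s)" using I by (auto simp: continuous_on_eq_continuous_at isCont_def)
  have comp: "((\<lambda>t. M t $ i $ j) has_real_derivative M' $ i $ j) (at s)" for i j
    using M by (intro DERIV_matrix_entry)
  have eq: "(?p t \<bullet> v - ?p s \<bullet> v) / (t - s) =
      - (\<Sum>i\<in>UNIV. \<Sum>j\<in>UNIV. (M t $ i $ j - M s $ i $ j) / (t - s) * ?p t $ j * ?p s $ i)" if t: "t \<in> I" for t
  proof -
    note it = spd_invertible[OF pos[OF t]] and iw = spd_invertible[OF pos[OF I(2)]]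
    have "?p t \<bullet> v = ?p t \<bullet> (M s *v ?p s)" by (simp add: matrix_inv_mult_vec[OF iw])
    also have "\<dots> = (M s *v ?p t) \<bullet> ?p s"
      using spd_inner[OF pos[OF I(2)], of "?p t" "?p s"] by (simp add: inner_commute)
    finally have 1: "?p t \<bullet> v = (M s *v ?p t) \<bullet> ?p s" .
    have 2: "?p s \<bullet> v = (M t *v ?p t) \<bullet> ?p s" by (simp add: matrix_inv_mult_vec[OF it] inner_commute)
    have "?p t \<bullet> v - ?p s \<bullet> v = - (((M t - M s) *v ?p t) \<bullet> ?p s)"
      unfolding 1 2 by (simp add: matrix_vector_mult_diff_rdistrib inner_diff_left)
    also have "\<dots> / (t - s) = - (\<Sum>i\<in>UNIV. \<Sum>j\<in>UNIV. (M t $ i $ j - M s $ i $ j) / (t - s) * ?p t $ j * ?p s $ i)"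
      by (simp add: inner_vec_def matrix_vector_mult_def[of "M t - M s"] sum_distrib_right sum_divide_distrib)
    finally show ?thesis .
  qed
  have "((\<lambda>t. - (\<Sum>i\<in>UNIV. \<Sum>j\<in>UNIV. (M t $ i $ j - M s $ i $ j) / (t - s) * ?p t $ j * ?p s $ i)) \<longlongrightarrow>
      - (\<Sum>i\<in>UNIV. \<Sum>j\<in>UNIV. M' $ i $ j * ?p s $ j * ?p s $ i)) (at s)"
    using comp by (intro tendsto_intros tendsto_vec_nth pc) (simp add: has_field_derivative_iff)
  also have "- (\<Sum>i\<in>UNIV. \<Sum>j\<in>UNIV. M' $ i $ j * ?p s $ j * ?p s $ i) = - ((M' *v ?p s) \<bullet> ?p s)"
    by (simp add: inner_vec_def matrix_vector_mult_def[of M'] sum_distrib_right)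
  finally have lim: "((\<lambda>t. - (\<Sum>i\<in>UNIV. \<Sum>j\<in>UNIV. (M t $ i $ j - M s $ i $ j) / (t - s) * ?p t $ j * ?p s $ i)) \<longlongrightarrow>
      - ((M' *v ?p s) \<bullet> ?p s)) (at s)" .
  have ev: "\<forall>\<^sub>F t in at s. - (\<Sum>i\<in>UNIV. \<Sum>j\<in>UNIV. (M t $ i $ j - M s $ i $ j) / (t - s) * ?p t $ j * ?p s $ i)
      = (?p t \<bullet> v - ?p s \<bullet> v) / (t - s)"
    using eventually_at_in_open'[OF I] by eventually_elim (simp add: eq)
  show ?thesis unfolding has_field_derivative_iff using Lim_transform_eventually[OF lim ev] .
qed

lemma DERIV_gauss_time:
  fixes M :: "real \<Rightarrow> real^'n^'n" and v :: "real^'n"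
  assumes M: "(M has_vector_derivative M') (at s)" and I: "open I" "s \<in> I" and pos: "\<And>t. t \<in> I \<Longrightarrow> spd (M t)"
    and cont: "continuous_on I M"
  defines "p \<equiv> matrix_inv (M s) *v v"
  shows "((\<lambda>t. gauss (M t) v) has_real_derivative
     gauss (M s) v * (((M' *v p) \<bullet> p) / 4 - trace (matrix_inv (M s) ** M') / 2)) (at s)"
proof -
  note d = det_spd_pos[OF pos[OF I(2)]] and iv = spd_invertible[OF pos[OF I(2)]]
  have *: "((\<lambda>t. gauss (M t) v) has_real_derivative
     (4 * pi) powr (- real CARD('n) / 2) * (- (det (M s) * trace (matrix_inv (M s) ** M') * inverse (sqrt (det (M s))) / 2) / (sqrt (det (M s)))\<^sup>2)
       * exp (- (1/4) * ((matrix_inv (M s) *v v) \<bullet> v)) +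
     (4 * pi) powr (- real CARD('n) / 2) / sqrt (det (M s)) * (exp (- (1/4) * ((matrix_inv (M s) *v v) \<bullet> v)) * (- (1/4) * - ((M' *v p) \<bullet> p)))) (at s)"
    unfolding gauss_def p_def
    by (rule derivative_eq_intros DERIV_det[OF M iv] DERIV_inverse_quadratic[OF M I pos cont] refl | use d in force)+
      (use d in \<open>simp add: power2_eq_square field_simps\<close>)
  then show ?thesis
    by (rule DERIV_cong) (use d in \<open>simp add: gauss_def field_simps power2_eq_square\<close>)
qed

lemma DERIV_inverse_quadratic_line:
  fixes K :: "real^'n^'n"
  assumes "transpose K = K"
  shows "((\<lambda>t. (K *v (v + t *\<^sub>R e)) \<bullet> (v + t *\<^sub>R e)) has_real_derivative 2 * ((K *v (v + t *\<^sub>R e)) \<bullet> e)) (at t)"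
proof -
  have eq: "(K *v (v + t *\<^sub>R e)) \<bullet> (v + t *\<^sub>R e) = (K *v v) \<bullet> v + t * (2 * ((K *v v) \<bullet> e)) + t\<^sup>2 * ((K *v e) \<bullet> e)" for t
    using symmetric_inner[OF assms, of e v]
    by (simp add: matrix_vector_right_distrib matrix_vector_mult_scaleR inner_add_left inner_add_right power2_eq_square algebra_simps)
  show ?thesis unfolding eq
    by (rule derivative_eq_intros refl | simp add: matrix_vector_right_distrib matrix_vector_mult_scaleR inner_add_left)+
qed

lemma DERIV_gauss_line:
  fixes M :: "real^'n^'n"
  assumes "spd M"
  shows "((\<lambda>t. gauss M (v + t *\<^sub>R e)) has_real_derivative
      - (1/2) * ((matrix_inv M *v (v + t *\<^sub>R e)) \<bullet> e) * gauss M (v + t *\<^sub>R e)) (at t)"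
proof -
  have s: "transpose (matrix_inv M) = matrix_inv M" using spd_matrix_inv[OF assms] by (simp add: spd_def)
  show ?thesis unfolding gauss_def
    by (rule derivative_eq_intros DERIV_inverse_quadratic_line[OF s] refl | simp)+
qed

lemma integrable_bounded_support:
  fixes f :: "'a::euclidean_space \<Rightarrow> real"
  assumes [measurable]: "f \<in> borel_measurable borel" and B: "\<And>x. x \<in> K \<Longrightarrow> \<bar>f x\<bar> \<le> B" and K: "compact K"
    and supp: "\<And>x. x \<notin> K \<Longrightarrow> f x = 0"
  shows "integrable lborel f"
proof (rule Bochner_Integration.integrable_bound)
  show "integrable lborel (\<lambda>x. indicator K x *\<^sub>R B)"
    using emeasure_compact_finite[OF K] compact_imp_closed[OF K]
    by (intro integrable_scaleR_left) (auto simp: integrable_indicator_iff borel_closed)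
  show "AE x in lborel. norm (f x) \<le> norm (indicator K x *\<^sub>R B)"
  proof (intro always_eventually allI)
    fix x show "norm (f x) \<le> norm (indicator K x *\<^sub>R B)"
      by (cases "x \<in> K") (use B[of x] supp[of x] in auto)
  qed
qed simp

lemma lborel_integral_translation:
  fixes f :: "'a::euclidean_space \<Rightarrow> real"
  assumes [measurable]: "f \<in> borel_measurable borel"
  shows "(\<integral>x. f (x + a) \<partial>lborel) = (\<integral>x. f x \<partial>lborel)"
  by (subst (2) lborel_distr_plus[of a, symmetric], subst integral_distr) (auto simp: add.commute)

text \<open>Translation invariance of the integral, in infinitesimal form.\<close>

lemma integral_directional_derivative_eq_0:
  fixes F f :: "'a::euclidean_space \<Rightarrow> real"
  assumes F [measurable]: "F \<in> borel_measurable borel" and f [measurable]: "f \<in> borel_measurable borel"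
    and B: "\<And>x. \<bar>F x\<bar> \<le> B" "\<And>x. \<bar>f x\<bar> \<le> B" and supp: "\<And>x. R < norm x \<Longrightarrow> F x = 0 \<and> f x = 0"
    and cont: "\<And>x. continuous_on UNIV (\<lambda>t::real. F (x + t *\<^sub>R e))"
    and fin: "\<And>x. finite (T x)"
    and deriv: "\<And>x t. t \<notin> T x \<Longrightarrow> ((\<lambda>t. F (x + t *\<^sub>R e)) has_real_derivative f (x + t *\<^sub>R e)) (at t)"
  shows "(\<integral>x. f x \<partial>lborel) = 0"
proof -
  let ?g = "\<lambda>x t. indicator {0..1::real} t * f (x + t *\<^sub>R e)"
  have g_if: "?g x = (\<lambda>t. if t \<in> {0..1} then f (x + t *\<^sub>R e) else 0)" for x
    by (auto simp: fun_eq_iff indicator_def)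
  have gB: "\<bar>?g x t\<bar> \<le> B" for x t
    using B(2)[of "x + t *\<^sub>R e"] by (cases "t \<in> {0..1}") auto
  have iF: "integrable lborel F"
    by (rule integrable_bounded_support[where B=B and K="cball 0 R"]) (use B supp in auto)
  have inner: "(\<integral>t. ?g x t \<partial>lborel) = F (x + e) - F x" for x
  proof -
    \<comment> \<open>The finite set \<open>T x\<close> of exceptional parameters allows for corners
      of \<open>F\<close>; for the fields below they lie on the level surface of the
      Gaussian.\<close>
    have "((\<lambda>t. f (x + t *\<^sub>R e)) has_integral F (x + 1 *\<^sub>R e) - F (x + 0 *\<^sub>R e)) {0..1}"
    proof (rule fundamental_theorem_of_calculus_interior_strong[OF fin[of x]])
      show "((\<lambda>t. F (x + t *\<^sub>R e)) has_vector_derivative f (x + t *\<^sub>R e)) (at t)" if "t \<in> {0<..<1} - T x" for t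
        using deriv that by (auto simp: has_real_derivative_iff_has_vector_derivative)
      show "continuous_on {0..1} (\<lambda>t. F (x + t *\<^sub>R e))"
        using cont by (rule continuous_on_subset) auto
    qed simp
    then have 1: "((\<lambda>t. ?g x t) has_integral F (x + e) - F x) UNIV"
      using has_integral_restrict_UNIV[of "{0..1}" "\<lambda>t. f (x + t *\<^sub>R e)"] unfolding g_if[of x] by simp
    have "integrable lborel (\<lambda>t. ?g x t)"
    proof (rule integrable_bounded_support[where B=B and K="{0..1}"])
      show "\<bar>?g x t\<bar> \<le> B" for t by (rule gB)
    qed auto
    then have "((\<lambda>t. ?g x t) has_integral (\<integral>t. ?g x t \<partial>lborel)) UNIV" by (rule has_integral_integral_lborel)
    then show ?thesis using 1 has_integral_unique by blast
  qed
  have int: "integrable (lborel \<Otimes>\<^sub>M lborel) (case_prod ?g)"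
    unfolding lborel_prod
  proof (rule integrable_bounded_support[where B=B and K="cball 0 (R + norm e) \<times> {0..1}"])
    show "case_prod ?g \<in> borel_measurable borel" unfolding borel_prod[symmetric] by measurable
    show "compact (cball (0::'a) (R + norm e) \<times> {0..1::real})" by (intro compact_Times) auto
    show "\<bar>case_prod ?g z\<bar> \<le> B" for z
      using gB by (simp add: case_prod_beta)
    show "case_prod ?g z = 0" if out: "z \<notin> cball 0 (R + norm e) \<times> {0..1}" for z
    proof (cases "0 \<le> snd z \<and> snd z \<le> 1")
      case True
      then have "R + norm e < norm (fst z)" using out by (cases z) auto
      moreover have "norm (fst z) \<le> norm (fst z + snd z *\<^sub>R e) + norm (snd z *\<^sub>R e)"
        using norm_triangle_ineq4[of "fst z + snd z *\<^sub>R e" "snd z *\<^sub>R e"] by simp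
      moreover have "norm (snd z *\<^sub>R e) \<le> norm e" using True by (simp add: mult_left_le_one_le)
      ultimately have "R < norm (fst z + snd z *\<^sub>R e)" by linarith
      then show ?thesis using supp by (simp add: case_prod_beta)
    qed (auto simp: indicator_def case_prod_beta)
  qed
  have "0 = (\<integral>x. F (x + e) \<partial>lborel) - (\<integral>x. F x \<partial>lborel)" by (simp add: lborel_integral_translation)
  also have "\<dots> = (\<integral>x. F (x + e) - F x \<partial>lborel)"
  proof (rule Bochner_Integration.integral_diff[symmetric])
    show "integrable lborel (\<lambda>x. F (x + e))"
    proof (rule integrable_bounded_support[where B=B and K="cball 0 (R + norm e)"])
      show "F (x + e) = 0" if "x \<notin> cball 0 (R + norm e)" for x
      proof -
        have "norm x \<le> norm (x + e) + norm e" using norm_triangle_ineq4[of "x + e" e] by simp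
        then show ?thesis using that supp by auto
      qed
    qed (use B in auto)
  qed (rule iF)
  \<comment> \<open>Integrating along the line first gives increments of \<open>F\<close>;
    integrating over space first gives, by translation invariance, the integral of
    \<open>f\<close>.\<close>
  also have "\<dots> = (\<integral>x. (\<integral>t. ?g x t \<partial>lborel) \<partial>lborel)" by (simp add: inner)
  also have "\<dots> = (\<integral>t. (\<integral>x. ?g x t \<partial>lborel) \<partial>lborel)"
    by (rule lborel_pair.Fubini_integral[OF int, symmetric])
  also have "\<dots> = (\<integral>t. indicator {0..1::real} t * (\<integral>x. f x \<partial>lborel) \<partial>lborel)"
    by (simp add: lborel_integral_translation)
  also have "\<dots> = (\<integral>x. f x \<partial>lborel)" by simp
  finally show ?thesis by simp
qed

section \<open>The potential of a heat ball\<close>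

definition ramp :: "real \<Rightarrow> real" where "ramp x = max 0 (x - 1)"

text \<open>The potential of \<open>W\<close> restricted to the ball is \<open>x - kappa x\<close> with \<open>x = r psi\<close>, that is \<open>x\<close> for
  \<open>x \<le> 1\<close> and \<open>1 + ln x\<close> for \<open>x > 1\<close>.\<close>

definition kappa :: "real \<Rightarrow> real" where "kappa x = ramp x - ln (1 + ramp x)"

lemma ramp_nonneg: "0 \<le> ramp x" by (simp add: ramp_def)

lemma continuous_on_ramp [continuous_intros]: "continuous_on X f \<Longrightarrow> continuous_on X (\<lambda>x. ramp (f x))"
  unfolding ramp_def by (intro continuous_intros)

lemma continuous_on_kappa [continuous_intros]: "continuous_on X f \<Longrightarrow> continuous_on X (\<lambda>x. kappa (f x))"
  unfolding kappa_def using ramp_nonneg by (intro continuous_intros) (auto simp: add_pos_nonneg add_nonneg_eq_0_iff)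

lemma kappa_nonneg: "0 \<le> kappa x"
  unfolding kappa_def using ln_add_one_self_le_self[OF ramp_nonneg] by simp

lemma kappa_le_ramp: "kappa x \<le> ramp x"
  unfolding kappa_def using ramp_nonneg by simp

lemma kappa_eq_0: "x \<le> 1 \<Longrightarrow> kappa x = 0"
  by (simp add: kappa_def ramp_def)

lemma kappa_le: "0 \<le> x \<Longrightarrow> kappa x \<le> x"
  using kappa_le_ramp[of x] by (auto simp: ramp_def max_def split: if_splits)

lemma DERIV_ramp:
  assumes "x \<noteq> 1"
  shows "(ramp has_real_derivative (if 1 < x then 1 else 0)) (at x)"
proof (cases "1 < x")
  case True
  have "((\<lambda>x. x - 1) has_real_derivative 1) (at x)" by (auto intro!: derivative_eq_intros)
  then have "(ramp has_real_derivative 1) (at x)"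
    by (rule has_field_derivative_transform_within_open[where S="{1<..}"]) (use True in \<open>auto simp: ramp_def\<close>)
  then show ?thesis using True by simp
next
  case False
  have "((\<lambda>x. 0) has_real_derivative 0) (at x)" by simp
  then have "(ramp has_real_derivative 0) (at x)"
    by (rule has_field_derivative_transform_within_open[where S="{..<1}"]) (use False assms in \<open>auto simp: ramp_def\<close>)
  then show ?thesis using False by simp
qed

text \<open>Quadratic vanishing at 1 makes \<open>kappa\<close> differentiable across the corner of
  \<open>ramp\<close>.\<close>

lemma kappa_quadratic: "kappa x \<le> (x - 1)\<^sup>2"
proof (cases "1 < x")
  case True
  have "ln (1 / x) \<le> 1 / x - 1" using True by (intro ln_le_minus_one) auto
  then have "kappa x \<le> x - 1 - (1 - 1 / x)" using True by (simp add: kappa_def ramp_def ln_div)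
  also have "\<dots> = (x - 1)\<^sup>2 / x" using True by (simp add: field_simps power2_eq_square)
  also have "\<dots> \<le> (x - 1)\<^sup>2" using True by (simp add: divide_le_eq_1 field_simps mult_left_le)
  finally show ?thesis .
qed (simp add: kappa_eq_0)

lemma DERIV_kappa: "(kappa has_real_derivative ramp x / (1 + ramp x)) (at x)"
proof (cases "x = 1")
  case False
  have "(kappa has_real_derivative (if 1 < x then 1 else 0) - inverse (1 + ramp x) * (0 + (if 1 < x then 1 else 0))) (at x)"
    unfolding kappa_def
    by (rule derivative_eq_intros DERIV_ramp[OF False] refl | use ramp_nonneg[of x] in force)+
      (use ramp_nonneg[of x] in \<open>simp add: field_simps\<close>)
  then show ?thesis
    by (rule DERIV_cong) (use ramp_nonneg[of x] in \<open>auto simp: field_simps ramp_def\<close>)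
next
  case True
  have lim: "((\<lambda>y::real. \<bar>y - 1\<bar>) \<longlongrightarrow> 0) (at 1)"
    using tendsto_rabs[OF tendsto_diff[OF tendsto_ident_at tendsto_const[of "1::real"]], of 1 UNIV] by simp
  have "\<bar>kappa y / (y - 1)\<bar> \<le> \<bar>y - 1\<bar>" for y
  proof (cases "y = 1")
    case False
    then show ?thesis using kappa_quadratic[of y] kappa_nonneg[of y]
      by (simp add: abs_divide divide_le_eq power2_eq_square abs_mult_self_eq)
  qed simp
  then have "((\<lambda>y. kappa y / (y - 1)) \<longlongrightarrow> 0) (at 1)"
    by (intro tendsto_rabs_zero_cancel[OF tendsto_sandwich[OF _ _ tendsto_const lim]]) auto
  then show ?thesis unfolding True has_field_derivative_iff by (simp add: ramp_def kappa_eq_0)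
qed

text \<open>The profile x - kappa x grows only logarithmically. A square root is all that is needed
  near the pole, where the mass of the square root of the Gaussian tends to zero.\<close>

lemma minus_kappa_le_sqrt: "0 \<le> x \<Longrightarrow> x - kappa x \<le> 2 * sqrt x"
proof (cases "1 < x")
  case True
  have "ln (sqrt x) \<le> sqrt x - 1" using True by (intro ln_le_minus_one) auto
  then have "ln x \<le> 2 * (sqrt x - 1)" using True by (simp add: ln_sqrt)
  then show ?thesis using True by (simp add: kappa_def ramp_def)
next
  case False
  assume "0 \<le> x"
  then have "x = sqrt x * sqrt x" by simp
  also have "\<dots> \<le> 2 * sqrt x" using False \<open>0 \<le> x\<close> by (intro mult_right_mono) (auto simp: real_sqrt_le_1_iff order_trans[of _ 1])
  finally show ?thesis using False by (simp add: kappa_eq_0)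
qed

section \<open>Gaussian tails and square roots of Gaussians\<close>

lemma matrix_inv_scaleR:
  fixes M :: "real^'n^'n"
  assumes "invertible M" "c \<noteq> 0"
  shows "matrix_inv (c *\<^sub>R M) = (1 / c) *\<^sub>R matrix_inv M"
proof -
  have "(c *\<^sub>R M) ** ((1 / c) *\<^sub>R matrix_inv M) = M ** matrix_inv M"
    using assms by (simp add: matrix_scalar_ac scalar_matrix_assoc[symmetric])
  then show ?thesis by (intro matrix_inv_unique(1)) (simp add: matrix_inv_mult[OF assms(1)])
qed

text \<open>Doubling the matrix halves the exponent. This serves both to spend one half of the
  exponent on decay and to integrate the square root of a Gaussian.\<close>

lemma gauss_double:
  fixes M :: "real^'n^'n"
  assumes "spd M"
  shows "gauss (2 *\<^sub>R M) v = 1 / sqrt (4 * pi) ^ CARD('n) / (sqrt 2 ^ CARD('n) * sqrt (det M)) * exp (- ((matrix_inv M *v v) \<bullet> v / 8))"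
proof -
  have "2 *\<^sub>R M = (\<chi> i. 2 *s M $ i)" by (simp add: vec_eq_iff)
  then have "det (2 *\<^sub>R M) = 2 ^ CARD('n) * det M" using det_rows_mul[of "\<lambda>_. 2" "\<lambda>i. M $ i"] by simp
  moreover have "sqrt (2 ^ CARD('n)) = sqrt 2 ^ CARD('n)" by (simp add: real_sqrt_power)
  ultimately show ?thesis
    by (simp add: gauss_alt real_sqrt_mult matrix_inv_scaleR spd_invertible[OF assms] scaleR_matrix_vector_assoc[symmetric])
qed

text \<open>Legendre duality with the test vector v / m.\<close>

lemma spd_inv_lower_bound:
  fixes M :: "real^'n^'n"
  assumes M: "spd M" and m: "0 < m" "\<And>x. (M *v x) \<bullet> x \<le> m * (x \<bullet> x)"
  shows "(v \<bullet> v) / m \<le> (matrix_inv M *v v) \<bullet> v"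
proof -
  have "2 * (((1/m) *\<^sub>R v) \<bullet> v) - (M *v ((1/m) *\<^sub>R v)) \<bullet> ((1/m) *\<^sub>R v) \<le> (matrix_inv M *v v) \<bullet> v"
    by (rule spd_legendre[OF M])
  moreover have "(M *v ((1/m) *\<^sub>R v)) \<bullet> ((1/m) *\<^sub>R v) \<le> m * (((1/m) *\<^sub>R v) \<bullet> ((1/m) *\<^sub>R v))" by (rule m)
  moreover have "m * (((1/m) *\<^sub>R v) \<bullet> ((1/m) *\<^sub>R v)) = (v \<bullet> v) / m" using m by simp
  moreover have "2 * (((1/m) *\<^sub>R v) \<bullet> v) = 2 * ((v \<bullet> v) / m)" by simp
  ultimately show ?thesis by linarith
qed

lemma quadratic_form_bound:
  fixes M :: "real^'n^'n"
  shows "(M *v x) \<bullet> x \<le> (\<Sum>i\<in>UNIV. \<Sum>j\<in>UNIV. \<bar>M $ i $ j\<bar>) * (x \<bullet> x)"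
proof -
  have "(M *v x) \<bullet> x \<le> norm (M *v x) * norm x" by (rule norm_cauchy_schwarz)
  also have "norm (M *v x) \<le> onorm ((*v) M) * norm x"
    by (rule onorm[OF matrix_vector_mul_bounded_linear])
  also have "onorm ((*v) M) \<le> (\<Sum>i\<in>UNIV. \<Sum>j\<in>UNIV. \<bar>M $ i $ j\<bar>)"
    by (rule onorm_le_matrix_component_sum)
  finally show ?thesis
    by (simp add: mult_right_mono power2_norm_eq_inner[symmetric] power2_eq_square mult.assoc)
qed

text \<open>At distance d half of the exponent is at least d^2 / (8 m). The other half remains as
  the Gaussian of 2 M, and the change of normalisation costs the power of sqrt 2.\<close>

lemma gauss_tail:
  fixes M :: "real^'n^'n"
  assumes M: "spd M" and m: "0 < m" "\<And>x. (M *v x) \<bullet> x \<le> m * (x \<bullet> x)" and d: "0 \<le> d"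
  shows "(\<integral>\<^sup>+v. ennreal (gauss M (v - y)) * indicator {v. d \<le> norm (v - y)} v \<partial>lborel) \<le> ennreal (sqrt 2 ^ CARD('n) * exp (- (d\<^sup>2 / (8 * m))))"
proof -
  let ?c = "sqrt 2 ^ CARD('n) * exp (- (d\<^sup>2 / (8 * m)))"
  have *: "gauss M v \<le> ?c * gauss (2 *\<^sub>R M) v" if "d \<le> norm v" for v
  proof -
    have "(v \<bullet> v) / m \<le> (matrix_inv M *v v) \<bullet> v" by (rule spd_inv_lower_bound[OF M m])
    moreover have "d\<^sup>2 / m \<le> (v \<bullet> v) / m"
      using that d m by (intro divide_right_mono) (auto simp: power2_norm_eq_inner[symmetric] intro!: power_mono)
    ultimately have "d\<^sup>2 / (8 * m) \<le> (matrix_inv M *v v) \<bullet> v / 8" by simp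
    then have "exp (- ((matrix_inv M *v v) \<bullet> v / 8)) \<le> exp (- (d\<^sup>2 / (8 * m)))" by simp
    then have "exp (- ((matrix_inv M *v v) \<bullet> v / 8)) * exp (- ((matrix_inv M *v v) \<bullet> v / 8)) \<le>
       exp (- (d\<^sup>2 / (8 * m))) * exp (- ((matrix_inv M *v v) \<bullet> v / 8))" by (intro mult_right_mono) auto
    then have "exp (- ((matrix_inv M *v v) \<bullet> v / 4)) \<le> exp (- (d\<^sup>2 / (8 * m))) * exp (- ((matrix_inv M *v v) \<bullet> v / 8))"
      by (simp add: exp_add[symmetric])
    then have "1 / sqrt (4 * pi) ^ CARD('n) / sqrt (det M) * exp (- ((matrix_inv M *v v) \<bullet> v / 4)) \<le>
      1 / sqrt (4 * pi) ^ CARD('n) / sqrt (det M) * (exp (- (d\<^sup>2 / (8 * m))) * exp (- ((matrix_inv M *v v) \<bullet> v / 8)))"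
      using det_spd_pos[OF M] by (intro mult_left_mono) auto
    then show ?thesis unfolding gauss_double[OF M] by (simp only: gauss_alt[of M v]) simp
  qed
  have "(\<integral>\<^sup>+v. ennreal (gauss M (v - y)) * indicator {v. d \<le> norm (v - y)} v \<partial>lborel) \<le>
     (\<integral>\<^sup>+v. ennreal ?c * ennreal (gauss (2 *\<^sub>R M) (v - y)) \<partial>lborel)"
    using * by (intro nn_integral_mono) (auto simp: indicator_def ennreal_mult'[symmetric] intro!: ennreal_leI)
  also have "\<dots> = ennreal ?c"
    using nn_integral_gauss[OF spd_scaleR[OF M], of 2 y] by (subst nn_integral_cmult) auto
  finally show ?thesis .
qed

text \<open>The square root of a Gaussian is a multiple of the Gaussian of 2 M. The total is of
  order (det M)^(1/4), which tends to 0 when \<open>M\<close> shrinks to the pole.\<close>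

lemma nn_integral_sqrt_gauss:
  fixes M :: "real^'n^'n"
  assumes M: "spd M"
  shows "(\<integral>\<^sup>+v. ennreal (sqrt (gauss M v)) \<partial>lborel) =
     ennreal (sqrt (sqrt (4 * pi) ^ CARD('n)) * sqrt 2 ^ CARD('n) * sqrt (sqrt (det M)))"
proof -
  let ?c = "sqrt (sqrt (4 * pi) ^ CARD('n)) * sqrt 2 ^ CARD('n) * sqrt (sqrt (det M))"
  note d = det_spd_pos[OF M]
  have "sqrt (gauss M v) = ?c * gauss (2 *\<^sub>R M) v" for v
  proof -
    have e: "sqrt (exp (- ((matrix_inv M *v v) \<bullet> v / 4))) = exp (- ((matrix_inv M *v v) \<bullet> v / 8))"
      by (rule real_sqrt_unique) (simp_all add: power2_eq_square exp_add[symmetric])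
    have q: "x / sqrt x = sqrt x" if "0 \<le> x" for x :: real by (simp add: real_div_sqrt that)
    have 1: "sqrt (sqrt (4 * pi) ^ CARD('n)) / sqrt (4 * pi) ^ CARD('n) = 1 / sqrt (sqrt (4 * pi) ^ CARD('n))"
      using q[of "sqrt (4 * pi) ^ CARD('n)"] by (simp add: field_simps)
    have 2: "sqrt (sqrt (det M)) / sqrt (det M) = 1 / sqrt (sqrt (det M))"
      using q[of "sqrt (det M)"] d by (simp add: field_simps)
    have "?c * gauss (2 *\<^sub>R M) v = (sqrt (sqrt (4 * pi) ^ CARD('n)) / sqrt (4 * pi) ^ CARD('n)) *
       (sqrt (sqrt (det M)) / sqrt (det M)) * exp (- ((matrix_inv M *v v) \<bullet> v / 8))"
      unfolding gauss_double[OF M] by simp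
    also have "\<dots> = sqrt (gauss M v)"
      unfolding 1 2 gauss_alt by (simp add: real_sqrt_mult real_sqrt_divide e)
    finally show ?thesis ..
  qed
  then have "(\<integral>\<^sup>+v. ennreal (sqrt (gauss M v)) \<partial>lborel) = (\<integral>\<^sup>+v. ennreal ?c * ennreal (gauss (2 *\<^sub>R M) v) \<partial>lborel)"
    using d by (intro nn_integral_cong) (simp add: ennreal_mult')
  also have "\<dots> = ennreal ?c"
    using nn_integral_gauss[OF spd_scaleR[OF M], of 2 0] by (subst nn_integral_cmult) auto
  finally show ?thesis .
qed

lemma trace_matrix_inv_mult:
  fixes M P :: "real^'n^'n"
  shows "trace (matrix_inv M ** P) = (\<Sum>i\<in>UNIV. (matrix_inv M *v column i P) $ i)"
  by (simp add: trace_def matrix_matrix_mult_def matrix_vector_mult_def column_def)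

lemma continuous_on_trace_matrix_inv:
  fixes M P :: "'a::topological_space \<Rightarrow> real^'n^'n"
  assumes "continuous_on X M" "continuous_on X P" "\<And>x. x \<in> X \<Longrightarrow> spd (M x)"
  shows "continuous_on X (\<lambda>x. trace (matrix_inv (M x) ** P x))"
  unfolding trace_matrix_inv_mult
proof (intro continuous_on_sum continuous_on_component continuous_on_matrix_inv_vec assms(1))
  show "continuous_on X (\<lambda>x. column i (P x))" for i
    unfolding column_def using assms(2) by (intro continuous_on_vec_lambda continuous_intros)
  show "det (M x) \<noteq> 0" if "x \<in> X" for x using det_spd_pos[OF assms(3)[OF that]] by simp
qed

lemma trace_mult_commute: "trace (A ** B) = trace (B ** A)" for A B :: "real^'n^'n"
  unfolding trace_def matrix_matrix_mult_def by (simp, subst sum.swap) (simp add: mult.commute)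

lemma continuous_bounded_cball:
  fixes f :: "'a::euclidean_space \<Rightarrow> real"
  assumes "continuous_on (cball 0 R) f"
  obtains B where "0 \<le> B" "\<And>x. norm x \<le> R \<Longrightarrow> \<bar>f x\<bar> \<le> B"
proof -
  have "bounded (f ` cball 0 R)" using assms by (intro compact_imp_bounded compact_continuous_image) auto
  then obtain B where "0 < B" "\<forall>x\<in>f ` cball 0 R. norm x \<le> B" using bounded_pos by blast
  then show ?thesis by (intro that[of B]) auto
qed

text \<open>On a line the level set lies in the zero set of a quadratic polynomial with positive
  leading coefficient.\<close>

lemma finite_gauss_level_line:
  fixes M :: "real^'n^'n"
  assumes M: "spd M" and e: "e \<noteq> 0" and c: "0 < c"
  shows "finite {t. gauss M (v + t *\<^sub>R e) = c}"
proof -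
  let ?K = "matrix_inv M"
  have K: "spd ?K" using M by (rule spd_matrix_inv)
  have eq: "(?K *v (v + t *\<^sub>R e)) \<bullet> (v + t *\<^sub>R e) = (?K *v v) \<bullet> v + t * (2 * ((?K *v v) \<bullet> e)) + t\<^sup>2 * ((?K *v e) \<bullet> e)" for t
    using spd_inner[OF K, of e v]
    by (simp add: matrix_vector_right_distrib matrix_vector_mult_scaleR inner_add_left inner_add_right power2_eq_square algebra_simps)
  define k where "k = 1 / sqrt (4 * pi) ^ CARD('n) / sqrt (det M)"
  have k: "0 < k" using det_spd_pos[OF M] by (simp add: k_def)
  let ?q = "[:(?K *v v) \<bullet> v + 4 * ln (c / k), 2 * ((?K *v v) \<bullet> e), (?K *v e) \<bullet> e:]"
  have "{t. gauss M (v + t *\<^sub>R e) = c} \<subseteq> {t. poly ?q t = 0}"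
  proof
    fix t assume "t \<in> {t. gauss M (v + t *\<^sub>R e) = c}"
    then have "k * exp (- ((?K *v (v + t *\<^sub>R e)) \<bullet> (v + t *\<^sub>R e) / 4)) = c" by (simp add: gauss_alt k_def)
    then have "exp (- ((?K *v (v + t *\<^sub>R e)) \<bullet> (v + t *\<^sub>R e) / 4)) = c / k" using k by (simp add: field_simps)
    then have "- ((?K *v (v + t *\<^sub>R e)) \<bullet> (v + t *\<^sub>R e) / 4) = ln (c / k)" by (metis ln_exp)
    then have "(?K *v (v + t *\<^sub>R e)) \<bullet> (v + t *\<^sub>R e) = - 4 * ln (c / k)" by simp
    then show "t \<in> {t. poly ?q t = 0}" unfolding eq by (simp add: algebra_simps power2_eq_square)
  qed
  moreover have "(?K *v e) \<bullet> e \<noteq> 0" using K e by (metis less_irrefl spd_def)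
  then have "?q \<noteq> 0" by simp
  then have "finite {t. poly ?q t = 0}" by (rule poly_roots_finite)
  ultimately show ?thesis by (rule finite_subset)
qed

text \<open>The relation x kappa'(x) = ramp x, with the derivative from \<open>DERIV_kappa\<close>.
  It removes the quotient after every chain rule, because derivatives of a Gaussian carry the
  Gaussian as a factor.\<close>

lemma ramp_identity: "ramp x / (1 + ramp x) * x = ramp x"
  by (auto simp: ramp_def max_def)

section \<open>The divergence identity behind the potential of the ball\<close>

context frame
begin

definition psi :: "(real^'n) \<times> real \<Rightarrow> real" where
  "psi z = (if 0 < snd z then gauss (C (snd z)) (fst z) else 0)"

text \<open>For positive time this is the squared gradient of \<open>ln psi\<close> in the form
  \<open>P\<close>.\<close>

definition W :: "(real^'n) \<times> real \<Rightarrow> real" where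
  "W z = (if 0 < snd z then ((P (snd z) *v (matrix_inv (C (snd z)) *v fst z)) \<bullet> (matrix_inv (C (snd z)) *v fst z)) / 4 else 0)"

definition heat_ball :: "real \<Rightarrow> ((real^'n) \<times> real) set" where
  "heat_ball r = {z. 1 / r < psi z}"

lemma continuous_on_C_comp: "continuous_on X f \<Longrightarrow> continuous_on X (\<lambda>x. C (f x))"
  using continuous_on_compose2[OF C_cont[of UNIV]] by simp

lemma continuous_on_P_comp: "continuous_on X f \<Longrightarrow> continuous_on X (\<lambda>x. P (f x))"
  using continuous_on_compose2[OF P_cont] by simp

lemma P_inner: "(P t *v x) \<bullet> y = (P t *v y) \<bullet> x"
  using symmetric_inner[OF P_sym] .

definition G :: "(real^'n) \<times> real \<Rightarrow> real^'n \<Rightarrow> real \<Rightarrow> real" where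
  "G z \<eta> s = gauss (C (snd z) - C s) (\<eta> - fst z)"

text \<open>Up to the factor \<open>- 2\<close>, these are the spatial gradients of \<open>ln (gauss (C s) \<eta>)\<close> and \<open>ln (G z \<eta> s)\<close>.\<close>

definition pv :: "real^'n \<Rightarrow> real \<Rightarrow> real^'n" where
  "pv \<eta> s = matrix_inv (C s) *v \<eta>"

definition qv :: "(real^'n) \<times> real \<Rightarrow> real^'n \<Rightarrow> real \<Rightarrow> real^'n" where
  "qv z \<eta> s = matrix_inv (C (snd z) - C s) *v (\<eta> - fst z)"

definition xv :: "real \<Rightarrow> real^'n \<Rightarrow> real \<Rightarrow> real" where
  "xv r \<eta> s = r * gauss (C s) \<eta>"

text \<open>The time derivative of \<open>G z \<eta> s * kappa (xv r \<eta> s)\<close>: the first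
  summand comes from \<open>G\<close>, the second from \<open>kappa\<close> with x kappa'(x) = ramp
  x.\<close>

definition Ht :: "(real^'n) \<times> real \<Rightarrow> real \<Rightarrow> real^'n \<Rightarrow> real \<Rightarrow> real" where
  "Ht z r \<eta> s = G z \<eta> s *
    ((trace (matrix_inv (C (snd z) - C s) ** P s) / 2 - ((P s *v qv z \<eta> s) \<bullet> qv z \<eta> s) / 4) * kappa (xv r \<eta> s)
     + (((P s *v pv \<eta> s) \<bullet> pv \<eta> s) / 4 - trace (matrix_inv (C s) ** P s) / 2) * ramp (xv r \<eta> s))"

lemma DERIV_G_kappa:
  assumes s: "0 < s" "s < snd z"
  shows "((\<lambda>s. G z \<eta> s * kappa (xv r \<eta> s)) has_real_derivative Ht z r \<eta> s) (at s)"
proof -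
  have dC: "((\<lambda>s. C (snd z) - C s) has_vector_derivative - P s) (at s)"
    using has_vector_derivative_diff[OF has_vector_derivative_const C_deriv, of "C (snd z)" s] by simp
  have G: "((\<lambda>s. G z \<eta> s) has_real_derivative
    G z \<eta> s * (((- P s *v qv z \<eta> s) \<bullet> qv z \<eta> s) / 4 - trace (matrix_inv (C (snd z) - C s) ** (- P s)) / 2)) (at s)"
    unfolding G_def qv_def
    by (rule DERIV_gauss_time[OF dC, of "{..<snd z}"])
      (use s in \<open>auto intro!: C_spd continuous_intros continuous_on_C_comp\<close>)
  have X: "((\<lambda>s. xv r \<eta> s) has_real_derivative
    r * (gauss (C s) \<eta> * (((P s *v pv \<eta> s) \<bullet> pv \<eta> s) / 4 - trace (matrix_inv (C s) ** P s) / 2))) (at s)"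
    unfolding xv_def pv_def
    by (intro DERIV_cmult DERIV_gauss_time[OF C_deriv, of "{0<..}"])
      (use s in \<open>auto intro!: C_spd0 C_cont\<close>)
  have tr: "trace (matrix_inv (C (snd z) - C s) ** (- P s)) = - trace (matrix_inv (C (snd z) - C s) ** P s)"
    by (simp add: trace_def matrix_matrix_mult_def sum_negf)
  have "((\<lambda>s. kappa (xv r \<eta> s)) has_real_derivative ramp (xv r \<eta> s) / (1 + ramp (xv r \<eta> s)) *
     (r * (gauss (C s) \<eta> * (((P s *v pv \<eta> s) \<bullet> pv \<eta> s) / 4 - trace (matrix_inv (C s) ** P s) / 2)))) (at s)"
    by (rule DERIV_chain2[OF DERIV_kappa X])
  also have "ramp (xv r \<eta> s) / (1 + ramp (xv r \<eta> s)) *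
     (r * (gauss (C s) \<eta> * (((P s *v pv \<eta> s) \<bullet> pv \<eta> s) / 4 - trace (matrix_inv (C s) ** P s) / 2))) =
    ramp (xv r \<eta> s) * (((P s *v pv \<eta> s) \<bullet> pv \<eta> s) / 4 - trace (matrix_inv (C s) ** P s) / 2)"
    using ramp_identity[of "xv r \<eta> s"] by (simp add: xv_def[of r \<eta> s] mult.assoc[symmetric])
  finally have K: "((\<lambda>s. kappa (xv r \<eta> s)) has_real_derivative
    ramp (xv r \<eta> s) * (((P s *v pv \<eta> s) \<bullet> pv \<eta> s) / 4 - trace (matrix_inv (C s) ** P s) / 2)) (at s)" .
  show ?thesis
    by (rule DERIV_cong[OF DERIV_mult[OF G K]])
      (simp add: Ht_def tr matrix_mult_uminus algebra_simps)
qed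

text \<open>The vector field \<open>(Fi z r s i)\<^sub>i\<close> has divergence \<open>- 2 (Ht + G W 1)\<close> with \<open>1\<close> the indicator of the
  ball, so \<open>G kappa\<close> changes in time at the rate \<open>- \<integral> G W 1\<close>.\<close>

definition Fi :: "(real^'n) \<times> real \<Rightarrow> real \<Rightarrow> real \<Rightarrow> 'n \<Rightarrow> real^'n \<Rightarrow> real" where
  "Fi z r s i \<eta> = G z \<eta> s * (ramp (xv r \<eta> s) * (P s *v pv \<eta> s) $ i - kappa (xv r \<eta> s) * (P s *v qv z \<eta> s) $ i)"

text \<open>The derivative of \<open>Fi z r s i\<close> in the i-th coordinate, off the surface r
  psi = 1. The last summand comes from differentiating \<open>ramp\<close>; it jumps at that surface
  and produces the source \<open>W\<close>.\<close>

definition fi :: "(real^'n) \<times> real \<Rightarrow> real \<Rightarrow> real \<Rightarrow> 'n \<Rightarrow> real^'n \<Rightarrow> real" where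
  "fi z r s i \<eta> = G z \<eta> s *
     (- (1/2) * qv z \<eta> s $ i * (ramp (xv r \<eta> s) * (P s *v pv \<eta> s) $ i - kappa (xv r \<eta> s) * (P s *v qv z \<eta> s) $ i)
      + (ramp (xv r \<eta> s) * (P s ** matrix_inv (C s)) $ i $ i - kappa (xv r \<eta> s) * (P s ** matrix_inv (C (snd z) - C s)) $ i $ i)
      + (1/2) * pv \<eta> s $ i * ramp (xv r \<eta> s) * (P s *v qv z \<eta> s) $ i
      - (1/2) * (if 1 < xv r \<eta> s then xv r \<eta> s * pv \<eta> s $ i * (P s *v pv \<eta> s) $ i else 0))"

text \<open>Symmetry of \<open>P\<close> cancels the mixed terms in \<open>pv\<close> and
  \<open>qv\<close>. Of the terms quadratic in \<open>pv\<close>, the difference between x and ramp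
  x, which is 1 on the ball, leaves exactly \<open>W\<close>.\<close>

lemma sum_fi:
  assumes s: "0 < s" "s < snd z" and r: "0 < r"
  shows "(\<Sum>i\<in>UNIV. fi z r s i \<eta>) = - 2 * (Ht z r \<eta> s + G z \<eta> s * W (\<eta>, s) * indicator (heat_ball r) (\<eta>, s))"
proof -
  let ?a = "ramp (xv r \<eta> s)" and ?k = "kappa (xv r \<eta> s)" and ?p = "pv \<eta> s" and ?q = "qv z \<eta> s"
  let ?A = "if 1 < xv r \<eta> s then xv r \<eta> s else 0"
  have t1: "trace (P s ** matrix_inv (C s)) = trace (matrix_inv (C s) ** P s)"
    and t2: "trace (P s ** matrix_inv (C (snd z) - C s)) = trace (matrix_inv (C (snd z) - C s) ** P s)"
    by (rule trace_mult_commute)+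
  have "(\<Sum>i\<in>UNIV. fi z r s i \<eta>) = G z \<eta> s * (\<Sum>i\<in>UNIV.
      - (1/2) * ?a * (?q $ i * (P s *v ?p) $ i) + (1/2) * ?k * (?q $ i * (P s *v ?q) $ i)
      + ?a * (P s ** matrix_inv (C s)) $ i $ i - ?k * (P s ** matrix_inv (C (snd z) - C s)) $ i $ i
      + (1/2) * ?a * (?p $ i * (P s *v ?q) $ i) - (1/2) * ?A * (?p $ i * (P s *v ?p) $ i))"
    unfolding fi_def sum_distrib_left by (intro sum.cong refl) (simp add: algebra_simps)
  also have "(\<Sum>i\<in>UNIV.
      - (1/2) * ?a * (?q $ i * (P s *v ?p) $ i) + (1/2) * ?k * (?q $ i * (P s *v ?q) $ i)
      + ?a * (P s ** matrix_inv (C s)) $ i $ i - ?k * (P s ** matrix_inv (C (snd z) - C s)) $ i $ i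
      + (1/2) * ?a * (?p $ i * (P s *v ?q) $ i) - (1/2) * ?A * (?p $ i * (P s *v ?p) $ i))
    = - (1/2) * ?a * (?q \<bullet> (P s *v ?p)) + (1/2) * ?k * (?q \<bullet> (P s *v ?q)) + ?a * trace (P s ** matrix_inv (C s))
      - ?k * trace (P s ** matrix_inv (C (snd z) - C s)) + (1/2) * ?a * (?p \<bullet> (P s *v ?q)) - (1/2) * ?A * (?p \<bullet> (P s *v ?p))"
    unfolding inner_vec_def trace_def sum_distrib_left sum.distrib[symmetric] sum_subtractf[symmetric] by simp
  also have "?q \<bullet> (P s *v ?p) = ?p \<bullet> (P s *v ?q)" using P_inner[of s ?p ?q] by (simp add: inner_commute)
  finally have 1: "(\<Sum>i\<in>UNIV. fi z r s i \<eta>) = G z \<eta> s * ((1/2) * ?k * (?q \<bullet> (P s *v ?q)) + ?a * trace (matrix_inv (C s) ** P s)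
      - ?k * trace (matrix_inv (C (snd z) - C s) ** P s) - (1/2) * ?A * (?p \<bullet> (P s *v ?p)))"
    unfolding t1 t2 by (simp add: algebra_simps)
  have mem: "(\<eta>, s) \<in> heat_ball r \<longleftrightarrow> 1 < xv r \<eta> s"
    using s r by (simp add: heat_ball_def psi_def xv_def field_simps)
  have 2: "?a - ?A = - indicator (heat_ball r) (\<eta>, s)" using mem by (auto simp: ramp_def indicator_def)
  have "W (\<eta>, s) = (?p \<bullet> (P s *v ?p)) / 4" using s by (simp add: W_def pv_def inner_commute)
  then have 3: "- 2 * (Ht z r \<eta> s + G z \<eta> s * W (\<eta>, s) * indicator (heat_ball r) (\<eta>, s))
     = G z \<eta> s * (- 2) * ((trace (matrix_inv (C (snd z) - C s) ** P s) / 2 - (?q \<bullet> (P s *v ?q)) / 4) * ?k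
       + ((?p \<bullet> (P s *v ?p)) / 4 - trace (matrix_inv (C s) ** P s) / 2) * ?a - (?p \<bullet> (P s *v ?p)) / 4 * (?a - ?A))"
    unfolding 2 Ht_def by (simp add: inner_commute algebra_simps)
  show ?thesis unfolding 1 3 by (simp add: algebra_simps)
qed

text \<open>Away from the pole the slices of the ball stay bounded: monotonicity of \<open>C\<close>
  bounds the height of the Gaussian by its determinant at \<open>s1\<close> and the width by the
  quadratic form at \<open>s2\<close>.\<close>

lemma heat_ball_radius:
  assumes s: "0 < s1" "s1 \<le> s2" and r: "0 < r"
  obtains R where "0 < R" "\<And>s \<eta>. s1 \<le> s \<Longrightarrow> s \<le> s2 \<Longrightarrow> 1 < xv r \<eta> s \<Longrightarrow> norm \<eta> \<le> R"
proof -
  define m where "m = (\<Sum>i\<in>UNIV. \<Sum>j\<in>UNIV. \<bar>C s2 $ i $ j\<bar>) + 1"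
  have m: "0 < m" unfolding m_def by (intro add_nonneg_pos sum_nonneg) auto
  have mb: "(C s2 *v x) \<bullet> x \<le> m * (x \<bullet> x)" for x
    using quadratic_form_bound[of "C s2" x] inner_ge_zero[of x] unfolding m_def distrib_right by linarith
  define L where "L = r * (1 / sqrt (4 * pi) ^ CARD('n) / sqrt (det (C s1)))"
  have d1: "0 < det (C s1)" using det_spd_pos C_spd0 s by blast
  have L: "0 < L" using r d1 by (simp add: L_def)
  have mono: "(C s *v x) \<bullet> x \<le> (C t *v x) \<bullet> x" if "s \<le> t" for s t x
    using spd_nonneg[OF C_spd, of s t x] that by (cases "s = t") (auto simp: matrix_vector_mult_diff_rdistrib inner_diff_left)
  have "norm \<eta> \<le> sqrt (4 * L * m)" if h: "s1 \<le> s" "s \<le> s2" "1 < xv r \<eta> s" for s \<eta>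
  proof -
    have sp: "0 < s" using s h by simp
    let ?q = "(matrix_inv (C s) *v \<eta>) \<bullet> \<eta>"
    have "det (C s1) \<le> det (C s)" using s h sp by (intro det_spd_mono C_spd0 mono) auto
    then have "r * (1 / sqrt (4 * pi) ^ CARD('n) / sqrt (det (C s))) \<le> L"
      unfolding L_def using d1 r by (intro mult_left_mono divide_left_mono) auto
    then have "xv r \<eta> s \<le> L * exp (- (?q / 4))"
      unfolding xv_def gauss_alt mult.assoc[symmetric] by (intro mult_right_mono) auto
    then have "1 < L * exp (- (?q / 4))" using h by simp
    then have "exp (?q / 4) < L" by (simp add: exp_minus field_simps)
    moreover have "1 + ?q / 4 \<le> exp (?q / 4)" by (rule exp_ge_add_one_self)
    ultimately have q: "?q \<le> 4 * L" by linarith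
    have "(\<eta> \<bullet> \<eta>) / m \<le> (matrix_inv (C s2) *v \<eta>) \<bullet> \<eta>"
      using s by (intro spd_inv_lower_bound C_spd0 m mb) auto
    also have "\<dots> \<le> ?q" using s h sp by (intro spd_inv_antimono C_spd0 mono) auto
    finally have "\<eta> \<bullet> \<eta> \<le> 4 * L * m" using q m by (simp add: divide_le_eq) (meson mult_right_mono order_trans less_imp_le)
    then show ?thesis by (simp add: norm_eq_sqrt_inner)
  qed
  then show ?thesis using L m by (intro that[of "sqrt (4 * L * m)"]) auto
qed

lemma continuous_on_G: "s < snd z \<Longrightarrow> continuous_on X (\<lambda>\<eta>. G z \<eta> s)"
  unfolding G_def by (intro continuous_on_gauss continuous_intros C_spd)

lemma continuous_on_xv: "0 < s \<Longrightarrow> continuous_on X (\<lambda>\<eta>. xv r \<eta> s)"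
  unfolding xv_def by (intro continuous_intros continuous_on_gauss C_spd0)

lemma continuous_on_pv: "continuous_on X (\<lambda>\<eta>. pv \<eta> s)"
  unfolding pv_def by (intro continuous_on_mult_vec continuous_intros)

lemma continuous_on_qv: "continuous_on X (\<lambda>\<eta>. qv z \<eta> s)"
  unfolding qv_def by (intro continuous_on_mult_vec continuous_intros)

lemma continuous_on_Pmult: "continuous_on X f \<Longrightarrow> continuous_on X (\<lambda>\<eta>. (P s *v f \<eta>) $ i)"
  by (intro continuous_on_component continuous_on_mult_vec continuous_intros)

lemma DERIV_Fi_line:
  assumes s: "0 < s" "s < snd z" and r: "0 < r" and x1: "xv r (v + t *\<^sub>R axis i 1) s \<noteq> 1"
  shows "((\<lambda>t. Fi z r s i (v + t *\<^sub>R axis i 1)) has_real_derivative fi z r s i (v + t *\<^sub>R axis i 1)) (at t)"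
proof -
  let ?e = "axis i 1 :: real^'n"
  let ?h = "v + t *\<^sub>R ?e"
  have ax: "w \<bullet> ?e = w $ i" for w :: "real^'n" by (simp add: inner_axis)
  have G: "((\<lambda>t. G z (v + t *\<^sub>R ?e) s) has_real_derivative - (1/2) * qv z ?h s $ i * G z ?h s) (at t)"
    using DERIV_gauss_line[OF C_spd[OF s(2)], of "v - fst z" ?e t]
    by (simp add: G_def qv_def ax algebra_simps)
  have X: "((\<lambda>t. xv r (v + t *\<^sub>R ?e) s) has_real_derivative - (1/2) * pv ?h s $ i * xv r ?h s) (at t)"
    using DERIV_cmult[OF DERIV_gauss_line[OF C_spd0[OF s(1)], of v ?e t], of r]
    by (simp add: xv_def pv_def ax algebra_simps)
  have R: "((\<lambda>t. ramp (xv r (v + t *\<^sub>R ?e) s)) has_real_derivative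
      (if 1 < xv r ?h s then 1 else 0) * (- (1/2) * pv ?h s $ i * xv r ?h s)) (at t)"
    by (rule DERIV_chain2[OF DERIV_ramp[OF x1] X])
  have "((\<lambda>t. kappa (xv r (v + t *\<^sub>R ?e) s)) has_real_derivative
      ramp (xv r ?h s) / (1 + ramp (xv r ?h s)) * (- (1/2) * pv ?h s $ i * xv r ?h s)) (at t)"
    by (rule DERIV_chain2[OF DERIV_kappa X])
  also have "ramp (xv r ?h s) / (1 + ramp (xv r ?h s)) * (- (1/2) * pv ?h s $ i * xv r ?h s)
     = - (1/2) * pv ?h s $ i * (ramp (xv r ?h s) / (1 + ramp (xv r ?h s)) * xv r ?h s)" by (simp only: mult_ac)
  also have "\<dots> = - (1/2) * pv ?h s $ i * ramp (xv r ?h s)" unfolding ramp_identity ..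
  finally have K: "((\<lambda>t. kappa (xv r (v + t *\<^sub>R ?e) s)) has_real_derivative - (1/2) * pv ?h s $ i * ramp (xv r ?h s)) (at t)" .
  have lin: "((\<lambda>t. (P s *v (M *v (w + t *\<^sub>R ?e))) $ i) has_real_derivative (P s ** M) $ i $ i) (at t)" for M w
  proof -
    have eq: "(P s *v (M *v (w + t *\<^sub>R ?e))) $ i = (P s *v (M *v w)) $ i + t * (P s ** M) $ i $ i" for t
    proof -
      have "((P s ** M) *v ?e) $ i = (P s ** M) $ i $ i"
        by (simp add: matrix_vector_mult_basis column_def)
      then show ?thesis
        by (simp add: matrix_vector_mul_assoc matrix_vector_right_distrib matrix_vector_mult_scaleR)
    qed
    show ?thesis unfolding eq by (auto intro!: derivative_eq_intros)
  qed
  have Pp: "((\<lambda>t. (P s *v pv (v + t *\<^sub>R ?e) s) $ i) has_real_derivative (P s ** matrix_inv (C s)) $ i $ i) (at t)"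
    unfolding pv_def by (rule lin)
  have Pq: "((\<lambda>t. (P s *v qv z (v + t *\<^sub>R ?e) s) $ i) has_real_derivative (P s ** matrix_inv (C (snd z) - C s)) $ i $ i) (at t)"
    unfolding qv_def using lin[of "matrix_inv (C (snd z) - C s)" "v - fst z"] by (simp add: algebra_simps)
  show ?thesis
    unfolding Fi_def
    by (rule DERIV_cong[OF DERIV_mult[OF G DERIV_diff[OF DERIV_mult[OF R Pp] DERIV_mult[OF K Pq]]]])
      (simp add: fi_def algebra_simps)
qed

lemma integral_fi:
  assumes s: "0 < s" "s < snd z" and r: "0 < r"
  shows "integrable lborel (fi z r s i)" "(\<integral>\<eta>. fi z r s i \<eta> \<partial>lborel) = 0"
proof -
  obtain R where "0 < R" and R': "\<And>t \<eta>. s \<le> t \<Longrightarrow> t \<le> s \<Longrightarrow> 1 < xv r \<eta> t \<Longrightarrow> norm \<eta> \<le> R"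
    using heat_ball_radius[OF s(1) order_refl r] by blast
  note R = \<open>0 < R\<close> R'[OF order_refl order_refl]
  note ci = continuous_on_const continuous_on_G[OF s(2)] continuous_on_xv[OF s(1)] continuous_on_pv continuous_on_qv
    continuous_on_Pmult continuous_on_component continuous_on_ramp continuous_on_kappa
    continuous_on_add continuous_on_diff continuous_on_mult
  \<comment> \<open>The part of \<open>fi\<close> that is continuous; the remainder is a continuous
    function \<open>h\<close> cut off outside the slice of the ball. Boundedness and measurability
    follow from this splitting.\<close>
  define g where "g \<eta> = G z \<eta> s *
     (- (1/2) * qv z \<eta> s $ i * (ramp (xv r \<eta> s) * (P s *v pv \<eta> s) $ i - kappa (xv r \<eta> s) * (P s *v qv z \<eta> s) $ i)
      + (ramp (xv r \<eta> s) * (P s ** matrix_inv (C s)) $ i $ i - kappa (xv r \<eta> s) * (P s ** matrix_inv (C (snd z) - C s)) $ i $ i)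
      + (1/2) * pv \<eta> s $ i * ramp (xv r \<eta> s) * (P s *v qv z \<eta> s) $ i)" for \<eta>
  define h where "h \<eta> = G z \<eta> s * ((1/2) * (xv r \<eta> s * pv \<eta> s $ i * (P s *v pv \<eta> s) $ i))" for \<eta>
  have fi: "fi z r s i \<eta> = g \<eta> - (if 1 < xv r \<eta> s then h \<eta> else 0)" for \<eta>
    by (simp add: fi_def g_def h_def algebra_simps)
  have cF: "continuous_on X (Fi z r s i)" and cg: "continuous_on X g" and ch: "continuous_on X h" for X
    unfolding Fi_def[abs_def] g_def[abs_def] h_def[abs_def] by (intro ci)+
  have supp: "Fi z r s i \<eta> = 0 \<and> fi z r s i \<eta> = 0" if "R < norm \<eta>" for \<eta>
  proof -
    have "xv r \<eta> s \<le> 1" using R(2)[of \<eta>] that by linarith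
    then show ?thesis by (simp add: Fi_def fi_def kappa_eq_0 ramp_def)
  qed
  obtain B1 where B1: "0 \<le> B1" "\<And>\<eta>. norm \<eta> \<le> R \<Longrightarrow> \<bar>Fi z r s i \<eta>\<bar> \<le> B1" using continuous_bounded_cball[OF cF] by blast
  obtain B2 where B2: "0 \<le> B2" "\<And>\<eta>. norm \<eta> \<le> R \<Longrightarrow> \<bar>g \<eta>\<bar> \<le> B2" using continuous_bounded_cball[OF cg] by blast
  obtain B3 where B3: "0 \<le> B3" "\<And>\<eta>. norm \<eta> \<le> R \<Longrightarrow> \<bar>h \<eta>\<bar> \<le> B3" using continuous_bounded_cball[OF ch] by blast
  let ?B = "B1 + B2 + B3"
  have bF: "\<bar>Fi z r s i \<eta>\<bar> \<le> ?B" for \<eta>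
    using B1(2)[of \<eta>] supp[of \<eta>] B1(1) B2(1) B3(1) by (cases "norm \<eta> \<le> R") auto
  have bf: "\<bar>fi z r s i \<eta>\<bar> \<le> ?B" for \<eta>
  proof (cases "norm \<eta> \<le> R")
    case True
    have "\<bar>fi z r s i \<eta>\<bar> \<le> \<bar>g \<eta>\<bar> + \<bar>h \<eta>\<bar>" unfolding fi by auto
    then show ?thesis using B2(2)[OF True] B3(2)[OF True] B1(1) by linarith
  qed (use supp B1(1) B2(1) B3(1) in auto)
  have [measurable]: "Fi z r s i \<in> borel_measurable borel" "g \<in> borel_measurable borel" "h \<in> borel_measurable borel"
      "(\<lambda>\<eta>. xv r \<eta> s) \<in> borel_measurable borel"
    using cF cg ch continuous_on_xv[OF s(1)] by (intro borel_measurable_continuous_onI; simp)+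
  have mf: "fi z r s i \<in> borel_measurable borel" unfolding fi[abs_def] by measurable
  show "integrable lborel (fi z r s i)"
    by (rule integrable_bounded_support[OF mf bf compact_cball[of 0 R]]) (use supp in auto)
  show "(\<integral>\<eta>. fi z r s i \<eta> \<partial>lborel) = 0"
  proof (rule integral_directional_derivative_eq_0[of "Fi z r s i" "fi z r s i" ?B R "axis i 1" "\<lambda>v. {t. gauss (C s) (v + t *\<^sub>R axis i 1) = 1 / r}"])
    show "continuous_on UNIV (\<lambda>t. Fi z r s i (v + t *\<^sub>R axis i 1))" for v
      by (rule continuous_on_compose2[OF cF[of UNIV]]) (auto intro!: continuous_intros)
    show "finite {t. gauss (C s) (v + t *\<^sub>R axis i 1) = 1 / r}" for v
      using s r by (intro finite_gauss_level_line C_spd0) (auto simp: axis_eq_0_iff)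
    show "((\<lambda>t. Fi z r s i (v + t *\<^sub>R axis i 1)) has_real_derivative fi z r s i (v + t *\<^sub>R axis i 1)) (at t)"
      if "t \<notin> {t. gauss (C s) (v + t *\<^sub>R axis i 1) = 1 / r}" for v t
      using that r by (intro DERIV_Fi_line s r) (auto simp: xv_def field_simps)
  qed (use bF bf supp mf in auto)
qed

lemma integral_Ht_slice:
  assumes s: "0 < s" "s < snd z" and r: "0 < r"
  shows "integrable lborel (\<lambda>\<eta>. Ht z r \<eta> s + G z \<eta> s * W (\<eta>, s) * indicator (heat_ball r) (\<eta>, s))"
    "(\<integral>\<eta>. Ht z r \<eta> s + G z \<eta> s * W (\<eta>, s) * indicator (heat_ball r) (\<eta>, s) \<partial>lborel) = 0"
proof -
  have eq: "Ht z r \<eta> s + G z \<eta> s * W (\<eta>, s) * indicator (heat_ball r) (\<eta>, s) = - (1/2) * (\<Sum>i\<in>UNIV. fi z r s i \<eta>)" for \<eta>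
  proof -
    have "a = - 2 * b \<Longrightarrow> b = - (1/2) * a" for a b :: real by simp
    from this[OF sum_fi[OF assms]] show ?thesis .
  qed
  show "integrable lborel (\<lambda>\<eta>. Ht z r \<eta> s + G z \<eta> s * W (\<eta>, s) * indicator (heat_ball r) (\<eta>, s))"
    unfolding eq using integral_fi(1)[OF assms] by (intro integrable_mult_right Bochner_Integration.integrable_sum)
  show "(\<integral>\<eta>. Ht z r \<eta> s + G z \<eta> s * W (\<eta>, s) * indicator (heat_ball r) (\<eta>, s) \<partial>lborel) = 0"
    unfolding eq using integral_fi[OF assms] by (simp add: Bochner_Integration.integral_sum)
qed

text \<open>The decrease of \<open>qf z r\<close> over a time interval is the contribution of that
  strip of the ball to the potential at \<open>z\<close>. Its limits at time 0 and at the time of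
  \<open>z\<close> give r psi and kappa (r psi).\<close>

definition qf :: "(real^'n) \<times> real \<Rightarrow> real \<Rightarrow> real \<Rightarrow> real" where
  "qf z r s = (\<integral>\<eta>. G z \<eta> s * kappa (xv r \<eta> s) \<partial>lborel)"

lemma det_C_mono: "0 < s \<Longrightarrow> s \<le> t \<Longrightarrow> det (C s) \<le> det (C t)"
proof -
  assume s: "0 < s" "s \<le> t"
  have "(C s *v x) \<bullet> x \<le> (C t *v x) \<bullet> x" for x
    using spd_nonneg[OF C_spd, of s t x] s by (cases "s = t") (auto simp: matrix_vector_mult_diff_rdistrib inner_diff_left)
  then show ?thesis using s by (intro det_spd_mono C_spd0) auto
qed

lemma G_nonneg: "s < snd z \<Longrightarrow> 0 \<le> G z \<eta> s"
  by (simp add: G_def gauss_pos C_spd less_imp_le)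

lemma xv_nonneg: "0 < s \<Longrightarrow> 0 < r \<Longrightarrow> 0 \<le> xv r \<eta> s"
  by (simp add: xv_def gauss_pos C_spd0 less_imp_le)

lemma W_nonneg: "0 \<le> W z"
  by (simp add: W_def P_nonneg)

lemma continuous_on_joint:
  fixes z :: "(real^'n) \<times> real"
  assumes z: "\<And>w. w \<in> X \<Longrightarrow> 0 < snd w \<and> snd w < snd z"
  shows "continuous_on X (\<lambda>w. G z (fst w) (snd w))" "continuous_on X (\<lambda>w. qv z (fst w) (snd w))"
    "continuous_on X (\<lambda>w. Ht z r (fst w) (snd w))"
proof -
  have cC: "continuous_on X (\<lambda>w. C (snd w))" "continuous_on X (\<lambda>w. P (snd w))"
    by (intro continuous_on_C_comp continuous_on_P_comp continuous_intros)+
  have cD: "continuous_on X (\<lambda>w. C (snd z) - C (snd w))" by (intro continuous_intros cC)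
  have sD: "spd (C (snd z) - C (snd w))" and sC: "spd (C (snd w))" if "w \<in> X" for w
    using z[OF that] by (auto intro: C_spd C_spd0)
  have dD: "det (C (snd z) - C (snd w)) \<noteq> 0" and dC: "det (C (snd w)) \<noteq> 0" if "w \<in> X" for w
    using det_spd_pos[OF sD[OF that]] det_spd_pos[OF sC[OF that]] by auto
  show G: "continuous_on X (\<lambda>w. G z (fst w) (snd w))"
    unfolding G_def by (intro continuous_on_gauss cD sD continuous_intros)
  show q: "continuous_on X (\<lambda>w. qv z (fst w) (snd w))"
    unfolding qv_def by (intro continuous_on_matrix_inv_vec cD dD continuous_intros)
  have x: "continuous_on X (\<lambda>w. xv r (fst w) (snd w))"
    unfolding xv_def by (intro continuous_on_mult continuous_on_const continuous_on_gauss cC sC continuous_on_fst continuous_on_id)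
  have p: "continuous_on X (\<lambda>w. pv (fst w) (snd w))"
    unfolding pv_def by (intro continuous_on_matrix_inv_vec cC dC continuous_intros)
  have t: "continuous_on X (\<lambda>w. trace (matrix_inv (C (snd z) - C (snd w)) ** P (snd w)))"
    "continuous_on X (\<lambda>w. trace (matrix_inv (C (snd w)) ** P (snd w)))"
    by (rule continuous_on_trace_matrix_inv[OF cD cC(2) sD], assumption,
        rule continuous_on_trace_matrix_inv[OF cC sC], assumption)
  have Pp: "continuous_on X (\<lambda>w. (P (snd w) *v pv (fst w) (snd w)) \<bullet> pv (fst w) (snd w))"
    and Pq: "continuous_on X (\<lambda>w. (P (snd w) *v qv z (fst w) (snd w)) \<bullet> qv z (fst w) (snd w))"
    by (intro continuous_on_inner continuous_on_mult_vec cC p q)+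
  show "continuous_on X (\<lambda>w. Ht z r (fst w) (snd w))"
    unfolding Ht_def
    by (intro continuous_on_mult continuous_on_add continuous_on_diff continuous_on_divide continuous_on_const
        G x Pp Pq t continuous_on_ramp continuous_on_kappa) auto
qed

lemma continuous_on_W: "continuous_on {w. 0 < snd w} W"
proof -
  have cC: "continuous_on {w :: (real^'n) \<times> real. 0 < snd w} (\<lambda>w. C (snd w))"
    "continuous_on {w :: (real^'n) \<times> real. 0 < snd w} (\<lambda>w. P (snd w))"
    by (intro continuous_on_C_comp continuous_on_P_comp continuous_intros)+
  have dC: "det (C (snd w)) \<noteq> 0" if "w \<in> {w :: (real^'n) \<times> real. 0 < snd w}" for w
    using that det_spd_pos[OF C_spd0, of "snd w"] by auto
  have p: "continuous_on {w :: (real^'n) \<times> real. 0 < snd w} (\<lambda>w. matrix_inv (C (snd w)) *v fst w)"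
    by (intro continuous_on_matrix_inv_vec cC dC continuous_intros)
  have "continuous_on {w :: (real^'n) \<times> real. 0 < snd w} (\<lambda>w. ((P (snd w) *v (matrix_inv (C (snd w)) *v fst w)) \<bullet> (matrix_inv (C (snd w)) *v fst w)) / 4)"
    by (intro continuous_on_divide continuous_on_inner continuous_on_mult_vec cC p continuous_on_const) auto
  then show ?thesis by (rule continuous_on_cong[THEN iffD1, rotated -1]) (auto simp: W_def)
qed

lemma open_upper: "open {w :: 'a::topological_space \<times> real. 0 < snd w}"
  by (intro open_Collect_less continuous_intros)

lemma W_measurable [measurable]: "W \<in> borel_measurable borel"
proof -
  have "(\<lambda>w. indicator {w. 0 < snd w} w *\<^sub>R W w) \<in> borel_measurable borel"
    by (intro borel_measurable_continuous_on_indicator borel_open open_upper continuous_on_W)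
  also have "(\<lambda>w. indicator {w. 0 < snd w} w *\<^sub>R W w) = W"
    by (auto simp: fun_eq_iff W_def indicator_def)
  finally show ?thesis .
qed

lemma continuous_on_psi: "continuous_on {w. 0 < snd w} psi"
proof -
  have "continuous_on {w :: (real^'n) \<times> real. 0 < snd w} (\<lambda>w. gauss (C (snd w)) (fst w))"
    by (intro continuous_on_gauss continuous_on_C_comp continuous_intros C_spd0) auto
  then show ?thesis by (rule continuous_on_cong[THEN iffD1, rotated -1]) (auto simp: psi_def)
qed

lemma psi_measurable [measurable]: "psi \<in> borel_measurable borel"
proof -
  have "(\<lambda>w. indicator {w. 0 < snd w} w *\<^sub>R psi w) \<in> borel_measurable borel"
    by (intro borel_measurable_continuous_on_indicator borel_open open_upper continuous_on_psi)
  also have "(\<lambda>w. indicator {w. 0 < snd w} w *\<^sub>R psi w) = psi"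
    by (auto simp: fun_eq_iff psi_def indicator_def)
  finally show ?thesis .
qed

lemma heat_ball_measurable [measurable]: "heat_ball r \<in> sets borel"
  unfolding heat_ball_def by measurable

lemma psi_nonneg: "0 \<le> psi z"
  by (simp add: psi_def gauss_pos C_spd0 less_imp_le)

lemma psi_pos: "0 < snd z \<Longrightarrow> 0 < psi z"
  by (simp add: psi_def gauss_pos C_spd0)

lemma heat_ball_upper: "0 < r \<Longrightarrow> z \<in> heat_ball r \<Longrightarrow> 0 < snd z"
  by (auto simp: heat_ball_def psi_def split: if_splits)

text \<open>Fubini for \<open>Ht\<close> over the strip: in space first, the divergence identity
  turns it into minus the source term; in time first, the fundamental theorem of calculus gives the
  increments of G kappa.\<close>

lemma nn_integral_heat_ball_strip:
  assumes s: "0 < s1" "s1 \<le> s2" "s2 < snd z" and r: "0 < r"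
  shows "(\<integral>\<^sup>+s. (\<integral>\<^sup>+\<eta>. ennreal (G z \<eta> s * W (\<eta>, s) * indicator (heat_ball r) (\<eta>, s)) \<partial>lborel) * indicator {s1..s2} s \<partial>lborel)
    = ennreal (qf z r s1 - qf z r s2)" (is "?lhs = _")
proof -
  obtain R where R: "0 < R" "\<And>s \<eta>. s1 \<le> s \<Longrightarrow> s \<le> s2 \<Longrightarrow> 1 < xv r \<eta> s \<Longrightarrow> norm \<eta> \<le> R"
    using heat_ball_radius[OF s(1,2) r] by blast
  let ?H = "\<lambda>\<eta> s. indicator {s1..s2} s * Ht z r \<eta> s"
  let ?S = "{w :: (real^'n) \<times> real. s1 \<le> snd w \<and> snd w \<le> s2}"
  have supp: "kappa (xv r \<eta> s) = 0 \<and> ramp (xv r \<eta> s) = 0" if "R < norm \<eta>" "s1 \<le> s" "s \<le> s2" for \<eta> s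
  proof -
    have "xv r \<eta> s \<le> 1" using R(2)[of s \<eta>] that by linarith
    then show ?thesis by (simp add: kappa_eq_0 ramp_def)
  qed
  have suppH: "Ht z r \<eta> s = 0" if "R < norm \<eta>" "s1 \<le> s" "s \<le> s2" for \<eta> s
    using supp[OF that] by (simp add: Ht_def)
  have cl: "closed ?S" by (intro closed_Collect_conj closed_Collect_le continuous_intros)
  have cH: "continuous_on ?S (\<lambda>w. Ht z r (fst w) (snd w))"
    by (rule continuous_on_joint(3)) (use s in auto)
  have cmp: "compact (cball (0 :: real^'n) R \<times> {s1..s2})" by (intro compact_Times) auto
  have "bounded ((\<lambda>w. Ht z r (fst w) (snd w)) ` (cball 0 R \<times> {s1..s2}))"
    by (intro compact_imp_bounded compact_continuous_image continuous_on_subset[OF cH] cmp) auto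
  then obtain B where B: "0 < B" "\<And>w. w \<in> cball 0 R \<times> {s1..s2} \<Longrightarrow> \<bar>Ht z r (fst w) (snd w)\<bar> \<le> B"
    using bounded_pos by (metis (mono_tags, lifting) imageI real_norm_def)
  have int: "integrable (lborel \<Otimes>\<^sub>M lborel) (case_prod ?H)"
    unfolding lborel_prod
  proof (rule integrable_bounded_support[OF _ _ cmp, where B=B])
    have "(\<lambda>w. indicator ?S w *\<^sub>R Ht z r (fst w) (snd w)) \<in> borel_measurable borel"
      by (intro borel_measurable_continuous_on_indicator borel_closed cl cH)
    also have "(\<lambda>w. indicator ?S w *\<^sub>R Ht z r (fst w) (snd w)) = case_prod ?H"
      by (auto simp: fun_eq_iff indicator_def)
    finally show "case_prod ?H \<in> borel_measurable borel" .
    show "\<bar>case_prod ?H w\<bar> \<le> B" if "w \<in> cball 0 R \<times> {s1..s2}" for w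
      using B(2)[OF that] that by (auto simp: indicator_def case_prod_beta)
    show "case_prod ?H w = 0" if "w \<notin> cball 0 R \<times> {s1..s2}" for w
      using that suppH[of "fst w" "snd w"] by (cases w) (auto simp: indicator_def)
  qed
  have inner: "(\<integral>s. ?H \<eta> s \<partial>lborel) = G z \<eta> s2 * kappa (xv r \<eta> s2) - G z \<eta> s1 * kappa (xv r \<eta> s1)" for \<eta>
  proof -
    have "(\<integral>s. indicator {s1..s2} s *\<^sub>R Ht z r \<eta> s \<partial>lborel) = G z \<eta> s2 * kappa (xv r \<eta> s2) - G z \<eta> s1 * kappa (xv r \<eta> s1)"
    proof (rule integral_FTC_Icc[OF s(2)])
      show "((\<lambda>s. G z \<eta> s * kappa (xv r \<eta> s)) has_vector_derivative Ht z r \<eta> s) (at s within {s1..s2})"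
        if "s1 \<le> s" "s \<le> s2" for s
        using DERIV_G_kappa[of s z \<eta> r] s that
        by (auto simp: has_real_derivative_iff_has_vector_derivative intro: has_vector_derivative_at_within)
      show "continuous_on {s1..s2} (Ht z r \<eta>)"
      proof -
        have "continuous_on {s1..s2} (\<lambda>s. Ht z r (fst (\<eta>, s)) (snd (\<eta>, s)))"
          by (rule continuous_on_compose2[OF cH continuous_on_Pair[OF continuous_on_const continuous_on_id]]) auto
        then show ?thesis by simp
      qed
    qed
    then show ?thesis by simp
  qed
  have intG: "integrable lborel (\<lambda>\<eta>. G z \<eta> s * kappa (xv r \<eta> s))" if "s1 \<le> s" "s \<le> s2" for s
  proof -
    have c: "continuous_on X (\<lambda>\<eta>. G z \<eta> s * kappa (xv r \<eta> s))" for X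
      using s that by (intro continuous_on_mult continuous_on_kappa continuous_on_G continuous_on_xv) auto
    obtain B where "\<And>\<eta>. norm \<eta> \<le> R \<Longrightarrow> \<bar>G z \<eta> s * kappa (xv r \<eta> s)\<bar> \<le> B"
      using continuous_bounded_cball[OF c] by blast
    then show ?thesis
      using borel_measurable_continuous_onI[OF c] supp[OF _ that]
      by (intro integrable_bounded_support[where B=B and K="cball 0 R"]) auto
  qed
  have intH: "integrable lborel (\<lambda>\<eta>. Ht z r \<eta> s)" if "s1 \<le> s" "s \<le> s2" for s
  proof -
    have c: "continuous_on X (\<lambda>\<eta>. Ht z r \<eta> s)" for X
    proof -
      have "continuous_on X (\<lambda>\<eta>. Ht z r (fst (\<eta>, s)) (snd (\<eta>, s)))"
        by (rule continuous_on_compose2[OF cH continuous_on_Pair[OF continuous_on_id continuous_on_const]]) (use that in auto)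
      then show ?thesis by simp
    qed
    obtain B where "\<And>\<eta>. norm \<eta> \<le> R \<Longrightarrow> \<bar>Ht z r \<eta> s\<bar> \<le> B"
      using continuous_bounded_cball[OF c] by blast
    then show ?thesis
      using borel_measurable_continuous_onI[OF c] suppH[OF _ that]
      by (intro integrable_bounded_support[where B=B and K="cball 0 R"]) auto
  qed
  have slice: "(\<integral>\<^sup>+\<eta>. ennreal (G z \<eta> s * W (\<eta>, s) * indicator (heat_ball r) (\<eta>, s)) \<partial>lborel) = ennreal (- (\<integral>\<eta>. Ht z r \<eta> s \<partial>lborel))"
    and neg: "(\<integral>\<eta>. Ht z r \<eta> s \<partial>lborel) \<le> 0" if "s1 \<le> s" "s \<le> s2" for s
  proof -
    have ss: "0 < s" "s < snd z" using that s by auto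
    let ?g = "\<lambda>\<eta>. G z \<eta> s * W (\<eta>, s) * indicator (heat_ball r) (\<eta>, s)"
    have "integrable lborel (\<lambda>\<eta>. (Ht z r \<eta> s + ?g \<eta>) - Ht z r \<eta> s)"
      by (intro Bochner_Integration.integrable_diff integral_Ht_slice ss r intH that)
    then have i: "integrable lborel ?g" by simp
    have nn: "0 \<le> ?g \<eta>" for \<eta> using G_nonneg[OF ss(2)] W_nonneg by simp
    have e: "(\<integral>\<eta>. ?g \<eta> \<partial>lborel) = - (\<integral>\<eta>. Ht z r \<eta> s \<partial>lborel)"
      using integral_Ht_slice(2)[OF ss r] Bochner_Integration.integral_add[OF intH[OF that] i] by simp
    have "(\<integral>\<^sup>+\<eta>. ennreal (?g \<eta>) \<partial>lborel) = ennreal (\<integral>\<eta>. ?g \<eta> \<partial>lborel)"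
      using i nn by (intro nn_integral_eq_integral) auto
    then show "(\<integral>\<^sup>+\<eta>. ennreal (?g \<eta>) \<partial>lborel) = ennreal (- (\<integral>\<eta>. Ht z r \<eta> s \<partial>lborel))" unfolding e .
    have "0 \<le> (\<integral>\<eta>. ?g \<eta> \<partial>lborel)" using nn by (intro Bochner_Integration.integral_nonneg) auto
    then show "(\<integral>\<eta>. Ht z r \<eta> s \<partial>lborel) \<le> 0" unfolding e by simp
  qed
  have io: "(\<integral>\<eta>. ?H \<eta> s \<partial>lborel) = indicator {s1..s2} s * (\<integral>\<eta>. Ht z r \<eta> s \<partial>lborel)" for s by simp
  have iH: "integrable lborel (\<lambda>s. (\<integral>\<eta>. ?H \<eta> s \<partial>lborel))"
    by (rule lborel_pair.integrable_snd[OF int])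
  have "?lhs = (\<integral>\<^sup>+s. ennreal (- (\<integral>\<eta>. ?H \<eta> s \<partial>lborel)) \<partial>lborel)"
    unfolding io
  proof (rule nn_integral_cong)
    fix s
    show "(\<integral>\<^sup>+\<eta>. ennreal (G z \<eta> s * W (\<eta>, s) * indicator (heat_ball r) (\<eta>, s)) \<partial>lborel) * indicator {s1..s2} s =
      ennreal (- (indicator {s1..s2} s * (\<integral>\<eta>. Ht z r \<eta> s \<partial>lborel)))"
      by (cases "s \<in> {s1..s2}") (simp_all add: slice)
  qed
  also have "\<dots> = ennreal (\<integral>s. - (\<integral>\<eta>. ?H \<eta> s \<partial>lborel) \<partial>lborel)"
    using iH neg by (intro nn_integral_eq_integral Bochner_Integration.integrable_minus) (auto simp: io indicator_def)
  also have "(\<integral>s. - (\<integral>\<eta>. ?H \<eta> s \<partial>lborel) \<partial>lborel) = - (\<integral>s. (\<integral>\<eta>. ?H \<eta> s \<partial>lborel) \<partial>lborel)" by simp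
  also have "(\<integral>s. (\<integral>\<eta>. ?H \<eta> s \<partial>lborel) \<partial>lborel) = (\<integral>\<eta>. (\<integral>s. ?H \<eta> s \<partial>lborel) \<partial>lborel)"
    by (rule lborel_pair.Fubini_integral[OF int])
  also have "\<dots> = qf z r s2 - qf z r s1"
    unfolding inner qf_def using s by (intro Bochner_Integration.integral_diff intG) auto
  finally show ?thesis by simp
qed

section \<open>Limits at the pole and at the evaluation point\<close>

lemma integrable_G: "s < snd z \<Longrightarrow> integrable lborel (\<lambda>\<eta>. G z \<eta> s)"
  and integral_G: "s < snd z \<Longrightarrow> (\<integral>\<eta>. G z \<eta> s \<partial>lborel) = 1"
proof -
  assume s: "s < snd z"
  have m: "(\<lambda>\<eta>. G z \<eta> s) \<in> borel_measurable borel"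
    using continuous_on_G[OF s] by (intro borel_measurable_continuous_onI)
  have n: "(\<integral>\<^sup>+\<eta>. ennreal (G z \<eta> s) \<partial>lborel) = 1"
    unfolding G_def by (rule nn_integral_gauss[OF C_spd[OF s]])
  show i: "integrable lborel (\<lambda>\<eta>. G z \<eta> s)"
    using m n G_nonneg[OF s] by (intro integrableI_nonneg) auto
  show "(\<integral>\<eta>. G z \<eta> s \<partial>lborel) = 1"
    using n nn_integral_eq_integral[OF i] G_nonneg[OF s] by (simp add: ennreal_eq_1)
qed

text \<open>Chapman-Kolmogorov with the pole as source, so the value does not depend on
  \<open>s\<close>.\<close>

lemma nn_integral_G_xv:
  assumes s: "0 < s" "s < snd z" and r: "0 < r"
  shows "(\<integral>\<^sup>+\<eta>. ennreal (G z \<eta> s * xv r \<eta> s) \<partial>lborel) = ennreal (r * psi z)"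
proof -
  have "(\<integral>\<^sup>+\<eta>. ennreal (G z \<eta> s * xv r \<eta> s) \<partial>lborel) =
     (\<integral>\<^sup>+\<eta>. ennreal r * (ennreal (gauss (C s) (0 - \<eta>)) * ennreal (gauss (C (snd z) - C s) (\<eta> - fst z))) \<partial>lborel)"
    using gauss_pos[OF C_spd0[OF s(1)]] gauss_pos[OF C_spd[OF s(2)]] r
    by (intro nn_integral_cong) (simp add: G_def xv_def ennreal_mult[symmetric] less_imp_le mult_ac)
  also have "\<dots> = ennreal r * ennreal (gauss (C s + (C (snd z) - C s)) (0 - fst z))"
    by (subst nn_integral_cmult) (simp_all only: gauss_convolution[OF C_spd0[OF s(1)] C_spd[OF s(2)]], measurable)
  also have "\<dots> = ennreal (r * psi z)"
    using s r psi_nonneg[of z] by (simp add: psi_def ennreal_mult)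
  finally show ?thesis .
qed

lemma integrable_G_kappa:
  assumes s: "0 < s" "s < snd z" and r: "0 < r"
  shows "integrable lborel (\<lambda>\<eta>. G z \<eta> s * kappa (xv r \<eta> s))"
    and "qf z r s \<le> r * psi z"
    and "ennreal (qf z r s) = (\<integral>\<^sup>+\<eta>. ennreal (G z \<eta> s * kappa (xv r \<eta> s)) \<partial>lborel)"
proof -
  have nn: "0 \<le> G z \<eta> s * kappa (xv r \<eta> s)" for \<eta> using G_nonneg[OF s(2)] kappa_nonneg by simp
  have m: "(\<lambda>\<eta>. G z \<eta> s * kappa (xv r \<eta> s)) \<in> borel_measurable borel"
    using s by (intro borel_measurable_continuous_onI continuous_on_mult continuous_on_kappa continuous_on_G continuous_on_xv) auto
  have le: "(\<integral>\<^sup>+\<eta>. ennreal (G z \<eta> s * kappa (xv r \<eta> s)) \<partial>lborel) \<le> ennreal (r * psi z)"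
    unfolding nn_integral_G_xv[OF assms, symmetric]
    using G_nonneg[OF s(2)] kappa_le xv_nonneg[OF s(1) r] by (intro nn_integral_mono ennreal_leI mult_left_mono) auto
  then show i: "integrable lborel (\<lambda>\<eta>. G z \<eta> s * kappa (xv r \<eta> s))"
    using m nn by (intro integrableI_nonneg) (auto simp: le_less_trans)
  then show eq: "ennreal (qf z r s) = (\<integral>\<^sup>+\<eta>. ennreal (G z \<eta> s * kappa (xv r \<eta> s)) \<partial>lborel)"
    unfolding qf_def using nn by (intro nn_integral_eq_integral[symmetric]) auto
  show "qf z r s \<le> r * psi z"
    using le psi_nonneg[of z] r unfolding eq[symmetric] by (subst (asm) ennreal_le_iff) auto
qed

text \<open>Replacing kappa x by x costs at most 2 sqrt x. With \<open>G\<close> bounded by its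
  maximum, the error is controlled by the mass of the square root of a Gaussian.\<close>

lemma qf_lower_bound:
  assumes s: "0 < s" "s < snd z" and r: "0 < r"
  shows "r * psi z \<le> qf z r s + 2 * sqrt r * (sqrt (sqrt (4 * pi) ^ CARD('n)) * sqrt 2 ^ CARD('n) * sqrt (sqrt (det (C s))))
      / (sqrt (4 * pi) ^ CARD('n) * sqrt (det (C (snd z) - C s)))"
proof -
  let ?k = "1 / (sqrt (4 * pi) ^ CARD('n) * sqrt (det (C (snd z) - C s)))"
  let ?S = "sqrt (sqrt (4 * pi) ^ CARD('n)) * sqrt 2 ^ CARD('n) * sqrt (sqrt (det (C s)))"
  note dC = det_spd_pos[OF C_spd0[OF s(1)]] and dD = det_spd_pos[OF C_spd[OF s(2)]]
  have Gk: "G z \<eta> s \<le> ?k" for \<eta>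
  proof -
    have "exp (- ((matrix_inv (C (snd z) - C s) *v (\<eta> - fst z)) \<bullet> (\<eta> - fst z) / 4)) \<le> 1"
      using spd_nonneg[OF spd_matrix_inv[OF C_spd[OF s(2)]]] by simp
    then have "?k * exp (- ((matrix_inv (C (snd z) - C s) *v (\<eta> - fst z)) \<bullet> (\<eta> - fst z) / 4)) \<le> ?k * 1"
      using dD by (intro mult_left_mono) auto
    then show ?thesis by (simp add: G_def gauss_alt)
  qed
  have "ennreal (r * psi z) = (\<integral>\<^sup>+\<eta>. ennreal (G z \<eta> s * xv r \<eta> s) \<partial>lborel)"
    by (rule nn_integral_G_xv[OF assms, symmetric])
  also have "\<dots> \<le> (\<integral>\<^sup>+\<eta>. ennreal (G z \<eta> s * kappa (xv r \<eta> s)) + ennreal (?k * 2 * sqrt r) * ennreal (sqrt (gauss (C s) \<eta>)) \<partial>lborel)"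
  proof (rule nn_integral_mono)
    fix \<eta>
    have "xv r \<eta> s - kappa (xv r \<eta> s) \<le> 2 * sqrt (xv r \<eta> s)" by (rule minus_kappa_le_sqrt[OF xv_nonneg[OF s(1) r]])
    then have "G z \<eta> s * (xv r \<eta> s - kappa (xv r \<eta> s)) \<le> G z \<eta> s * (2 * sqrt (xv r \<eta> s))"
      using G_nonneg[OF s(2)] by (rule mult_left_mono)
    also have "\<dots> \<le> ?k * (2 * sqrt (xv r \<eta> s))"
      using Gk[of \<eta>] xv_nonneg[OF s(1) r, of \<eta>] by (intro mult_right_mono) auto
    also have "\<dots> = ?k * 2 * sqrt r * sqrt (gauss (C s) \<eta>)" by (simp add: xv_def real_sqrt_mult)
    finally have "G z \<eta> s * xv r \<eta> s \<le> G z \<eta> s * kappa (xv r \<eta> s) + ?k * 2 * sqrt r * sqrt (gauss (C s) \<eta>)"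
      by (simp add: algebra_simps)
    then have "ennreal (G z \<eta> s * xv r \<eta> s) \<le> ennreal (G z \<eta> s * kappa (xv r \<eta> s) + ?k * 2 * sqrt r * sqrt (gauss (C s) \<eta>))"
      by (rule ennreal_leI)
    also have "\<dots> = ennreal (G z \<eta> s * kappa (xv r \<eta> s)) + ennreal (?k * 2 * sqrt r) * ennreal (sqrt (gauss (C s) \<eta>))"
      using G_nonneg[OF s(2)] kappa_nonneg r dD gauss_pos[OF C_spd0[OF s(1)], of \<eta>]
      by (subst ennreal_plus) (auto simp: ennreal_mult[symmetric] less_imp_le)
    finally show "ennreal (G z \<eta> s * xv r \<eta> s) \<le> ennreal (G z \<eta> s * kappa (xv r \<eta> s)) + ennreal (?k * 2 * sqrt r) * ennreal (sqrt (gauss (C s) \<eta>))" .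
  qed
  also have "\<dots> = ennreal (qf z r s) + ennreal (?k * 2 * sqrt r) * ennreal ?S"
    unfolding integrable_G_kappa(3)[OF assms] nn_integral_sqrt_gauss[OF C_spd0[OF s(1)], symmetric]
    using integrable_G_kappa(1)[OF assms]
    by (subst nn_integral_add) (auto intro!: nn_integral_cmult)
  also have "\<dots> = ennreal (qf z r s + ?k * 2 * sqrt r * ?S)"
  proof -
    have "0 \<le> qf z r s" unfolding qf_def
      using G_nonneg[OF s(2)] kappa_nonneg by (intro Bochner_Integration.integral_nonneg) auto
    then show ?thesis using dD dC r by (simp add: ennreal_mult[symmetric] ennreal_plus[symmetric] del: ennreal_plus)
  qed
  finally have "r * psi z \<le> qf z r s + ?k * 2 * sqrt r * ?S"
  proof (subst (asm) ennreal_le_iff)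
    show "0 \<le> qf z r s + ?k * 2 * sqrt r * ?S"
      using G_nonneg[OF s(2)] kappa_nonneg dD dC r unfolding qf_def
      by (intro add_nonneg_nonneg Bochner_Integration.integral_nonneg) auto
  qed
  then show ?thesis by (simp add: mult_ac)
qed

text \<open>The error bound carries the factor (det (C s))^(1/4), which vanishes since
  \<open>C 0 = 0\<close>, while the maximum of \<open>G\<close> stays bounded as long as the time of
  \<open>z\<close> is positive.\<close>

lemma qf_tendsto_pole:
  assumes z: "0 < snd z" and r: "0 < r" and a: "\<And>k. 0 < a k" "\<And>k. a k < snd z" "a \<longlonglongrightarrow> 0"
  shows "(\<lambda>k. qf z r (a k)) \<longlonglongrightarrow> r * psi z"
proof -
  have Ca: "(\<lambda>k. C (a k)) \<longlonglongrightarrow> C 0"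
    using continuous_on_tendsto_compose[OF C_cont[of UNIV] a(3)] by simp
  have d1: "(\<lambda>k. det (C (a k))) \<longlonglongrightarrow> det (C 0)"
    and d2: "(\<lambda>k. det (C (snd z) - C (a k))) \<longlonglongrightarrow> det (C (snd z) - C 0)"
    unfolding det_def by (intro tendsto_intros Ca)+
  have C0: "det (C 0) = 0" "det (C (snd z) - C 0) \<noteq> 0"
    using det_spd_pos[OF C_spd0[OF z]] by (simp_all add: C_0) (metis det_0 mat_0)
  let ?b = "\<lambda>d d'. 2 * sqrt r * (sqrt (sqrt (4 * pi) ^ CARD('n)) * sqrt 2 ^ CARD('n) * sqrt (sqrt d))
      / (sqrt (4 * pi) ^ CARD('n) * sqrt d')"
  have "(\<lambda>k. r * psi z - ?b (det (C (a k))) (det (C (snd z) - C (a k)))) \<longlonglongrightarrow> r * psi z - ?b (det (C 0)) (det (C (snd z) - C 0))"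
    using C0(2) by (intro tendsto_intros d1 d2) auto
  then have lo: "(\<lambda>k. r * psi z - ?b (det (C (a k))) (det (C (snd z) - C (a k)))) \<longlonglongrightarrow> r * psi z"
    by (simp add: C0(1))
  show ?thesis
  proof (rule tendsto_sandwich[OF _ _ lo tendsto_const[of "r * psi z"]])
    show "\<forall>\<^sub>F k in sequentially. r * psi z - ?b (det (C (a k))) (det (C (snd z) - C (a k))) \<le> qf z r (a k)"
      using qf_lower_bound[OF a(1,2) r] by (intro always_eventually allI) (simp add: diff_le_eq)
    show "\<forall>\<^sub>F k in sequentially. qf z r (a k) \<le> r * psi z"
      using integrable_G_kappa(2)[OF a(1,2) r] by (intro always_eventually allI)
  qed
qed

text \<open>Bounds the quadratic form of \<open>C t - C s\<close> by its entries. The summand t - s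
  makes positivity immediate and does not disturb the limit 0.\<close>

definition width :: "real \<Rightarrow> real \<Rightarrow> real" where
  "width t s = (\<Sum>i\<in>UNIV. \<Sum>j\<in>UNIV. \<bar>(C t - C s) $ i $ j\<bar>) + (t - s)"

lemma width_pos: "s < t \<Longrightarrow> 0 < width t s"
  unfolding width_def by (intro add_nonneg_pos sum_nonneg) auto

lemma width_bound: "s < t \<Longrightarrow> ((C t - C s) *v x) \<bullet> x \<le> width t s * (x \<bullet> x)"
  using quadratic_form_bound[of "C t - C s" x] inner_ge_zero[of x] mult_nonneg_nonneg[of "t - s" "x \<bullet> x"]
  unfolding width_def distrib_right by linarith

lemma width_tendsto:
  assumes "b \<longlonglongrightarrow> t" shows "(\<lambda>k. width t (b k)) \<longlonglongrightarrow> 0"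
proof -
  have Cb: "(\<lambda>k. C (b k)) \<longlonglongrightarrow> C t"
    using continuous_on_tendsto_compose[OF C_cont[of UNIV] assms] by simp
  have "(\<lambda>k. width t (b k)) \<longlonglongrightarrow> (\<Sum>i\<in>UNIV. \<Sum>j\<in>UNIV. \<bar>(C t - C t) $ i $ j\<bar>) + (t - t)"
    unfolding width_def by (intro tendsto_intros Cb assms)
  then show ?thesis by simp
qed

lemma exp_minus_le_inverse: "0 < u \<Longrightarrow> exp (- u) \<le> 1 / u" for u :: real
  using order_trans[OF _ exp_ge_add_one_self[of u], of u] by (simp add: exp_minus field_simps)

text \<open>\<open>G\<close> concentrates at \<open>fst z\<close>. Near that point the continuity of
  \<open>kappa\<close> gives \<epsilon>; far from it the Gaussian tail is small and
  \<open>kappa\<close> is bounded, because times at least \<open>snd z / 2\<close> stay away from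
  the pole.\<close>

lemma qf_near_source:
  assumes z: "0 < snd z" and r: "0 < r" and e: "0 < \<epsilon>"
  obtains \<delta> B where "0 < \<delta>"
    "\<And>s. snd z / 2 \<le> s \<Longrightarrow> snd z - \<delta> < s \<Longrightarrow> s < snd z \<Longrightarrow> \<bar>qf z r s - kappa (r * psi z)\<bar> \<le> \<epsilon> + B * width (snd z) s"
proof -
  let ?t = "snd z" and ?y = "fst z"
  let ?f = "\<lambda>w. kappa (xv r (fst w) (snd w))"
  have cf: "continuous_on {w. 0 < snd w} ?f"
    unfolding xv_def by (intro continuous_on_kappa continuous_on_mult continuous_on_const continuous_on_gauss
      continuous_on_C_comp continuous_on_fst continuous_on_snd continuous_on_id C_spd0) auto
  have "z \<in> {w. 0 < snd w}" using z by simp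
  then obtain d where d: "0 < d" "\<And>w. w \<in> {w. 0 < snd w} \<Longrightarrow> dist w z < d \<Longrightarrow> dist (?f w) (?f z) < \<epsilon>"
    using cf e unfolding continuous_on_iff by blast
  have k0: "kappa (r * psi z) = ?f z" using z by (simp add: psi_def xv_def)
  define B0 where "B0 = r * (1 / sqrt (4 * pi) ^ CARD('n) / sqrt (det (C (?t / 2))))"
  have dh: "0 < det (C (?t / 2))" using z by (intro det_spd_pos C_spd0) simp
  have B0: "0 < B0" using r dh by (simp add: B0_def)
  have fb: "0 \<le> ?f (\<eta>, s) \<and> ?f (\<eta>, s) \<le> B0" if s: "?t / 2 \<le> s" for \<eta> s
  proof -
    have sp: "0 < s" using s z by simp
    have "det (C (?t / 2)) \<le> det (C s)" using s z by (intro det_C_mono) auto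
    then have "r * (1 / sqrt (4 * pi) ^ CARD('n) / sqrt (det (C s))) \<le> B0"
      unfolding B0_def using dh r by (intro mult_left_mono divide_left_mono) auto
    moreover have "exp (- ((matrix_inv (C s) *v \<eta>) \<bullet> \<eta> / 4)) \<le> 1"
      using spd_nonneg[OF spd_matrix_inv[OF C_spd0[OF sp]]] by simp
    ultimately have "xv r \<eta> s \<le> B0 * 1"
      unfolding xv_def gauss_alt mult.assoc[symmetric] using B0 by (intro mult_mono) auto
    then show ?thesis using kappa_le[OF xv_nonneg[OF sp r], of \<eta>] kappa_nonneg by auto
  qed
  \<comment> \<open>The factor 8 / (d / 2)^2 arises from the tail exp (- u) \<le> 1 / u with u = (d
    / 2)^2 / (8 width).\<close>
  define B where "B = B0 * sqrt 2 ^ CARD('n) * 8 / (d / 2)\<^sup>2"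
  show ?thesis
  proof (rule that[of "d / 2" B])
    show "0 < d / 2" using d by simp
    fix s assume s: "?t / 2 \<le> s" "?t - d / 2 < s" "s < ?t"
    have sp: "0 < s" using s z by simp
    let ?far = "{\<eta>. d / 2 \<le> norm (\<eta> - ?y)}"
    have pt: "\<bar>?f (\<eta>, s) - ?f z\<bar> \<le> \<epsilon> + B0 * indicator ?far \<eta>" for \<eta>
    proof (cases "\<eta> \<in> ?far")
      case True
      then show ?thesis using fb[OF s(1), of \<eta>] fb[of ?t ?y] z e
        by (simp add: abs_le_iff)
    next
      case False
      have "dist (\<eta>, s) z \<le> norm (\<eta> - ?y) + norm (s - ?t)"
        using norm_Pair_le[of "\<eta> - ?y" "s - ?t"] by (cases z) (simp add: dist_norm)
      then have "dist (\<eta>, s) z < d" using False s by simp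
      then show ?thesis using d(2)[of "(\<eta>, s)"] sp False by (simp add: dist_real_def)
    qed
    have intk: "integrable lborel (\<lambda>\<eta>. G z \<eta> s * ?f (\<eta>, s))"
      using integrable_G_kappa(1)[OF sp s(3) r] by simp
    have intc: "integrable lborel (\<lambda>\<eta>. G z \<eta> s * ?f z)" using integrable_G[OF s(3)] by simp
    have "qf z r s - ?f z = (\<integral>\<eta>. G z \<eta> s * ?f (\<eta>, s) - G z \<eta> s * ?f z \<partial>lborel)"
      unfolding Bochner_Integration.integral_diff[OF intk intc] qf_def by (simp add: integral_G[OF s(3)])
    also have "\<dots> = (\<integral>\<eta>. G z \<eta> s * (?f (\<eta>, s) - ?f z) \<partial>lborel)" by (simp only: right_diff_distrib)
    finally have q: "qf z r s - ?f z = (\<integral>\<eta>. G z \<eta> s * (?f (\<eta>, s) - ?f z) \<partial>lborel)" .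
    have "integrable lborel (\<lambda>\<eta>. G z \<eta> s * (?f (\<eta>, s) - ?f z))"
      using Bochner_Integration.integrable_diff[OF intk intc] by (simp only: right_diff_distrib)
    then have "ennreal \<bar>qf z r s - ?f z\<bar> \<le> (\<integral>\<^sup>+\<eta>. ennreal \<bar>G z \<eta> s * (?f (\<eta>, s) - ?f z)\<bar> \<partial>lborel)"
      unfolding q using integral_norm_bound_ennreal by fastforce
    also have "\<dots> \<le> (\<integral>\<^sup>+\<eta>. ennreal \<epsilon> * ennreal (G z \<eta> s) + ennreal B0 * (ennreal (G z \<eta> s) * indicator ?far \<eta>) \<partial>lborel)"
    proof (rule nn_integral_mono)
      fix \<eta>
      have "\<bar>G z \<eta> s * (?f (\<eta>, s) - ?f z)\<bar> \<le> G z \<eta> s * (\<epsilon> + B0 * indicator ?far \<eta>)"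
        using pt[of \<eta>] G_nonneg[OF s(3), of \<eta>] by (simp add: abs_mult mult_left_mono)
      also have "\<dots> = \<epsilon> * G z \<eta> s + B0 * (G z \<eta> s * indicator ?far \<eta>)" by (simp add: algebra_simps)
      finally show "ennreal \<bar>G z \<eta> s * (?f (\<eta>, s) - ?f z)\<bar> \<le> ennreal \<epsilon> * ennreal (G z \<eta> s) + ennreal B0 * (ennreal (G z \<eta> s) * indicator ?far \<eta>)"
        using e B0 G_nonneg[OF s(3), of \<eta>]
        by (cases "\<eta> \<in> ?far") (auto simp: ennreal_mult[symmetric] ennreal_plus[symmetric] intro!: ennreal_leI simp del: ennreal_plus)
    qed
    also have "\<dots> = ennreal \<epsilon> * (\<integral>\<^sup>+\<eta>. ennreal (G z \<eta> s) \<partial>lborel) + ennreal B0 * (\<integral>\<^sup>+\<eta>. ennreal (G z \<eta> s) * indicator ?far \<eta> \<partial>lborel)"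
    proof -
      have [measurable]: "(\<lambda>\<eta>. G z \<eta> s) \<in> borel_measurable borel"
        using continuous_on_G[OF s(3)] by (intro borel_measurable_continuous_onI)
      show ?thesis by (subst nn_integral_add, simp, simp, subst nn_integral_cmult, simp, subst nn_integral_cmult, simp_all)
    qed
    also have "\<dots> \<le> ennreal \<epsilon> * 1 + ennreal B0 * ennreal (sqrt 2 ^ CARD('n) * (8 * width ?t s / (d / 2)\<^sup>2))"
    proof (intro add_mono mult_left_mono)
      show "(\<integral>\<^sup>+\<eta>. ennreal (G z \<eta> s) \<partial>lborel) \<le> 1"
        unfolding G_def by (simp add: nn_integral_gauss[OF C_spd[OF s(3)]])
      have "(\<integral>\<^sup>+\<eta>. ennreal (G z \<eta> s) * indicator ?far \<eta> \<partial>lborel) \<le> ennreal (sqrt 2 ^ CARD('n) * exp (- ((d / 2)\<^sup>2 / (8 * width ?t s))))"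
        unfolding G_def using d by (intro gauss_tail C_spd s width_pos width_bound) auto
      also have "\<dots> \<le> ennreal (sqrt 2 ^ CARD('n) * (8 * width ?t s / (d / 2)\<^sup>2))"
        using exp_minus_le_inverse[of "(d / 2)\<^sup>2 / (8 * width ?t s)"] d width_pos[OF s(3)]
        by (intro ennreal_leI mult_left_mono) auto
      finally show "(\<integral>\<^sup>+\<eta>. ennreal (G z \<eta> s) * indicator ?far \<eta> \<partial>lborel) \<le> ennreal (sqrt 2 ^ CARD('n) * (8 * width ?t s / (d / 2)\<^sup>2))" .
    qed auto
    also have "\<dots> = ennreal (\<epsilon> + B * width ?t s)"
      using e B0 width_pos[OF s(3)] by (simp add: B_def ennreal_mult[symmetric] ennreal_plus[symmetric] mult_ac del: ennreal_plus)
    finally show "\<bar>qf z r s - kappa (r * psi z)\<bar> \<le> \<epsilon> + B * width ?t s"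
      unfolding k0 using e B0 width_pos[OF s(3)]
      by (subst (asm) ennreal_le_iff) (auto simp: B_def)
  qed
qed

lemma qf_tendsto_source:
  assumes z: "0 < snd z" and r: "0 < r" and b: "\<And>k. b k < snd z" "b \<longlonglongrightarrow> snd z"
  shows "(\<lambda>k. qf z r (b k)) \<longlonglongrightarrow> kappa (r * psi z)"
proof (rule LIMSEQ_I)
  fix e :: real assume e: "0 < e"
  then obtain \<delta> B where dB: "0 < \<delta>"
    "\<And>s. snd z / 2 \<le> s \<Longrightarrow> snd z - \<delta> < s \<Longrightarrow> s < snd z \<Longrightarrow> \<bar>qf z r s - kappa (r * psi z)\<bar> \<le> e / 3 + B * width (snd z) s"
    using qf_near_source[OF z r, of "e / 3"] by (metis divide_pos_pos zero_less_numeral)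
  have "(\<lambda>k. B * width (snd z) (b k)) \<longlonglongrightarrow> B * 0" by (intro tendsto_intros width_tendsto b)
  then have "\<forall>\<^sub>F k in sequentially. B * width (snd z) (b k) < e / 3"
    using e by (intro order_tendstoD) auto
  moreover have "\<forall>\<^sub>F k in sequentially. snd z / 2 < b k" "\<forall>\<^sub>F k in sequentially. snd z - \<delta> < b k"
    using b z dB(1) by (intro order_tendstoD(1)[OF b(2)]; simp)+
  ultimately have "\<forall>\<^sub>F k in sequentially. norm (qf z r (b k) - kappa (r * psi z)) < e"
  proof eventually_elim
    case (elim k)
    then show ?case using dB(2)[of "b k"] b(1)[of k] e by simp
  qed
  then show "\<exists>no. \<forall>n\<ge>no. norm (qf z r (b n) - kappa (r * psi z)) < e"
    by (simp add: eventually_sequentially)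
qed

text \<open>Monotone convergence over time strips exhausting the interval from 0 to the time of
  \<open>z\<close>; the increments of \<open>qf\<close> telescope to the difference of its two
  limits.\<close>

theorem nn_integral_heat_ball:
  assumes z: "0 < snd z" and r: "0 < r"
  shows "(\<integral>\<^sup>+\<zeta>. ennreal (kern z \<zeta>) * ennreal (W \<zeta>) * indicator (heat_ball r) \<zeta> \<partial>lborel) = ennreal (r * psi z - kappa (r * psi z))"
proof -
  let ?t = "snd z"
  \<comment> \<open>The offset 3 gives \<open>a k \<le> ?t / 3\<close>, hence
    \<open>a k \<le> b k\<close> already for k = 0.\<close>
  define a where "a k = ?t / real (k + 3)" for k
  define b where "b k = ?t - ?t / real (k + 3)" for k
  have lim: "(\<lambda>k. ?t / real (k + 3)) \<longlonglongrightarrow> 0"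
    by (rule LIMSEQ_ignore_initial_segment[OF lim_const_over_n])
  have ak: "0 < a k" "a k \<le> ?t / 3" for k
  proof -
    show "0 < a k" unfolding a_def using z by simp
    show "a k \<le> ?t / 3" unfolding a_def using z by (intro divide_left_mono) auto
  qed
  have bk: "b k = ?t - a k" for k by (simp add: a_def b_def)
  have a: "0 < a k" "a k < ?t" "a k \<le> b k" "b k < ?t" for k
    using ak[of k] z unfolding bk by auto
  have al: "a \<longlonglongrightarrow> 0" using lim by (simp add: a_def[abs_def])
  have bl: "b \<longlonglongrightarrow> ?t" using tendsto_diff[OF tendsto_const lim, of ?t] by (simp add: b_def[abs_def])
  have dec: "?t / real (l + 3) \<le> ?t / real (k + 3)" if "k \<le> l" for k l
    using z that by (intro divide_left_mono) auto
  define J where "J s = (\<integral>\<^sup>+\<eta>. ennreal (G z \<eta> s * W (\<eta>, s) * indicator (heat_ball r) (\<eta>, s)) \<partial>lborel)" for s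
  define f where "f \<zeta> = ennreal (kern z \<zeta>) * ennreal (W \<zeta>) * indicator (heat_ball r) \<zeta>" for \<zeta>
  have fm [measurable]: "f \<in> borel_measurable borel" unfolding f_def by measurable
  have fJ: "(\<integral>\<^sup>+\<eta>. f (\<eta>, s) \<partial>lborel) = J s" if "s < ?t" for s
    unfolding f_def J_def using that G_nonneg[OF that] W_nonneg
    by (intro nn_integral_cong) (auto simp: kern_def G_def[symmetric] ennreal_mult indicator_def)
  have f0: "(\<integral>\<^sup>+\<eta>. f (\<eta>, s) \<partial>lborel) = 0" if "s \<le> 0 \<or> ?t \<le> s" for s
  proof -
    have "f (\<eta>, s) = 0" for \<eta> using that by (auto simp: f_def kern_def W_def)
    then show ?thesis by simp
  qed
  have strip: "(\<integral>\<^sup>+s. (\<integral>\<^sup>+\<eta>. f (\<eta>, s) \<partial>lborel) * indicator {a k..b k} s \<partial>lborel) = ennreal (qf z r (a k) - qf z r (b k))" for k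
  proof -
    have "(\<integral>\<^sup>+s. (\<integral>\<^sup>+\<eta>. f (\<eta>, s) \<partial>lborel) * indicator {a k..b k} s \<partial>lborel) = (\<integral>\<^sup>+s. J s * indicator {a k..b k} s \<partial>lborel)"
      using fJ a(4)[of k] by (intro nn_integral_cong) (auto simp: indicator_def)
    also have "\<dots> = ennreal (qf z r (a k) - qf z r (b k))"
      unfolding J_def by (rule nn_integral_heat_ball_strip[OF a(1,3,4) r])
    finally show ?thesis .
  qed
  have U: "(\<Union>k. {a k..b k}) = {0<..<?t}"
  proof (intro equalityI subsetI)
    fix s assume s: "s \<in> {0<..<?t}"
    have "\<forall>\<^sub>F k in sequentially. a k < s" "\<forall>\<^sub>F k in sequentially. s < b k"
      using s by (intro order_tendstoD[OF al] order_tendstoD[OF bl]; simp)+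
    then have "\<forall>\<^sub>F k in sequentially. s \<in> {a k..b k}" by eventually_elim auto
    then obtain k where "s \<in> {a k..b k}" by (metis eventually_sequentially order_refl)
    then show "s \<in> (\<Union>k. {a k..b k})" by blast
  next
    fix s assume "s \<in> (\<Union>k. {a k..b k})"
    then obtain k where "a k \<le> s" "s \<le> b k" by auto
    then show "s \<in> {0<..<?t}" using a(1)[of k] a(4)[of k] by simp
  qed
  have sub: "{a k..b k} \<subseteq> {a (Suc k)..b (Suc k)}" for k
  proof -
    have "a (Suc k) \<le> a k" unfolding a_def by (rule dec) simp
    then show ?thesis unfolding bk by auto
  qed
  have inc: "incseq (\<lambda>k s. (\<integral>\<^sup>+\<eta>. f (\<eta>, s) \<partial>lborel) * indicator {a k..b k} s)"
  proof (intro incseq_SucI le_funI mult_left_mono)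
    show "(indicator {a k..b k} s :: ennreal) \<le> indicator {a (Suc k)..b (Suc k)} s" for k s
      using sub[of k] by (intro indicator_leI) blast
  qed simp
  have "(\<integral>\<^sup>+\<zeta>. f \<zeta> \<partial>lborel) = (\<integral>\<^sup>+s. (\<integral>\<^sup>+\<eta>. f (\<eta>, s) \<partial>lborel) \<partial>lborel)"
    by (rule nn_integral_lborel_pair) measurable
  also have "\<dots> = (\<integral>\<^sup>+s. (SUP k. (\<integral>\<^sup>+\<eta>. f (\<eta>, s) \<partial>lborel) * indicator {a k..b k} s) \<partial>lborel)"
  proof (rule nn_integral_cong)
    fix s
    let ?F = "\<integral>\<^sup>+\<eta>. f (\<eta>, s) \<partial>lborel"
    show "?F = (SUP k. ?F * indicator {a k..b k} s)"
    proof (cases "s \<in> {0<..<?t}")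
      case True
      then obtain k where "s \<in> {a k..b k}" using U by blast
      then have "?F \<le> (SUP k. ?F * indicator {a k..b k} s)" by (intro SUP_upper2[of k]) auto
      moreover have "(SUP k. ?F * indicator {a k..b k} s) \<le> ?F"
        by (intro SUP_least) (simp add: indicator_def)
      ultimately show ?thesis by (rule antisym)
    next
      case False
      then show ?thesis using f0[of s] by auto
    qed
  qed
  also have "\<dots> = (SUP k. \<integral>\<^sup>+s. (\<integral>\<^sup>+\<eta>. f (\<eta>, s) \<partial>lborel) * indicator {a k..b k} s \<partial>lborel)"
    by (rule nn_integral_monotone_convergence_SUP[OF inc]) measurable
  also have "\<dots> = (SUP k. ennreal (qf z r (a k) - qf z r (b k)))"
    unfolding strip ..
  also have "\<dots> = ennreal (r * psi z - kappa (r * psi z))"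
  proof (rule LIMSEQ_unique[OF LIMSEQ_SUP])
    have "incseq (\<lambda>k. \<integral>\<^sup>+s. (\<integral>\<^sup>+\<eta>. f (\<eta>, s) \<partial>lborel) * indicator {a k..b k} s \<partial>lborel)"
      using inc by (auto simp: incseq_def le_fun_def intro!: nn_integral_mono)
    then show "incseq (\<lambda>k. ennreal (qf z r (a k) - qf z r (b k)))" unfolding strip .
    show "(\<lambda>k. ennreal (qf z r (a k) - qf z r (b k))) \<longlonglongrightarrow> ennreal (r * psi z - kappa (r * psi z))"
      by (intro tendsto_ennrealI tendsto_diff qf_tendsto_pole qf_tendsto_source z r a al bl)
  qed
  finally show ?thesis unfolding f_def .
qed

end

section \<open>Rigidity of heat balls\<close>

lemma open_AE_empty:
  fixes A :: "'a::euclidean_space set"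
  assumes "open A" "AE x in lborel. x \<notin> A"
  shows "A = {}"
proof -
  have "A \<in> null_sets lborel"
    using assms by (subst AE_iff_null_sets) auto
  then have "negligible A" by (simp add: negligible_iff_null_sets null_sets_completionI)
  then show ?thesis using open_not_negligible[OF assms(1)] by blast
qed

lemma kappa_pos: "1 < x \<Longrightarrow> 0 < kappa x"
proof -
  assume x: "1 < x"
  have "ln x \<le> x - 1" "ln x \<noteq> x - 1" using x ln_eq_minus_one[of x] by (auto intro: ln_le_minus_one)
  then show ?thesis using x by (simp add: kappa_def ramp_def)
qed

lemma ennreal_add_left_cancel': "a + b = a + c \<Longrightarrow> a < \<infinity> \<Longrightarrow> b = c" for a b c :: ennreal
  by (simp add: ennreal_add_left_cancel less_top[symmetric])

lemma ennreal_add_left_le: "a + b \<le> a + c \<Longrightarrow> a < \<infinity> \<Longrightarrow> b \<le> c" for a b c :: ennreal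
  by (simp add: ennreal_add_left_cancel_le less_top[symmetric])

section \<open>Test functions, time weights and the comparison of densities\<close>

context frame
begin

definition pot :: "((real^'n) \<times> real) set \<Rightarrow> (real^'n) \<times> real \<Rightarrow> ennreal" where
  "pot X z = (\<integral>\<^sup>+\<zeta>. ennreal (kern z \<zeta>) * ennreal (W \<zeta>) * indicator X \<zeta> \<partial>lborel)"

lemma psi_eq_kern: "0 < snd z \<Longrightarrow> psi z = kern z (0, 0)"
  by (simp add: psi_def kern_def C_0)

text \<open>The maximum of \<open>psi\<close> on a time slice is of order t^(- N / 2), so the ball
  ends at a finite time.\<close>

lemma psi_late:
  obtains S where "0 < S" "\<And>z. S \<le> snd z \<Longrightarrow> r * psi z \<le> 1"
proof -
  let ?c = "det (C 1)"
  have c: "0 < ?c" by (intro det_spd_pos C_spd0) simp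
  define L where "L = max 0 r / sqrt (4 * pi) ^ CARD('n)"
  have L: "0 \<le> L" by (simp add: L_def)
  define S where "S = max 1 (L\<^sup>2 / ?c)"
  have S: "1 \<le> S" "L\<^sup>2 \<le> ?c * S" using c by (auto simp: S_def field_simps max_def)
  have "r * psi z \<le> 1" if z: "S \<le> snd z" for z
  proof -
    have s: "1 \<le> snd z" "0 < snd z" using S z by auto
    have "L\<^sup>2 \<le> ?c * snd z" using S(2) z c by (meson mult_left_mono less_imp_le order_trans)
    also have "\<dots> \<le> ?c * snd z ^ N"
      using s N_pos c by (intro mult_left_mono) (auto intro: self_le_power)
    also have "\<dots> = det (C (snd z))" using det_C[OF s(2)] by simp
    finally have "sqrt (L\<^sup>2) \<le> sqrt (det (C (snd z)))" by (rule real_sqrt_le_mono)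
    then have le: "L \<le> sqrt (det (C (snd z)))" using L by simp
    have d: "0 < sqrt (det (C (snd z)))" using det_spd_pos[OF C_spd0[OF s(2)]] by simp
    have e: "exp (- ((matrix_inv (C (snd z)) *v fst z) \<bullet> fst z / 4)) \<le> 1"
      using spd_nonneg[OF spd_matrix_inv[OF C_spd0[OF s(2)]]] by simp
    have "r * psi z \<le> max 0 r * psi z" using psi_nonneg by (intro mult_right_mono) auto
    also have "\<dots> = (L / sqrt (det (C (snd z)))) * exp (- ((matrix_inv (C (snd z)) *v fst z) \<bullet> fst z / 4))"
      using s by (simp add: psi_def gauss_alt L_def)
    also have "\<dots> \<le> 1 * 1" using le d e L by (intro mult_mono) (auto simp: divide_le_eq)
    finally show ?thesis by simp
  qed
  then show ?thesis using S by (intro that[of S]) auto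
qed

text \<open>Duality: if \<open>g\<close> is invariant under the kernel, testing a potential on the
  slice at time \<open>t\<close> against \<open>g\<close> is the same as testing its density before
  time \<open>t\<close>.\<close>

lemma nn_integral_slice:
  assumes f [measurable]: "f \<in> borel_measurable borel" and g [measurable]: "g \<in> borel_measurable borel"
    and t: "t < S"
    and inv: "\<And>\<zeta>. 0 < snd \<zeta> \<Longrightarrow> snd \<zeta> < t \<Longrightarrow> (\<integral>\<^sup>+y. ennreal (kern (y, t) \<zeta>) * g (y, t) \<partial>lborel) = g \<zeta>"
  shows "(\<integral>\<^sup>+y. (\<integral>\<^sup>+\<zeta>. kernS S (y, t) \<zeta> * f \<zeta> \<partial>lborel) * g (y, t) \<partial>lborel) =
    (\<integral>\<^sup>+\<zeta>. f \<zeta> * g \<zeta> * indicator {\<zeta>. 0 < snd \<zeta> \<and> snd \<zeta> < t} \<zeta> \<partial>lborel)"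
proof -
  have "(\<integral>\<^sup>+y. (\<integral>\<^sup>+\<zeta>. kernS S (y, t) \<zeta> * f \<zeta> \<partial>lborel) * g (y, t) \<partial>lborel)
     = (\<integral>\<^sup>+y. \<integral>\<^sup>+\<zeta>. kernS S (y, t) \<zeta> * f \<zeta> * g (y, t) \<partial>lborel \<partial>lborel)"
    by (intro nn_integral_cong nn_integral_multc[symmetric]) measurable
  also have "\<dots> = (\<integral>\<^sup>+\<zeta>. \<integral>\<^sup>+y. kernS S (y, t) \<zeta> * f \<zeta> * g (y, t) \<partial>lborel \<partial>lborel)"
    by (rule lborel_pair.Fubini') measurable
  also have "\<dots> = (\<integral>\<^sup>+\<zeta>. f \<zeta> * g \<zeta> * indicator {\<zeta>. 0 < snd \<zeta> \<and> snd \<zeta> < t} \<zeta> \<partial>lborel)"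
  proof (rule nn_integral_cong)
    fix \<zeta> :: "(real^'n) \<times> real"
    show "(\<integral>\<^sup>+y. kernS S (y, t) \<zeta> * f \<zeta> * g (y, t) \<partial>lborel) = f \<zeta> * g \<zeta> * indicator {\<zeta>. 0 < snd \<zeta> \<and> snd \<zeta> < t} \<zeta>"
    proof (cases "0 < snd \<zeta> \<and> snd \<zeta> < t")
      case True
      have "(\<integral>\<^sup>+y. kernS S (y, t) \<zeta> * f \<zeta> * g (y, t) \<partial>lborel) = (\<integral>\<^sup>+y. f \<zeta> * (ennreal (kern (y, t) \<zeta>) * g (y, t)) \<partial>lborel)"
        using True t by (intro nn_integral_cong) (simp add: kernS_def mult_ac)
      also have "\<dots> = f \<zeta> * g \<zeta>" using inv True by (subst nn_integral_cmult) auto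
      finally show ?thesis using True by simp
    next
      case False
      then have "kernS S (y, t) \<zeta> = 0" for y by (auto simp: kernS_def kern_def)
      then show ?thesis using False by simp
    qed
  qed
  finally show ?thesis .
qed

lemma psi_inverse:
  assumes s: "0 < snd z"
  shows "1 / psi z = sqrt (4 * pi) ^ CARD('n) * sqrt (det (C (snd z))) * exp ((matrix_inv (C (snd z)) *v fst z) \<bullet> fst z / 4)"
  using s by (simp add: psi_def gauss_alt exp_minus field_simps)

text \<open>By \<open>det_C\<close> the polynomial weight is \<open>det (C (snd z))\<close>, which turns the factor \<open>1 / sqrt (det (C (snd z)))\<close>
  of the reverse Gaussian into that of \<open>1 / psi\<close>.\<close>

definition approx_inv :: "real \<Rightarrow> (real^'n) \<times> real \<Rightarrow> real" where
  "approx_inv \<delta> z = sqrt (4 * pi) ^ CARD('n) * det (C 1) * snd z ^ N * revg \<delta> z"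

text \<open>Adding \<delta> I enlarges the covariance, which lowers the inverse form and raises the
  determinant in the denominator; both effects have the same sign.\<close>

lemma approx_inv_le:
  assumes s: "0 < snd z" and d: "0 < \<delta>"
  shows "approx_inv \<delta> z \<le> 1 / psi z"
proof -
  let ?M = "C (snd z)" and ?K = "C (snd z) + \<delta> *\<^sub>R mat 1"
  have M: "spd ?M" and K: "spd ?K" using s d by (auto intro: C_spd0 C_shift_spd)
  have le: "(?M *v x) \<bullet> x \<le> (?K *v x) \<bullet> x" for x
    using d by (simp add: matrix_vector_mult_add_rdistrib inner_add_left scaleR_matrix_vector_assoc[symmetric])
  have q: "(matrix_inv ?K *v fst z) \<bullet> fst z \<le> (matrix_inv ?M *v fst z) \<bullet> fst z" by (rule spd_inv_antimono[OF M K le])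
  have dd: "det ?M \<le> det ?K" by (rule det_spd_mono[OF M K le])
  have dM: "0 < det ?M" by (rule det_spd_pos[OF M])
  have "det ?M / sqrt (det ?K) \<le> det ?M / sqrt (det ?M)" using dd dM by (intro divide_left_mono) auto
  also have "\<dots> = sqrt (det ?M)" using dM by (simp add: real_div_sqrt)
  finally have 1: "det ?M / sqrt (det ?K) \<le> sqrt (det ?M)" .
  have "approx_inv \<delta> z = sqrt (4 * pi) ^ CARD('n) * (det ?M / sqrt (det ?K)) * exp ((matrix_inv ?K *v fst z) \<bullet> fst z / 4)"
    using s det_C[OF s] by (simp add: approx_inv_def revg_def reverse_gauss_def)
  also have "\<dots> \<le> sqrt (4 * pi) ^ CARD('n) * sqrt (det ?M) * exp ((matrix_inv ?M *v fst z) \<bullet> fst z / 4)"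
    using 1 q dM dd by (intro mult_mono) auto
  finally show ?thesis unfolding psi_inverse[OF s] .
qed

lemma approx_inv_tendsto:
  assumes s: "0 < snd z"
  shows "(\<lambda>k. approx_inv (1 / real (Suc k)) z) \<longlonglongrightarrow> 1 / psi z"
proof -
  let ?M = "C (snd z)" and ?K = "\<lambda>\<delta>. C (snd z) + \<delta> *\<^sub>R mat 1"
  have K: "spd (?K \<delta>)" if "0 \<le> \<delta>" for \<delta>
    using s that by (cases "\<delta> = 0") (auto intro: C_spd0 C_shift_spd)
  have cK: "continuous_on {0..} ?K" by (intro continuous_intros)
  have nz: "det (?K \<delta>) \<noteq> 0" if "\<delta> \<in> {0..}" for \<delta> using det_spd_pos[OF K[of \<delta>]] that by simp
  have cv: "continuous_on {0..} (\<lambda>\<delta>. matrix_inv (?K \<delta>) *v fst z)"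
    by (intro continuous_on_matrix_inv_vec cK nz continuous_on_const)
  have c: "continuous_on {0..} (\<lambda>\<delta>. reverse_gauss (?K \<delta>) (fst z))"
    unfolding reverse_gauss_def
    by (intro continuous_on_divide continuous_on_exp continuous_on_inner cv continuous_on_const continuous_on_real_sqrt
        continuous_on_det cK) (use nz in auto)
  have lim: "(\<lambda>k. 1 / real (Suc k)) \<longlonglongrightarrow> 0" by (rule LIMSEQ_Suc[OF lim_1_over_n])
  have "(\<lambda>k. reverse_gauss (?K (1 / real (Suc k))) (fst z)) \<longlonglongrightarrow> reverse_gauss (?K 0) (fst z)"
    by (rule continuous_on_tendsto_compose[OF c lim]) auto
  then have "(\<lambda>k. sqrt (4 * pi) ^ CARD('n) * det (C 1) * snd z ^ N * reverse_gauss (?K (1 / real (Suc k))) (fst z))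
     \<longlonglongrightarrow> sqrt (4 * pi) ^ CARD('n) * det (C 1) * snd z ^ N * reverse_gauss (?K 0) (fst z)"
    by (intro tendsto_intros)
  also have "sqrt (4 * pi) ^ CARD('n) * det (C 1) * snd z ^ N * reverse_gauss (?K 0) (fst z)
     = sqrt (4 * pi) ^ CARD('n) * (det ?M / sqrt (det ?M)) * exp ((matrix_inv ?M *v fst z) \<bullet> fst z / 4)"
    using det_C[OF s] by (simp add: reverse_gauss_def)
  also have "\<dots> = 1 / psi z"
    unfolding psi_inverse[OF s] using det_spd_pos[OF C_spd0[OF s]] by (simp add: real_div_sqrt)
  finally show ?thesis using s by (simp add: approx_inv_def revg_def)
qed

lemma nn_integral_power_weight:
  assumes "0 \<le> s" "s \<le> t"
  shows "ennreal (s ^ N) + (\<integral>\<^sup>+u. ennreal (real N * u ^ (N - 1)) * indicator {s<..t} u \<partial>lborel) = ennreal (t ^ N)"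
proof -
  have "(\<integral>\<^sup>+u. ennreal (real N * u ^ (N - 1)) * indicator {s<..t} u \<partial>lborel) = (\<integral>\<^sup>+u. ennreal (real N * u ^ (N - 1)) * indicator {s..t} u \<partial>lborel)"
  proof (rule nn_integral_cong_AE)
    show "AE u in lborel. ennreal (real N * u ^ (N - 1)) * indicator {s<..t} u = ennreal (real N * u ^ (N - 1)) * indicator {s..t} u"
      using AE_lborel_singleton[of s] by eventually_elim (auto simp: indicator_def)
  qed
  also have "\<dots> = ennreal (t ^ N - s ^ N)"
    by (rule nn_integral_FTC_Icc) (use assms in \<open>auto intro!: derivative_eq_intros\<close>)
  finally show ?thesis using assms
    by (simp add: ennreal_plus[symmetric] power_mono del: ennreal_plus)
qed

text \<open>Integration by parts in time against the weight \<open>s ^ N\<close>.\<close>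

lemma nn_integral_weighted:
  fixes h :: "(real^'n) \<times> real \<Rightarrow> ennreal"
  assumes h [measurable]: "h \<in> borel_measurable borel" and t: "0 < t"
    and supp: "\<And>\<zeta>. h \<zeta> \<noteq> 0 \<Longrightarrow> 0 < snd \<zeta> \<and> snd \<zeta> < t"
  shows "(\<integral>\<^sup>+\<zeta>. h \<zeta> * ennreal (snd \<zeta> ^ N) \<partial>lborel)
     + (\<integral>\<^sup>+u. ennreal (real N * u ^ (N - 1)) * indicator {0<..t} u * (\<integral>\<^sup>+\<zeta>. h \<zeta> * indicator {\<zeta>. 0 < snd \<zeta> \<and> snd \<zeta> < u} \<zeta> \<partial>lborel) \<partial>lborel)
     = ennreal (t ^ N) * (\<integral>\<^sup>+\<zeta>. h \<zeta> \<partial>lborel)"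
proof -
  let ?w = "\<lambda>u. ennreal (real N * u ^ (N - 1)) * indicator {0<..t} u"
  have "(\<integral>\<^sup>+u. ?w u * (\<integral>\<^sup>+\<zeta>. h \<zeta> * indicator {\<zeta>. 0 < snd \<zeta> \<and> snd \<zeta> < u} \<zeta> \<partial>lborel) \<partial>lborel)
    = (\<integral>\<^sup>+u. \<integral>\<^sup>+\<zeta>. ?w u * (h \<zeta> * indicator {\<zeta>. 0 < snd \<zeta> \<and> snd \<zeta> < u} \<zeta>) \<partial>lborel \<partial>lborel)"
    by (intro nn_integral_cong nn_integral_cmult[symmetric]) measurable
  also have "\<dots> = (\<integral>\<^sup>+u. \<integral>\<^sup>+\<zeta>. ?w u * (h \<zeta> * (if 0 < snd \<zeta> \<and> snd \<zeta> < u then 1 else 0)) \<partial>lborel \<partial>lborel)"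
    by (simp add: indicator_def of_bool_def)
  also have "\<dots> = (\<integral>\<^sup>+\<zeta>. \<integral>\<^sup>+u. ?w u * (h \<zeta> * (if 0 < snd \<zeta> \<and> snd \<zeta> < u then 1 else 0)) \<partial>lborel \<partial>lborel)"
    by (rule lborel_pair.Fubini') measurable
  also have "\<dots> = (\<integral>\<^sup>+\<zeta>. h \<zeta> * (\<integral>\<^sup>+u. ennreal (real N * u ^ (N - 1)) * indicator {snd \<zeta><..t} u \<partial>lborel) \<partial>lborel)"
  proof (rule nn_integral_cong)
    fix \<zeta> :: "(real^'n) \<times> real"
    have "?w u * (h \<zeta> * (if 0 < snd \<zeta> \<and> snd \<zeta> < u then 1 else 0)) = h \<zeta> * (ennreal (real N * u ^ (N - 1)) * indicator {snd \<zeta><..t} u)" for u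
      using supp[of \<zeta>] by (cases "h \<zeta> = 0") (auto simp: indicator_def mult_ac)
    then show "(\<integral>\<^sup>+u. ?w u * (h \<zeta> * (if 0 < snd \<zeta> \<and> snd \<zeta> < u then 1 else 0)) \<partial>lborel) = h \<zeta> * (\<integral>\<^sup>+u. ennreal (real N * u ^ (N - 1)) * indicator {snd \<zeta><..t} u \<partial>lborel)"
      by (simp add: nn_integral_cmult)
  qed
  finally have eq: "(\<integral>\<^sup>+u. ?w u * (\<integral>\<^sup>+\<zeta>. h \<zeta> * indicator {\<zeta>. 0 < snd \<zeta> \<and> snd \<zeta> < u} \<zeta> \<partial>lborel) \<partial>lborel)
     = (\<integral>\<^sup>+\<zeta>. h \<zeta> * (\<integral>\<^sup>+u. ennreal (real N * u ^ (N - 1)) * indicator {snd \<zeta><..t} u \<partial>lborel) \<partial>lborel)" .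
  define J where "J \<zeta> = (\<integral>\<^sup>+u. ennreal (real N * u ^ (N - 1)) * indicator {snd \<zeta><..t} u \<partial>lborel)" for \<zeta> :: "(real^'n) \<times> real"
  have J: "h \<zeta> * ennreal (snd \<zeta> ^ N) + h \<zeta> * J \<zeta> = ennreal (t ^ N) * h \<zeta>" for \<zeta>
    using supp[of \<zeta>] nn_integral_power_weight[of "snd \<zeta>" t] unfolding J_def
    by (cases "h \<zeta> = 0") (auto simp: distrib_left[symmetric] mult.commute)
  have Jm [measurable]: "J \<in> borel_measurable borel"
  proof -
    have "J = (\<lambda>\<zeta>. \<integral>\<^sup>+u. ennreal (real N * u ^ (N - 1)) * (if snd \<zeta> < u \<and> u \<le> t then 1 else 0) \<partial>lborel)"
      by (auto simp: J_def fun_eq_iff indicator_def of_bool_def)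
    then show ?thesis by simp
  qed
  show ?thesis
    unfolding eq J_def[symmetric]
    by (subst nn_integral_add[symmetric]) (simp_all add: J nn_integral_cmult)
qed

lemma pot_Un:
  assumes [measurable]: "X \<in> sets borel" "Y \<in> sets borel" and "X \<inter> Y = {}"
  shows "pot (X \<union> Y) z = pot X z + pot Y z"
proof -
  have "ennreal (kern z \<zeta>) * ennreal (W \<zeta>) * indicator (X \<union> Y) \<zeta> =
      ennreal (kern z \<zeta>) * ennreal (W \<zeta>) * indicator X \<zeta> + ennreal (kern z \<zeta>) * ennreal (W \<zeta>) * indicator Y \<zeta>" for \<zeta>
    using assms(3) by (auto simp: indicator_def)
  then show ?thesis unfolding pot_def by (simp add: nn_integral_add)
qed

lemma pot_heat_ball: "0 < snd z \<Longrightarrow> 0 < r \<Longrightarrow> pot (heat_ball r) z = ennreal (r * psi z - kappa (r * psi z))"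
  unfolding pot_def by (rule nn_integral_heat_ball)

lemma nn_integral_psi_slice:
  assumes "0 < t" and inv: "(\<integral>\<^sup>+y. ennreal (kern (y, t) (0, 0)) * g (y, t) \<partial>lborel) = g (0, 0)"
    and [measurable]: "g \<in> borel_measurable borel" and r: "0 < r"
  shows "(\<integral>\<^sup>+y. ennreal (r * psi (y, t)) * g (y, t) \<partial>lborel) = ennreal r * g (0, 0)"
proof -
  have "(\<integral>\<^sup>+y. ennreal (r * psi (y, t)) * g (y, t) \<partial>lborel) = (\<integral>\<^sup>+y. ennreal r * (ennreal (kern (y, t) (0, 0)) * g (y, t)) \<partial>lborel)"
    using assms(1) r kern_nonneg by (intro nn_integral_cong) (simp add: psi_eq_kern ennreal_mult mult.assoc)
  also have "\<dots> = ennreal r * g (0, 0)" by (subst nn_integral_cmult) (simp_all add: inv)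
  finally show ?thesis .
qed

theorem heat_ball_rigidity:
  assumes r: "0 < r" and D: "open D" and upper: "\<And>z. z \<in> D \<Longrightarrow> 0 < snd z" and late: "\<And>z. z \<in> D \<Longrightarrow> snd z < T"
    and W_pos: "AE \<zeta> in lborel. 0 < snd \<zeta> \<longrightarrow> 0 < W \<zeta>"
    and hyp: "\<And>z. z \<notin> D \<Longrightarrow> 0 < snd z \<Longrightarrow> pot D z = ennreal (r * psi z)"
  shows "D = heat_ball r"
proof -
  let ?\<Omega> = "heat_ball r"
  have Dm [measurable]: "D \<in> sets borel" using D by simp
  obtain S0 where S0: "0 < S0" "\<And>z. S0 \<le> snd z \<Longrightarrow> r * psi z \<le> 1" using psi_late[of r] by blast
  define S1 where "S1 = max S0 T"
  have S1: "0 < S1" "S0 \<le> S1" "T \<le> S1" using S0 by (auto simp: S1_def)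
  have ball_iff: "z \<in> ?\<Omega> \<longleftrightarrow> 1 < r * psi z" for z using r by (simp add: heat_ball_def field_simps)
  have lateO: "snd z < S1" if "z \<in> ?\<Omega>" for z
    using S0(2)[of z] that S1(2) unfolding ball_iff by linarith
  have lateD: "snd z < S1" if "z \<in> D" for z using late[OF that] S1(3) by linarith
  have upO: "0 < snd z" if "z \<in> ?\<Omega>" for z using heat_ball_upper[OF r that] .
  \<comment> \<open>\<open>kernS S\<close> requires starting times strictly below \<open>S\<close>,
    and the slice at \<open>S1\<close>, beyond both sets, must still be admissible.\<close>
  define S where "S = S1 + 1"
  have S: "0 < S" "S1 < S" using S1 by (auto simp: S_def)
  interpret K: causal_kernel lborel "kernS S" snd S by (rule causal_kernel_kernS[OF S(1)])
  define f where "f X \<zeta> = ennreal (W \<zeta>) * indicator X \<zeta>" for X \<zeta>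
  have fm [measurable]: "f X \<in> borel_measurable borel" if "X \<in> sets borel" for X
    unfolding f_def using that by measurable
  have potS: "(\<integral>\<^sup>+\<zeta>. kernS S z \<zeta> * f X \<zeta> \<partial>lborel) = pot X z" if "snd z < S" for X z
    unfolding pot_def f_def using that
    by (intro nn_integral_cong) (auto simp: kernS_def W_def mult.assoc)
  have splitD: "pot D z = pot (D \<inter> ?\<Omega>) z + pot (D - ?\<Omega>) z" for z
    by (subst pot_Un[symmetric]) (auto intro!: arg_cong[of _ _ "\<lambda>X. pot X z"])
  have splitO: "pot ?\<Omega> z = pot (D \<inter> ?\<Omega>) z + pot (?\<Omega> - D) z" for z
    by (subst pot_Un[symmetric]) (auto intro!: arg_cong[of _ _ "\<lambda>X. pot X z"])
  \<comment> \<open>Finiteness permits cancelling the potential of the common part of both sets in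
    extended reals.\<close>
  have fin: "pot (D \<inter> ?\<Omega>) z < \<infinity>" if "0 < snd z" for z
  proof -
    have "pot (D \<inter> ?\<Omega>) z \<le> pot ?\<Omega> z" unfolding splitO[of z] by simp
    also have "\<dots> < \<infinity>" unfolding pot_heat_ball[OF that r] by simp
    finally show ?thesis .
  qed
  let ?f1 = "f (?\<Omega> - D)" and ?f2 = "f (D - ?\<Omega>)"
  have dom: "K.potential ?f1 z \<le> K.potential ?f2 z" for z
  proof (rule K.domination)
    fix z assume "0 < ?f1 z"
    then have "z \<in> ?\<Omega> - D" by (cases "z \<in> ?\<Omega> - D") (auto simp: f_def)
    then have z: "z \<in> ?\<Omega>" "z \<notin> D" by auto
    have sz: "0 < snd z" "snd z < S" using upO[OF z(1)] lateO[OF z(1)] S by auto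
    have "pot ?\<Omega> z \<le> pot D z"
      unfolding pot_heat_ball[OF sz(1) r] hyp[OF z(2) sz(1)] using kappa_nonneg by (intro ennreal_leI) simp
    then have "pot (?\<Omega> - D) z \<le> pot (D - ?\<Omega>) z"
      unfolding splitD splitO by (rule ennreal_add_left_le) (rule fin[OF sz(1)])
    then show "K.potential ?f1 z \<le> K.potential ?f2 z" by (simp add: K.potential_def potS sz)
  qed (auto simp: f_def indicator_def)
  have eq_late: "pot (?\<Omega> - D) (y, S1) = pot (D - ?\<Omega>) (y, S1)" "pot (?\<Omega> - D) (y, S1) \<le> ennreal (r * psi (y, S1))" for y
  proof -
    have up: "0 < snd (y, S1)" and notD: "(y, S1) \<notin> D" using S1 lateD[of "(y, S1)"] by auto
    have O: "pot ?\<Omega> (y, S1) = ennreal (r * psi (y, S1))"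
      using pot_heat_ball[OF up r] kappa_eq_0[OF S0(2)[of "(y, S1)"]] S1 by simp
    have "pot ?\<Omega> (y, S1) = pot D (y, S1)" using O hyp[OF notD up] by simp
    then show "pot (?\<Omega> - D) (y, S1) = pot (D - ?\<Omega>) (y, S1)"
      unfolding splitD splitO by (rule ennreal_add_left_cancel') (rule fin[OF up])
    show "pot (?\<Omega> - D) (y, S1) \<le> ennreal (r * psi (y, S1))" unfolding O[symmetric] splitO by simp
  qed
  have supp: "?f1 \<zeta> \<noteq> 0 \<Longrightarrow> 0 < snd \<zeta> \<and> snd \<zeta> < S1" "?f2 \<zeta> \<noteq> 0 \<Longrightarrow> 0 < snd \<zeta> \<and> snd \<zeta> < S1" for \<zeta>
    using upO[of \<zeta>] lateO[of \<zeta>] upper[of \<zeta>] lateD[of \<zeta>] by (auto simp: f_def indicator_def split: if_splits)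
  have drop: "(\<integral>\<^sup>+\<zeta>. h \<zeta> * g \<zeta> * indicator {\<zeta>. 0 < snd \<zeta> \<and> snd \<zeta> < S1} \<zeta> \<partial>lborel) = (\<integral>\<^sup>+\<zeta>. h \<zeta> * g \<zeta> \<partial>lborel)"
    if "h = ?f1 \<or> h = ?f2" for h g :: "(real^'n) \<times> real \<Rightarrow> ennreal"
  proof (rule nn_integral_cong)
    fix \<zeta>
    have "0 < snd \<zeta> \<and> snd \<zeta> < S1" if "h \<zeta> \<noteq> 0" using \<open>h = ?f1 \<or> h = ?f2\<close> supp[of \<zeta>] that by auto
    then show "h \<zeta> * g \<zeta> * indicator {\<zeta>. 0 < snd \<zeta> \<and> snd \<zeta> < S1} \<zeta> = h \<zeta> * g \<zeta>"
      by (cases "h \<zeta> = 0") auto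
  qed
  \<comment> \<open>At time \<open>S1\<close> both potentials agree, and that of \<open>f1\<close>
    is at most r psi. Its pairing with \<open>g\<close> is then at most \<open>r * g (0, 0)\<close>,
    which is why \<open>g\<close> must be finite and invariant at the pole.\<close>
  have moment: "(\<integral>\<^sup>+\<zeta>. ?f1 \<zeta> * g \<zeta> \<partial>lborel) = (\<integral>\<^sup>+\<zeta>. ?f2 \<zeta> * g \<zeta> \<partial>lborel) \<and> (\<integral>\<^sup>+\<zeta>. ?f1 \<zeta> * g \<zeta> \<partial>lborel) < \<infinity>"
    if g [measurable]: "g \<in> borel_measurable borel" and g0: "g (0, 0) < \<infinity>"
      and inv: "\<And>\<zeta>. 0 \<le> snd \<zeta> \<Longrightarrow> snd \<zeta> < S1 \<Longrightarrow> (\<integral>\<^sup>+y. ennreal (kern (y, S1) \<zeta>) * g (y, S1) \<partial>lborel) = g \<zeta>" for g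
  proof -
    have 1: "(\<integral>\<^sup>+\<zeta>. ?f1 \<zeta> * g \<zeta> \<partial>lborel) = (\<integral>\<^sup>+y. pot (?\<Omega> - D) (y, S1) * g (y, S1) \<partial>lborel)"
      using nn_integral_slice[of ?f1 g S1 S] inv S drop[of ?f1 g] by (simp add: potS)
    have 2: "(\<integral>\<^sup>+\<zeta>. ?f2 \<zeta> * g \<zeta> \<partial>lborel) = (\<integral>\<^sup>+y. pot (D - ?\<Omega>) (y, S1) * g (y, S1) \<partial>lborel)"
      using nn_integral_slice[of ?f2 g S1 S] inv S drop[of ?f2 g] by (simp add: potS)
    have "(\<integral>\<^sup>+\<zeta>. ?f1 \<zeta> * g \<zeta> \<partial>lborel) \<le> (\<integral>\<^sup>+y. ennreal (r * psi (y, S1)) * g (y, S1) \<partial>lborel)"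
      unfolding 1 by (intro nn_integral_mono mult_right_mono eq_late) simp
    also have "\<dots> = ennreal r * g (0, 0)"
      using inv[of "(0, 0)"] S1 r by (intro nn_integral_psi_slice) auto
    also have "\<dots> < \<infinity>" using g0 by (simp add: ennreal_mult_less_top)
    finally show ?thesis unfolding 1 2 eq_late(1) by simp
  qed
  have mass: "(\<integral>\<^sup>+\<zeta>. ?f1 \<zeta> \<partial>lborel) = (\<integral>\<^sup>+\<zeta>. ?f2 \<zeta> \<partial>lborel)" "(\<integral>\<^sup>+\<zeta>. ?f1 \<zeta> \<partial>lborel) < \<infinity>"
    using moment[of "\<lambda>_. 1"] nn_integral_kern_target by auto
  have weighted: "(\<integral>\<^sup>+\<zeta>. ?f2 \<zeta> * ennreal (approx_inv \<delta> \<zeta>) \<partial>lborel) \<le> (\<integral>\<^sup>+\<zeta>. ?f1 \<zeta> * ennreal (approx_inv \<delta> \<zeta>) \<partial>lborel)"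
    if d: "0 < \<delta>" for \<delta>
  proof -
    note [measurable] = revg_measurable[OF d]
    let ?g = "\<lambda>\<zeta>. ennreal (revg \<delta> \<zeta>)"
    let ?B = "\<lambda>f. \<integral>\<^sup>+u. ennreal (real N * u ^ (N - 1)) * indicator {0<..S1} u *
        (\<integral>\<^sup>+\<zeta>. f \<zeta> * ?g \<zeta> * indicator {\<zeta>. 0 < snd \<zeta> \<and> snd \<zeta> < u} \<zeta> \<partial>lborel) \<partial>lborel"
    let ?A = "\<lambda>f. \<integral>\<^sup>+\<zeta>. f \<zeta> * ?g \<zeta> * ennreal (snd \<zeta> ^ N) \<partial>lborel"
    have m: "(\<integral>\<^sup>+\<zeta>. ?f1 \<zeta> * ?g \<zeta> \<partial>lborel) = (\<integral>\<^sup>+\<zeta>. ?f2 \<zeta> * ?g \<zeta> \<partial>lborel) \<and> (\<integral>\<^sup>+\<zeta>. ?f1 \<zeta> * ?g \<zeta> \<partial>lborel) < \<infinity>"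
      by (rule moment) (simp_all add: nn_integral_kern_revg[OF d])
    then have m2: "(\<integral>\<^sup>+\<zeta>. ?f2 \<zeta> * ?g \<zeta> \<partial>lborel) < \<infinity>" by (elim conjE) (simp only:)
    have AB1: "?A ?f1 + ?B ?f1 = ennreal (S1 ^ N) * (\<integral>\<^sup>+\<zeta>. ?f1 \<zeta> * ?g \<zeta> \<partial>lborel)"
      by (rule nn_integral_weighted) (use S1 supp(1) in auto)
    have AB2: "?A ?f2 + ?B ?f2 = ennreal (S1 ^ N) * (\<integral>\<^sup>+\<zeta>. ?f2 \<zeta> * ?g \<zeta> \<partial>lborel)"
      by (rule nn_integral_weighted) (use S1 supp(2) in auto)
    \<comment> \<open>Domination, applied on every slice up to \<open>S1\<close>, orders the masses
      emitted before each time. Since the sums of \<open>?A\<close> and \<open>?B\<close> agree for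
      both densities and \<open>?B ?f2\<close> is finite, the order of \<open>?A\<close> is the
      reverse.\<close>
    have B12: "?B ?f1 \<le> ?B ?f2"
    proof (rule nn_integral_mono)
      fix u :: real
      have "(\<integral>\<^sup>+\<zeta>. ?f1 \<zeta> * ?g \<zeta> * indicator {\<zeta>. 0 < snd \<zeta> \<and> snd \<zeta> < u} \<zeta> \<partial>lborel)
          \<le> (\<integral>\<^sup>+\<zeta>. ?f2 \<zeta> * ?g \<zeta> * indicator {\<zeta>. 0 < snd \<zeta> \<and> snd \<zeta> < u} \<zeta> \<partial>lborel)" if u: "0 < u" "u \<le> S1"
      proof -
        have uS: "u < S" using u S by simp
        have inv: "(\<integral>\<^sup>+y. ennreal (kern (y, u) \<zeta>) * ?g (y, u) \<partial>lborel) = ?g \<zeta>" if "0 < snd \<zeta>" "snd \<zeta> < u" for \<zeta>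
          using nn_integral_kern_revg[OF d, of \<zeta> u] that by simp
        have s1: "(\<integral>\<^sup>+\<zeta>. ?f1 \<zeta> * ?g \<zeta> * indicator {\<zeta>. 0 < snd \<zeta> \<and> snd \<zeta> < u} \<zeta> \<partial>lborel) = (\<integral>\<^sup>+y. K.potential ?f1 (y, u) * ?g (y, u) \<partial>lborel)"
          unfolding K.potential_def by (rule nn_integral_slice[OF _ _ uS inv, symmetric]) measurable
        have s2: "(\<integral>\<^sup>+\<zeta>. ?f2 \<zeta> * ?g \<zeta> * indicator {\<zeta>. 0 < snd \<zeta> \<and> snd \<zeta> < u} \<zeta> \<partial>lborel) = (\<integral>\<^sup>+y. K.potential ?f2 (y, u) * ?g (y, u) \<partial>lborel)"
          unfolding K.potential_def by (rule nn_integral_slice[OF _ _ uS inv, symmetric]) measurable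
        show ?thesis unfolding s1 s2 by (intro nn_integral_mono mult_right_mono dom) simp
      qed
      then show "ennreal (real N * u ^ (N - 1)) * indicator {0<..S1} u * (\<integral>\<^sup>+\<zeta>. ?f1 \<zeta> * ?g \<zeta> * indicator {\<zeta>. 0 < snd \<zeta> \<and> snd \<zeta> < u} \<zeta> \<partial>lborel)
         \<le> ennreal (real N * u ^ (N - 1)) * indicator {0<..S1} u * (\<integral>\<^sup>+\<zeta>. ?f2 \<zeta> * ?g \<zeta> * indicator {\<zeta>. 0 < snd \<zeta> \<and> snd \<zeta> < u} \<zeta> \<partial>lborel)"
        by (cases "u \<in> {0<..S1}") (auto intro!: mult_left_mono)
    qed
    have "?B ?f2 \<le> ?A ?f2 + ?B ?f2" by simp
    also have "\<dots> < \<infinity>" unfolding AB2 using m2 by (simp add: ennreal_mult_less_top)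
    finally have B2: "?B ?f2 < \<infinity>" .
    have "?B ?f2 + ?A ?f2 = ?A ?f1 + ?B ?f1" using AB1 AB2 m by (simp add: add.commute)
    also have "\<dots> \<le> ?B ?f2 + ?A ?f1" using B12 by (simp add: add.commute add_left_mono)
    finally have A: "?A ?f2 \<le> ?A ?f1" using B2 by (rule ennreal_add_left_le)
    let ?c = "ennreal (sqrt (4 * pi) ^ CARD('n) * det (C 1))"
    have c0: "0 \<le> sqrt (4 * pi) ^ CARD('n) * det (C 1)"
      using det_spd_pos[OF C_spd0[of 1]] by simp
    have conv: "(\<integral>\<^sup>+\<zeta>. h \<zeta> * ennreal (approx_inv \<delta> \<zeta>) \<partial>lborel) = ?c * ?A h"
      if [measurable]: "h \<in> borel_measurable borel" and "\<And>\<zeta>. h \<zeta> \<noteq> 0 \<Longrightarrow> 0 < snd \<zeta> \<and> snd \<zeta> < S1" for h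
    proof -
      have "h \<zeta> * ennreal (approx_inv \<delta> \<zeta>) = ?c * (h \<zeta> * ?g \<zeta> * ennreal (snd \<zeta> ^ N))" for \<zeta>
      proof (cases "h \<zeta> = 0")
        case False
        then have "0 < snd \<zeta>" using that(2) by blast
        then have "ennreal (approx_inv \<delta> \<zeta>) = ?c * (?g \<zeta> * ennreal (snd \<zeta> ^ N))"
          using c0 revg_nonneg[OF d, of \<zeta>] by (simp add: approx_inv_def ennreal_mult[symmetric] mult_ac)
        then show ?thesis by (simp add: mult_ac)
      qed simp
      then show ?thesis by (simp add: nn_integral_cmult)
    qed
    show ?thesis
      using A by (simp add: conv supp mult_left_mono)
  qed
  have approx_le: "(\<integral>\<^sup>+\<zeta>. ?f1 \<zeta> * ennreal (approx_inv \<delta> \<zeta>) \<partial>lborel) \<le> (\<integral>\<^sup>+\<zeta>. ?f1 \<zeta> * ennreal (1 / psi \<zeta>) \<partial>lborel)" if "0 < \<delta>" for \<delta>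
  proof (rule nn_integral_mono)
    fix \<zeta>
    show "?f1 \<zeta> * ennreal (approx_inv \<delta> \<zeta>) \<le> ?f1 \<zeta> * ennreal (1 / psi \<zeta>)"
      using supp(1)[of \<zeta>] approx_inv_le[of \<zeta> \<delta>] that
      by (cases "?f1 \<zeta> = 0") (auto intro!: mult_left_mono ennreal_leI)
  qed
  have revg_m [measurable]: "(\<lambda>\<zeta>. ennreal (approx_inv (1 / real (Suc k)) \<zeta>)) \<in> borel_measurable borel" for k
  proof -
    have [measurable]: "revg (1 / real (Suc k)) \<in> borel_measurable borel" by (rule revg_measurable) simp
    show ?thesis unfolding approx_inv_def by measurable
  qed
  have "(\<integral>\<^sup>+\<zeta>. ?f2 \<zeta> * ennreal (1 / psi \<zeta>) \<partial>lborel) = (\<integral>\<^sup>+\<zeta>. liminf (\<lambda>k. ?f2 \<zeta> * ennreal (approx_inv (1 / real (Suc k)) \<zeta>)) \<partial>lborel)"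
  proof (rule nn_integral_cong)
    fix \<zeta>
    show "?f2 \<zeta> * ennreal (1 / psi \<zeta>) = liminf (\<lambda>k. ?f2 \<zeta> * ennreal (approx_inv (1 / real (Suc k)) \<zeta>))"
    proof (cases "?f2 \<zeta> = 0")
      case False
      then have "0 < snd \<zeta>" using supp(2) by blast
      then have "(\<lambda>k. ?f2 \<zeta> * ennreal (approx_inv (1 / real (Suc k)) \<zeta>)) \<longlonglongrightarrow> ?f2 \<zeta> * ennreal (1 / psi \<zeta>)"
        by (intro ennreal_tendsto_cmult tendsto_ennrealI approx_inv_tendsto) (auto simp: f_def indicator_def)
      then show ?thesis by (simp add: lim_imp_Liminf)
    qed (simp add: Liminf_const)
  qed
  \<comment> \<open>Fatou's lemma passes to the limit for \<open>f2\<close>; for \<open>f1\<close>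
    the pointwise bound by 1 / psi suffices.\<close>
  also have "\<dots> \<le> liminf (\<lambda>k. \<integral>\<^sup>+\<zeta>. ?f2 \<zeta> * ennreal (approx_inv (1 / real (Suc k)) \<zeta>) \<partial>lborel)"
    by (rule nn_integral_liminf) measurable
  also have "\<dots> \<le> liminf (\<lambda>k::nat. \<integral>\<^sup>+\<zeta>. ?f1 \<zeta> * ennreal (1 / psi \<zeta>) \<partial>lborel)"
    by (intro Liminf_mono always_eventually allI order_trans[OF weighted approx_le]) auto
  also have "\<dots> = (\<integral>\<^sup>+\<zeta>. ?f1 \<zeta> * ennreal (1 / psi \<zeta>) \<partial>lborel)" by (simp add: Liminf_const)
  finally have I21: "(\<integral>\<^sup>+\<zeta>. ?f2 \<zeta> * ennreal (1 / psi \<zeta>) \<partial>lborel) \<le> (\<integral>\<^sup>+\<zeta>. ?f1 \<zeta> * ennreal (1 / psi \<zeta>) \<partial>lborel)" .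
  \<comment> \<open>Because the masses are equal and finite, r times the mass can be subtracted on
    both sides. The inequality between the integrals against 1 / psi then says that the sum of these
    two nonnegative integrals is at most 0.\<close>
  let ?J1 = "\<integral>\<^sup>+\<zeta>. ?f1 \<zeta> * ennreal (r - 1 / psi \<zeta>) \<partial>lborel" and ?J2 = "\<integral>\<^sup>+\<zeta>. ?f2 \<zeta> * ennreal (1 / psi \<zeta> - r) \<partial>lborel"
  let ?m = "\<integral>\<^sup>+\<zeta>. ?f1 \<zeta> \<partial>lborel"
  have p1: "0 \<le> 1 / psi \<zeta>" for \<zeta> using psi_nonneg by simp
  have "(\<integral>\<^sup>+\<zeta>. ?f1 \<zeta> * ennreal (1 / psi \<zeta>) \<partial>lborel) + ?J1 = (\<integral>\<^sup>+\<zeta>. ennreal r * ?f1 \<zeta> \<partial>lborel)"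
  proof (subst nn_integral_add[symmetric], simp, simp, rule nn_integral_cong)
    fix \<zeta>
    show "?f1 \<zeta> * ennreal (1 / psi \<zeta>) + ?f1 \<zeta> * ennreal (r - 1 / psi \<zeta>) = ennreal r * ?f1 \<zeta>"
    proof (cases "\<zeta> \<in> ?\<Omega> - D")
      case True
      then have "1 < r * psi \<zeta>" using ball_iff by blast
      then have "1 / psi \<zeta> \<le> r" using psi_nonneg[of \<zeta>] by (cases "psi \<zeta> = 0") (auto simp: field_simps)
      then have "ennreal (1 / psi \<zeta>) + ennreal (r - 1 / psi \<zeta>) = ennreal r"
        using p1[of \<zeta>] by (subst ennreal_plus[symmetric]) auto
      then show ?thesis by (metis distrib_left mult.commute)
    qed (simp add: f_def)
  qed
  then have e1: "(\<integral>\<^sup>+\<zeta>. ?f1 \<zeta> * ennreal (1 / psi \<zeta>) \<partial>lborel) + ?J1 = ennreal r * ?m" by (simp add: nn_integral_cmult)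
  have "(\<integral>\<^sup>+\<zeta>. ?f2 \<zeta> * ennreal (1 / psi \<zeta>) \<partial>lborel) = (\<integral>\<^sup>+\<zeta>. ennreal r * ?f2 \<zeta> + ?f2 \<zeta> * ennreal (1 / psi \<zeta> - r) \<partial>lborel)"
  proof (rule nn_integral_cong)
    fix \<zeta>
    show "?f2 \<zeta> * ennreal (1 / psi \<zeta>) = ennreal r * ?f2 \<zeta> + ?f2 \<zeta> * ennreal (1 / psi \<zeta> - r)"
    proof (cases "\<zeta> \<in> D - ?\<Omega>")
      case True
      then have "r * psi \<zeta> \<le> 1" "0 < psi \<zeta>" using ball_iff[of \<zeta>] upper[of \<zeta>] psi_pos by auto
      then have "r \<le> 1 / psi \<zeta>" by (simp add: field_simps)
      then have "ennreal r + ennreal (1 / psi \<zeta> - r) = ennreal (1 / psi \<zeta>)"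
        using r by (subst ennreal_plus[symmetric]) auto
      then show ?thesis by (metis distrib_left mult.commute)
    qed (simp add: f_def)
  qed
  also have "\<dots> = ennreal r * ?m + ?J2" unfolding mass(1) by (subst nn_integral_add) (simp_all add: nn_integral_cmult)
  finally have e2: "(\<integral>\<^sup>+\<zeta>. ?f2 \<zeta> * ennreal (1 / psi \<zeta>) \<partial>lborel) = ennreal r * ?m + ?J2" .
  have "ennreal r * ?m + (?J2 + ?J1) \<le> ennreal r * ?m + 0"
    using add_right_mono[OF I21, of ?J1] unfolding e1 e2 by (simp add: add.assoc)
  then have "?J2 + ?J1 \<le> 0"
    by (rule ennreal_add_left_le) (use mass(2) in \<open>simp add: ennreal_mult_less_top\<close>)
  then have J: "?J1 = 0" "?J2 = 0" by auto
  have "AE \<zeta> in lborel. ?f1 \<zeta> * ennreal (r - 1 / psi \<zeta>) = 0"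
    using J(1) by (subst (asm) nn_integral_0_iff_AE) auto
  with W_pos have aeO: "AE \<zeta> in lborel. \<zeta> \<notin> ?\<Omega> - D"
  proof eventually_elim
    case (elim \<zeta>)
    show ?case
    proof
      assume h: "\<zeta> \<in> ?\<Omega> - D"
      then have x: "1 < r * psi \<zeta>" "0 < snd \<zeta>" using ball_iff[of \<zeta>] upO[of \<zeta>] by auto
      then have "1 / psi \<zeta> < r" using psi_pos[of \<zeta>] by (simp add: field_simps)
      then show False using elim h x(2) by (auto simp: f_def ennreal_eq_0_iff)
    qed
  qed
  have "AE \<zeta> in lborel. ?f2 \<zeta> * ennreal (1 / psi \<zeta> - r) = 0"
    using J(2) by (subst (asm) nn_integral_0_iff_AE) auto
  with W_pos have "AE \<zeta> in lborel. \<zeta> \<notin> D \<inter> {\<zeta>. r * psi \<zeta> < 1}"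
  proof eventually_elim
    case (elim \<zeta>)
    show ?case
    proof
      assume h: "\<zeta> \<in> D \<inter> {\<zeta>. r * psi \<zeta> < 1}"
      then have x: "r * psi \<zeta> < 1" "0 < snd \<zeta>" using upper[of \<zeta>] by auto
      then have "r < 1 / psi \<zeta>" using psi_pos[of \<zeta>] by (simp add: field_simps)
      then show False using elim h x ball_iff[of \<zeta>] by (auto simp: f_def ennreal_eq_0_iff)
    qed
  qed
  moreover have "open (D \<inter> {\<zeta>. r * psi \<zeta> < 1})"
  proof -
    have c: "continuous_on D (\<lambda>\<zeta>. r * psi \<zeta>)"
      by (intro continuous_on_mult continuous_on_const continuous_on_subset[OF continuous_on_psi]) (use upper in auto)
    have "open (D \<inter> (\<lambda>\<zeta>. r * psi \<zeta>) -` {..<1})"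
      using c D by (intro continuous_open_preimage) auto
    then show ?thesis by (simp add: vimage_def)
  qed
  ultimately have E: "D \<inter> {\<zeta>. r * psi \<zeta> < 1} = {}" by (intro open_AE_empty)
  have ge: "1 \<le> r * psi \<zeta>" if "\<zeta> \<in> D" for \<zeta>
  proof (rule ccontr)
    assume "\<not> 1 \<le> r * psi \<zeta>"
    then have "\<zeta> \<in> D \<inter> {\<zeta>. r * psi \<zeta> < 1}" using that by simp
    then show False unfolding E by simp
  qed
  have sub: "D \<subseteq> ?\<Omega>"
  proof
    fix z assume z: "z \<in> D"
    obtain y s where ys: "z = (y, s)" by (cases z)
    have s: "0 < s" using upper[OF z] ys by simp
    let ?K = "matrix_inv (C s)"
    have K: "spd ?K" using s by (intro spd_matrix_inv C_spd0)
    \<comment> \<open>Along the ray through \<open>y\<close> the quadratic form strictly increases;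
      at the centre \<open>y = 0\<close> any nonzero direction serves. An open \<open>D\<close>
      contains a point further out, where r psi is smaller but still at least 1.\<close>
    define e where "e = (if y = 0 then axis undefined 1 else y)"
    have e0: "e \<noteq> 0" by (simp add: e_def axis_eq_0_iff)
    have ye: "0 \<le> (?K *v y) \<bullet> e" using spd_nonneg[OF K, of y] by (simp add: e_def)
    have "((\<lambda>t::real. (y + t *\<^sub>R e, s)) \<longlongrightarrow> (y + 0 *\<^sub>R e, s)) (at_right 0)"
      by (intro tendsto_intros)
    then have "\<forall>\<^sub>F t in at_right (0::real). (y + t *\<^sub>R e, s) \<in> D"
      using D z ys by (intro topological_tendstoD[of _ _ _ D]) auto
    moreover have "\<forall>\<^sub>F t in at_right (0::real). 0 < t" by (simp add: eventually_at_right_less)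
    ultimately have "\<forall>\<^sub>F t in at_right (0::real). (y + t *\<^sub>R e, s) \<in> D \<and> 0 < t" by eventually_elim auto
    then obtain t where t: "(y + t *\<^sub>R e, s) \<in> D" "0 < t"
      using eventually_happens'[OF trivial_limit_at_right_real] by blast
    have "(?K *v (y + t *\<^sub>R e)) \<bullet> (y + t *\<^sub>R e) = (?K *v y) \<bullet> y + 2 * t * ((?K *v y) \<bullet> e) + t * t * ((?K *v e) \<bullet> e)"
      using spd_inner[OF K, of e y]
      by (simp add: matrix_vector_right_distrib matrix_vector_mult_scaleR inner_add_left inner_add_right algebra_simps)
    moreover have "0 < t * t * ((?K *v e) \<bullet> e)" using K e0 t(2) by (simp add: spd_def)
    moreover have "0 \<le> 2 * t * ((?K *v y) \<bullet> e)" using ye t(2) by simp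
    ultimately have "(?K *v y) \<bullet> y < (?K *v (y + t *\<^sub>R e)) \<bullet> (y + t *\<^sub>R e)" by linarith
    then have "psi (y + t *\<^sub>R e, s) < psi (y, s)"
      using s det_spd_pos[OF C_spd0[OF s]] by (simp add: psi_def gauss_alt divide_strict_right_mono)
    then have "r * psi (y + t *\<^sub>R e, s) < r * psi z" using r ys by simp
    then show "z \<in> ?\<Omega>" using ge[OF t(1)] ball_iff by simp
  qed
  have "?\<Omega> \<subseteq> D"
  proof (rule ccontr)
    assume "\<not> ?\<Omega> \<subseteq> D"
    then obtain z where z: "z \<in> ?\<Omega>" "z \<notin> D" by blast
    have up: "0 < snd z" by (rule upO[OF z(1)])
    have "pot ?\<Omega> z = pot D z"
      unfolding pot_def
    proof (rule nn_integral_cong_AE)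
      show "AE \<zeta> in lborel. ennreal (kern z \<zeta>) * ennreal (W \<zeta>) * indicator ?\<Omega> \<zeta> = ennreal (kern z \<zeta>) * ennreal (W \<zeta>) * indicator D \<zeta>"
        using aeO by eventually_elim (use sub in \<open>auto simp: indicator_def\<close>)
    qed
    then have "ennreal (r * psi z - kappa (r * psi z)) = ennreal (r * psi z)"
      using pot_heat_ball[OF up r] hyp[OF z(2) up] by simp
    moreover have "1 < r * psi z" using z(1) ball_iff by blast
    ultimately show False
      using kappa_pos[of "r * psi z"] kappa_le[of "r * psi z"] by (simp add: ennreal_inj)
  qed
  with sub show ?thesis by blast
qed

end

section \<open>The matrices of a Kolmogorov structure\<close>

lemma bounded_linear_congruence: "bounded_linear (\<lambda>X. A ** X ** B)" for A :: "real^'n^'m" and B :: "real^'k^'n"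
proof -
  have "linear (\<lambda>X. A ** X ** B)"
    by (intro linearI) (simp_all add: vec_eq_iff matrix_matrix_mult_def sum_distrib_left sum_distrib_right
        distrib_left distrib_right sum.distrib mult_ac)
  then show ?thesis by (simp add: linear_conv_bounded_linear)
qed

lemma continuous_on_matrix_mult:
  fixes A :: "'a::topological_space \<Rightarrow> real^'n^'m" and B :: "'a \<Rightarrow> real^'k^'n"
  assumes "continuous_on X A" "continuous_on X B"
  shows "continuous_on X (\<lambda>x. A x ** B x)"
  unfolding matrix_matrix_mult_def using assms by (intro continuous_intros)

lemma continuous_on_transpose:
  fixes A :: "'a::topological_space \<Rightarrow> real^'n^'m"
  assumes "continuous_on X A"
  shows "continuous_on X (\<lambda>x. transpose (A x))"
  unfolding transpose_def using assms by (intro continuous_intros)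

lemma sum_matrix_mult_left: "(\<Sum>i\<in>I. A i) ** B = (\<Sum>i\<in>I. A i ** B)" for A :: "'i \<Rightarrow> real^'n^'m"
proof -
  have "0 ** B = 0" by (simp add: vec_eq_iff matrix_matrix_mult_def)
  then show ?thesis by (induction I rule: infinite_finite_induct) (simp_all add: matrix_add_rdistrib)
qed

lemma sum_matrix_mult_right: "B ** (\<Sum>i\<in>I. A i) = (\<Sum>i\<in>I. B ** A i)" for A :: "'i \<Rightarrow> real^'n^'m"
proof -
  have "B ** 0 = 0" by (simp add: vec_eq_iff matrix_matrix_mult_def)
  then show ?thesis by (induction I rule: infinite_finite_induct) (simp_all add: matrix_add_ldistrib)
qed

lemma scaleR_matrix_mult: "(c *\<^sub>R A) ** (d *\<^sub>R B) = (c * d) *\<^sub>R (A ** B)" for A :: "real^'n^'m"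
  by (simp add: vec_eq_iff matrix_matrix_mult_def sum_distrib_left mult_ac)

lemma has_vector_derivative_eqI:
  fixes f g :: "real \<Rightarrow> 'a::real_normed_vector"
  assumes "\<And>t. (f has_vector_derivative D t) (at t)" "\<And>t. (g has_vector_derivative D t) (at t)" "f a = g a"
  shows "f t = g t"
proof -
  have "((\<lambda>t. f t - g t) has_derivative (\<lambda>h. 0)) (at t)" for t
    using has_vector_derivative_diff[OF assms(1,2)] by (simp add: has_vector_derivative_def)
  then have "f t - g t = f a - g a"
    using has_derivative_zero_unique[of UNIV "\<lambda>t. f t - g t" a t] by auto
  then show ?thesis using assms(3) by simp
qed

section \<open>Block levels and the exponential of the nilpotent matrix B\<close>

definition mpow :: "real^'n^'n \<Rightarrow> nat \<Rightarrow> real^'n^'n" where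
  "mpow B k = ((**) B ^^ k) (mat 1)"

lemma mpow_0 [simp]: "mpow B 0 = mat 1" and mpow_Suc: "mpow B (Suc k) = B ** mpow B k"
  by (simp_all add: mpow_def)

lemma mpow_add: "mpow B (i + j) = mpow B i ** mpow B j"
  by (induction i) (simp_all add: mpow_Suc matrix_mul_assoc)

lemma mpow_scaleR: "mpow (c *\<^sub>R B) k = (c ^ k) *\<^sub>R mpow B k"
  by (induction k) (simp_all add: mpow_Suc scaleR_matrix_mult)

locale kolmogorov =
  fixes idx :: "'n::finite \<Rightarrow> nat" and p :: "nat \<Rightarrow> nat" and \<kappa> :: nat and A B :: "real^'n^'n"
  assumes struct: "kolmogorov_structure idx p \<kappa> A B"
begin

lemma bij: "bij_betw idx UNIV {0..<CARD('n)}"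
  and sum_p: "(\<Sum>j\<le>\<kappa>. p j) = CARD('n)"
  and A: "A_form idx p A" and B: "B_form idx p \<kappa> B"
  using struct by (auto simp: kolmogorov_structure_def block_sizes_def)

abbreviation blk :: "nat \<Rightarrow> 'n set" where "blk \<equiv> block idx p"

text \<open>The number of the block that contains \<open>i\<close>; in the dilations this coordinate
  has weight 2 lev i + 1.\<close>

definition lev :: "'n \<Rightarrow> nat" where "lev i = (LEAST j. idx i < (\<Sum>l<Suc j. p l))"

lemma partial_sum_mono: "j \<le> k \<Longrightarrow> (\<Sum>l<j. p l) \<le> (\<Sum>l<k. p l)"
  by (intro sum_mono2) auto

lemma blk_lev: "i \<in> blk j \<Longrightarrow> lev i = j"
  unfolding lev_def
proof (rule Least_equality)
  assume i: "i \<in> blk j"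
  then show "idx i < (\<Sum>l<Suc j. p l)" by (simp add: block_def)
  fix k assume k: "idx i < (\<Sum>l<Suc k. p l)"
  show "j \<le> k"
  proof (rule ccontr)
    assume "\<not> j \<le> k"
    then have "(\<Sum>l<Suc k. p l) \<le> (\<Sum>l<j. p l)" by (intro partial_sum_mono) simp
    then show False using i k by (simp add: block_def)
  qed
qed

lemma lev_le: "lev i \<le> \<kappa>" and lev_blk: "i \<in> blk (lev i)"
proof -
  have "idx i < CARD('n)" using bij by (auto simp: bij_betw_def)
  then have k: "idx i < (\<Sum>l<Suc \<kappa>. p l)" using sum_p by (simp add: lessThan_Suc_atMost)
  then show "lev i \<le> \<kappa>" unfolding lev_def by (rule Least_le)
  have up: "idx i < (\<Sum>l<Suc (lev i). p l)" unfolding lev_def using k by (rule LeastI)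
  have "(\<Sum>l<lev i. p l) \<le> idx i"
  proof (cases "lev i")
    case (Suc j)
    then have "\<not> idx i < (\<Sum>l<Suc j. p l)" unfolding lev_def using not_less_Least by (metis lessI)
    then show ?thesis using Suc by simp
  qed simp
  then show "i \<in> blk (lev i)" using up by (simp add: block_def)
qed

lemma mem_blk: "i \<in> blk j \<longleftrightarrow> lev i = j"
  using blk_lev lev_blk by blast

lemma card_blk:
  assumes "j \<le> \<kappa>" shows "card (blk j) = p j"
proof -
  have le: "(\<Sum>l<Suc j. p l) \<le> CARD('n)"
    unfolding sum_p[symmetric] lessThan_Suc_atMost[symmetric] using assms by (intro partial_sum_mono) simp
  have "bij_betw idx (blk j) {(\<Sum>l<j. p l)..<(\<Sum>l<Suc j. p l)}"
    unfolding bij_betw_def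
  proof
    show "inj_on idx (blk j)" using bij by (auto simp: bij_betw_def inj_on_def)
    show "idx ` blk j = {(\<Sum>l<j. p l)..<(\<Sum>l<Suc j. p l)}"
    proof
      show "{(\<Sum>l<j. p l)..<(\<Sum>l<Suc j. p l)} \<subseteq> idx ` blk j"
      proof
        fix k assume k: "k \<in> {(\<Sum>l<j. p l)..<(\<Sum>l<Suc j. p l)}"
        then have "k \<in> {0..<CARD('n)}" using le by auto
        then have "k \<in> range idx" using bij by (simp add: bij_betw_def)
        then obtain i where i: "k = idx i" by blast
        then show "k \<in> idx ` blk j" using k by (auto simp: block_def)
      qed
    qed (auto simp: block_def)
  qed
  then have "card (blk j) = card {(\<Sum>l<j. p l)..<(\<Sum>l<Suc j. p l)}" by (rule bij_betw_same_card)
  then show ?thesis by simp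
qed

lemma B_entry: "B $ i $ k \<noteq> 0 \<Longrightarrow> lev i = Suc (lev k)"
  using B unfolding B_form_def mem_blk by force

text \<open>Every factor \<open>B\<close> raises the level by one. As levels are at most \<kappa>,
  \<open>B\<close> is nilpotent and the exponential series is a finite sum.\<close>

lemma mpow_entry: "mpow B m $ i $ k \<noteq> 0 \<Longrightarrow> lev i = lev k + m"
proof (induction m arbitrary: i)
  case 0
  then show ?case by (simp add: mat_def split: if_splits)
next
  case (Suc m)
  have "(\<Sum>l\<in>UNIV. B $ i $ l * mpow B m $ l $ k) \<noteq> 0"
    using Suc.prems by (simp add: mpow_Suc matrix_matrix_mult_def)
  then obtain l where "B $ i $ l * mpow B m $ l $ k \<noteq> 0" by (metis (mono_tags, lifting) sum.neutral)
  then show ?case using Suc.IH[of l] B_entry[of i l] by simp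
qed

lemma mpow_eq_0: "\<kappa> < m \<Longrightarrow> mpow B m = 0"
proof -
  assume m: "\<kappa> < m"
  have "mpow B m $ i $ k = 0" for i k
    using mpow_entry[of m i k] lev_le[of i] m by (cases "mpow B m $ i $ k = 0") auto
  then show ?thesis by (simp add: vec_eq_iff)
qed

abbreviation E :: "real \<Rightarrow> real^'n^'n" where "E \<equiv> E_mat B"

lemma E_eq: "E t = (\<Sum>k\<le>\<kappa>. ((- t) ^ k / fact k) *\<^sub>R mpow B k)"
proof -
  have "E t = (\<Sum>k. (1 / fact k) *\<^sub>R mpow ((- t) *\<^sub>R B) k)"
    by (simp add: E_mat_def matrix_exp_def mpow_def)
  also have "\<dots> = (\<Sum>k\<le>\<kappa>. (1 / fact k) *\<^sub>R mpow ((- t) *\<^sub>R B) k)"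
  proof (rule suminf_finite)
    fix k assume "k \<notin> {..\<kappa>}"
    then show "(1 / fact k) *\<^sub>R mpow ((- t) *\<^sub>R B) k = 0"
      using mpow_scaleR[of "- t" B k] mpow_eq_0[of k] by simp
  qed simp
  also have "\<dots> = (\<Sum>k\<le>\<kappa>. ((- t) ^ k / fact k) *\<^sub>R mpow B k)"
    by (simp only: mpow_scaleR scaleR_scaleR) simp
  finally show ?thesis .
qed

lemma E_entry: "E t $ i $ k = (\<Sum>m\<le>\<kappa>. (- t) ^ m / fact m * mpow B m $ i $ k)"
  by (simp add: E_eq sum_component)

text \<open>Cauchy product of two finite exponential sums: the terms of the square outside the
  triangle i + j \<le> \<kappa> vanish by nilpotency.\<close>

lemma E_add: "E (s + t) = E s ** E t"
proof -
  let ?g = "\<lambda>i j. ((- s) ^ i / fact i * ((- t) ^ j / fact j)) *\<^sub>R mpow B (i + j)"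
  have "E s ** E t = (\<Sum>j\<le>\<kappa>. \<Sum>i\<le>\<kappa>. ?g i j)"
    by (simp add: E_eq sum_matrix_mult_left sum_matrix_mult_right scaleR_matrix_mult mpow_add)
  also have "\<dots> = (\<Sum>i\<le>\<kappa>. \<Sum>j\<le>\<kappa>. ?g i j)" by (rule sum.swap)
  also have "\<dots> = (\<Sum>(i,j)\<in>{..\<kappa>} \<times> {..\<kappa>}. ?g i j)" by (simp add: sum.cartesian_product)
  also have "\<dots> = (\<Sum>(i,j)\<in>{(i,j). i + j < Suc \<kappa>}. ?g i j)"
  proof (rule sum.mono_neutral_right)
    show "\<forall>x\<in>{..\<kappa>} \<times> {..\<kappa>} - {(i, j). i + j < Suc \<kappa>}. (case x of (i, j) \<Rightarrow> ?g i j) = 0"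
    proof
      fix x assume "x \<in> {..\<kappa>} \<times> {..\<kappa>} - {(i, j). i + j < Suc \<kappa>}"
      then obtain i j where x: "x = (i, j)" and "\<kappa> < i + j" by (cases x) auto
      then show "(case x of (i, j) \<Rightarrow> ?g i j) = 0" by (simp add: mpow_eq_0)
    qed
  qed auto
  also have "\<dots> = (\<Sum>k<Suc \<kappa>. \<Sum>i\<le>k. ?g i (k - i))" by (rule sum.triangle_reindex)
  also have "\<dots> = (\<Sum>k<Suc \<kappa>. ((- (s + t)) ^ k / fact k) *\<^sub>R mpow B k)"
  proof (rule sum.cong[OF refl])
    fix k
    have "(\<Sum>i\<le>k. ?g i (k - i)) = (\<Sum>i\<le>k. ((- s) ^ i /\<^sub>R fact i * ((- t) ^ (k - i) /\<^sub>R fact (k - i))) *\<^sub>R mpow B k)"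
      by (intro sum.cong) (auto simp: divide_inverse mult_ac)
    also have "\<dots> = (\<Sum>i\<le>k. (- s) ^ i /\<^sub>R fact i * ((- t) ^ (k - i) /\<^sub>R fact (k - i))) *\<^sub>R mpow B k"
      by (simp add: scaleR_sum_left)
    also have "(\<Sum>i\<le>k. (- s) ^ i /\<^sub>R fact i * ((- t) ^ (k - i) /\<^sub>R fact (k - i))) = ((- s) + (- t)) ^ k /\<^sub>R fact k"
      by (rule exp_series_add_commuting[symmetric]) simp
    finally show "(\<Sum>i\<le>k. ?g i (k - i)) = ((- (s + t)) ^ k / fact k) *\<^sub>R mpow B k"
      by (simp add: divide_inverse mult.commute)
  qed
  finally show ?thesis by (simp add: E_eq lessThan_Suc_atMost)
qed

lemma E_0: "E 0 = mat 1"
proof -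
  have "E 0 = (\<Sum>k\<le>\<kappa>. if k = 0 then mat 1 else 0)" unfolding E_eq by (intro sum.cong) auto
  then show ?thesis by simp
qed

lemma E_inverse: "E t ** E (- t) = mat 1" "E (- t) ** E t = mat 1"
  using E_add[of t "- t"] E_add[of "- t" t] by (simp_all add: E_0)

lemma E_inverse_vec: "E t *v (E (- t) *v x) = x" "E (- t) *v (E t *v x) = x"
  by (simp_all add: matrix_vector_mul_assoc E_inverse)

lemma invertible_E: "invertible (E t)"
  using E_inverse invertible_def by blast

lemma continuous_on_E: "continuous_on X E"
  unfolding E_eq by (intro continuous_intros) auto

lemma E_diag: "E t $ i $ i = 1" and E_off_diag: "i \<noteq> k \<Longrightarrow> E t $ i $ k \<noteq> 0 \<Longrightarrow> lev k < lev i"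
proof -
  have "E t $ i $ i = (\<Sum>m\<le>\<kappa>. if m = 0 then 1 else 0)"
    unfolding E_entry
  proof (intro sum.cong refl)
    fix m
    show "(- t) ^ m / fact m * mpow B m $ i $ i = (if m = 0 then 1 else 0)"
      using mpow_entry[of m i i] by (cases "m = 0") (auto simp: mat_def)
  qed
  then show "E t $ i $ i = 1" by simp
next
  assume ik: "i \<noteq> k" "E t $ i $ k \<noteq> 0"
  then obtain m where m: "(- t) ^ m / fact m * mpow B m $ i $ k \<noteq> 0"
    unfolding E_entry by (metis (mono_tags, lifting) sum.neutral)
  then have "m \<noteq> 0" using ik(1) by (cases m) (auto simp: mat_def)
  then show "lev k < lev i" using mpow_entry[of m i k] m by simp
qed

text \<open>\<open>E t\<close> is triangular for the ordering by levels, with unit diagonal. A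
  permutation with nonzero product never raises a level and lowers it at every moved index, contrary
  to the invariance of the sum of levels.\<close>

lemma det_E: "det (E t) = 1"
proof -
  let ?U = "UNIV :: 'n set"
  have z: "(\<Prod>i\<in>?U. E t $ i $ q i) = 0" if q: "q permutes ?U" "q \<noteq> id" for q
  proof (rule ccontr)
    assume "(\<Prod>i\<in>?U. E t $ i $ q i) \<noteq> 0"
    then have nz: "E t $ i $ q i \<noteq> 0" for i by simp
    obtain j where j: "q j \<noteq> j" using q(2) by (auto simp: fun_eq_iff)
    have le: "lev (q i) \<le> lev i" for i
      using E_off_diag[of i "q i" t] nz[of i] by (cases "q i = i") auto
    have lt: "lev (q j) < lev j" using E_off_diag[of j "q j" t] nz[of j] j by auto
    have "(\<Sum>i\<in>?U. lev (q i)) < (\<Sum>i\<in>?U. lev i)"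
      using le lt by (intro sum_strict_mono_ex1) auto
    moreover have "(\<Sum>i\<in>?U. lev (q i)) = (\<Sum>i\<in>?U. lev i)"
      using sum.permute[OF q(1), of lev] by (simp add: o_def)
    ultimately show False by simp
  qed
  have "det (E t) = (\<Sum>q\<in>{id}. of_int (sign q) * (\<Prod>i\<in>?U. E t $ i $ q i))"
    unfolding det_def by (rule sum.mono_neutral_right) (auto simp: z finite_permutations permutes_id)
  then show ?thesis by (simp add: sign_id E_diag)
qed

section \<open>The covariance C, its positivity and its scaling\<close>

lemma A_entry: "A $ i $ k \<noteq> 0 \<Longrightarrow> lev i = 0 \<and> lev k = 0"
proof -
  assume nz: "A $ i $ k \<noteq> 0"
  have "A = submat A (blk 0) (blk 0)" using A unfolding A_form_def by blast
  from arg_cong[OF this, of "\<lambda>M. M $ i $ k"]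
  have "A $ i $ k = (if i \<in> blk 0 \<and> k \<in> blk 0 then A $ i $ k else 0)"
    unfolding submat_def by (simp only: vec_lambda_beta)
  then have "i \<in> blk 0 \<and> k \<in> blk 0" using nz by presburger
  then show ?thesis by (simp add: mem_blk)
qed

lemma A_sym: "transpose A = A" using A by (simp add: A_form_def)

definition low :: "real^'n \<Rightarrow> real^'n" where "low x = (\<chi> i. if lev i = 0 then x $ i else 0)"

lemma A_low: "(A *v x) \<bullet> x = (A *v low x) \<bullet> low x"
proof -
  have "A $ i $ k * x $ k = A $ i $ k * low x $ k" for i k
    using A_entry[of i k] by (cases "A $ i $ k = 0") (auto simp: low_def)
  then have 1: "A *v x = A *v low x" unfolding matrix_vector_mult_def by (simp only:)
  have "(A *v y) $ i * x $ i = (A *v y) $ i * low x $ i" for y i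
  proof (cases "lev i = 0")
    case False
    then have "A $ i $ k = 0" for k using A_entry[of i k] by auto
    then show ?thesis by (simp add: matrix_vector_mult_def)
  qed (simp add: low_def)
  then show ?thesis unfolding 1 inner_vec_def inner_real_def by (intro sum.cong refl)
qed

lemma A_pos: "low x \<noteq> 0 \<Longrightarrow> 0 < (A *v x) \<bullet> x"
  unfolding A_low[of x] using A unfolding A_form_def mem_blk by (auto simp: low_def)

lemma A_nonneg: "0 \<le> (A *v x) \<bullet> x"
  using A_pos[of x] A_low[of x] by (cases "low x = 0") auto

definition P :: "real \<Rightarrow> real^'n^'n" where "P t = E t ** A ** transpose (E t)"

lemma P_quadratic: "(P t *v x) \<bullet> x = (A *v (transpose (E t) *v x)) \<bullet> (transpose (E t) *v x)"
  by (simp add: P_def matrix_vector_mul_assoc[symmetric] inner_matrix_transpose)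

lemma P_nonneg: "0 \<le> (P t *v x) \<bullet> x"
  unfolding P_quadratic by (rule A_nonneg)

lemma P_sym: "transpose (P t) = P t"
  by (simp add: P_def matrix_transpose_mul A_sym matrix_mul_assoc)

lemma P_add: "E s ** P t ** transpose (E s) = P (s + t)"
  by (simp add: P_def E_add matrix_transpose_mul matrix_mul_assoc)

lemma continuous_on_P: "continuous_on X P"
  unfolding P_def by (intro continuous_on_matrix_mult continuous_on_transpose continuous_on_E continuous_intros)

abbreviation C :: "real \<Rightarrow> real^'n^'n" where "C \<equiv> C_mat A B"

lemma C_0: "C 0 = 0"
  by (simp add: C_mat_def flip: zero_ereal_def)

lemma C_deriv: "(C has_vector_derivative P t) (at t)"
proof -
  let ?a = "- \<bar>t\<bar> - 1" and ?b = "\<bar>t\<bar> + 1"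
  have "((\<lambda>u. LBINT y=ereal 0..ereal u. P y) has_vector_derivative P t) (at t within {?a..?b})"
    by (rule interval_integral_FTC2) (auto intro: continuous_on_P)
  then have "((\<lambda>u. LBINT y=ereal 0..ereal u. P y) has_vector_derivative P t) (at t)"
    by (subst (asm) at_within_interior) auto
  moreover have "C = (\<lambda>u. LBINT y=ereal 0..ereal u. P y)"
    by (simp add: fun_eq_iff C_mat_def P_def zero_ereal_def)
  ultimately show ?thesis by simp
qed

text \<open>Both sides vanish at u = 0 and have the derivative P (s + u), since \<open>E\<close> is
  a one-parameter group. This turns the flow into increments of \<open>C\<close>.\<close>

lemma C_conjugate: "E s ** C u ** transpose (E s) = C (s + u) - C s"
proof (rule has_vector_derivative_eqI[where a=0 and D="\<lambda>u. P (s + u)" and t=u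
    and f="\<lambda>u. E s ** C u ** transpose (E s)" and g="\<lambda>u. C (s + u) - C s"])
  fix u
  show "((\<lambda>u. E s ** C u ** transpose (E s)) has_vector_derivative P (s + u)) (at u)"
    using bounded_linear.has_vector_derivative[OF bounded_linear_congruence C_deriv, of "E s" "transpose (E s)" u]
    by (simp add: P_add)
  have "((\<lambda>u. C (s + u)) has_vector_derivative P (s + u)) (at u)"
  proof -
    have "((\<lambda>u. s + u) has_vector_derivative 1) (at u)"
      unfolding has_real_derivative_iff_has_vector_derivative[symmetric] by (auto intro!: derivative_eq_intros)
    from vector_diff_chain_at[OF this C_deriv] show ?thesis by (simp add: o_def)
  qed
  then show "((\<lambda>u. C (s + u) - C s) has_vector_derivative P (s + u)) (at u)"
    using has_vector_derivative_diff[OF _ has_vector_derivative_const] by fastforce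
next
  show "E s ** C 0 ** transpose (E s) = C (s + 0) - C s"
    by (simp add: C_0 vec_eq_iff matrix_matrix_mult_def)
qed

lemma C_sym: "transpose (C t) = C t"
proof (rule has_vector_derivative_eqI[where a=0 and D=P and t=t and f="\<lambda>t. transpose (C t)" and g=C])
  fix t
  have "bounded_linear (transpose :: real^'n^'n \<Rightarrow> _)"
    by (intro linear_conv_bounded_linear[THEN iffD1] linearI) (simp_all add: transpose_add transpose_scaleR)
  from bounded_linear.has_vector_derivative[OF this C_deriv]
  show "((\<lambda>t. transpose (C t)) has_vector_derivative P t) (at t)" by (simp add: P_sym)
qed (auto simp: C_deriv C_0 transpose_def vec_eq_iff)

lemma DERIV_C_inner: "((\<lambda>t. (C t *v x) \<bullet> x) has_real_derivative (P t *v x) \<bullet> x) (at t)"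
proof -
  have "bounded_linear (\<lambda>X :: real^'n^'n. (X *v x) \<bullet> x)"
    by (intro linear_conv_bounded_linear[THEN iffD1] linearI)
      (simp_all add: matrix_vector_mult_add_rdistrib inner_add_left scaleR_matrix_vector_assoc[symmetric])
  from bounded_linear.has_vector_derivative[OF this C_deriv]
  show ?thesis by (simp add: has_real_derivative_iff_has_vector_derivative)
qed

text \<open>The rank of the block equals its number of rows, so the block is onto and its transpose
  is injective on the vectors supported in block j + 1.\<close>

lemma submat_rank_injective:
  assumes j: "Suc j \<le> \<kappa>" and z: "\<And>k. k \<in> blk j \<Longrightarrow> (transpose B *v x) $ k = 0" and i: "i \<in> blk (Suc j)"
  shows "x $ i = 0"
proof -
  let ?M = "submat B (blk (Suc j)) (blk j)"
  let ?V = "{v :: real^'n. \<forall>i. i \<notin> blk (Suc j) \<longrightarrow> v $ i = 0}"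
  have "\<forall>j\<in>{1..\<kappa>}. rank (submat B (blk j) (blk (j - 1))) = p j" using B unfolding B_form_def by blast
  from bspec[OF this, of "Suc j"] have rk: "rank ?M = p (Suc j)" using j by simp
  have "subspace (range ((*v) ?M))" by (intro linear_subspace_image subspace_UNIV matrix_vector_mul_linear)
  moreover have sV: "subspace ?V" by (auto simp: subspace_def)
  moreover have "range ((*v) ?M) \<subseteq> ?V" by (auto simp: submat_def matrix_vector_mult_def)
  moreover have "dim ?V \<le> dim (range ((*v) ?M))"
  proof -
    have "dim ?V = card (blk (Suc j))" by (simp add: dim_substandard_cart flip: dim_vec_eq)
    also have "\<dots> = dim (range ((*v) ?M))" using rk card_blk[OF j] by (simp add: rank_dim_range)
    finally show ?thesis by simp
  qed
  ultimately have eq: "range ((*v) ?M) = ?V" by (intro subspace_dim_equal)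
  define x' where "x' = (\<chi> i. if i \<in> blk (Suc j) then x $ i else 0)"
  have "x' \<in> ?V" by (simp add: x'_def)
  then obtain u where u: "x' = ?M *v u" using eq by blast
  have Mt: "(transpose ?M *v x) $ k = 0" for k
  proof (cases "k \<in> blk j")
    case True
    have "(transpose ?M *v x) $ k = (transpose B *v x) $ k"
      unfolding matrix_vector_mult_def transpose_def submat_def
      using True B_entry[of _ k] by (auto simp: mem_blk intro!: sum.cong)
    then show ?thesis using z True by simp
  qed (simp add: matrix_vector_mult_def transpose_def submat_def)
  \<comment> \<open>With x' = M u, the square of x' equals the product of the transpose of M applied
    to \<open>x\<close> with \<open>u\<close>, which vanishes.\<close>
  have "x' \<bullet> x' = x \<bullet> x'" by (simp add: inner_vec_def x'_def if_distrib cong: if_cong)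
  also have "\<dots> = (transpose ?M *v x) \<bullet> u" using inner_matrix_transpose[of ?M u x] u by (simp add: inner_commute)
  also have "\<dots> = 0" using Mt by (simp add: inner_vec_def)
  finally have "x' = 0" by simp
  then show ?thesis using i by (auto simp: x'_def vec_eq_iff split: if_splits)
qed

text \<open>Induction over the block, replacing x by its image under the transpose of
  \<open>B\<close>: block j of that image determines block j + 1 of x.\<close>

lemma blocks_zero:
  assumes "j \<le> \<kappa>" "\<And>k. lev k = 0 \<Longrightarrow> (transpose (mpow B j) *v x) $ k = 0" "lev i = j"
  shows "x $ i = 0"
  using assms
proof (induction j arbitrary: x i)
  case 0
  then show ?case by (simp add: transpose_mat)
next
  case (Suc j)
  have "(transpose B *v x) $ k = 0" if "lev k = j" for k
  proof (rule Suc.IH[OF _ _ that])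
    show "(transpose (mpow B j) *v (transpose B *v x)) $ k = 0" if "lev k = 0" for k
      using Suc.prems(2)[OF that] unfolding mpow_Suc matrix_transpose_mul matrix_vector_mul_assoc[symmetric] .
  qed (use Suc.prems in simp)
  then show ?case
    using submat_rank_injective[OF Suc.prems(1), of x i] Suc.prems(3) by (simp add: mem_blk)
qed

text \<open>The function \<open>s \<mapsto> low (transpose (E s) *v x)\<close> is polynomial in \<open>s\<close>; its coefficients determine \<open>x\<close>
  by the rank conditions on the blocks of \<open>B\<close>.\<close>

lemma kalman:
  assumes t: "0 < t" and z: "\<And>s. 0 < s \<Longrightarrow> s < t \<Longrightarrow> low (transpose (E s) *v x) = 0"
  shows "x = 0"
proof -
  have coeff: "(transpose (mpow B m) *v x) $ i = 0" if i: "lev i = 0" and m: "m \<le> \<kappa>" for i m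
  proof -
    let ?c = "\<lambda>m. (- 1) ^ m / fact m * (transpose (mpow B m) *v x) $ i"
    let ?q = "\<Sum>m\<le>\<kappa>. monom (?c m) m"
    have val: "(transpose (E s) *v x) $ i = poly ?q s" for s
    proof -
      have "(transpose (E s) *v x) $ i = (\<Sum>k\<in>UNIV. \<Sum>m\<le>\<kappa>. (- s) ^ m / fact m * mpow B m $ k $ i * x $ k)"
        by (simp add: matrix_vector_mult_def transpose_def E_entry sum_distrib_right)
      also have "\<dots> = (\<Sum>m\<le>\<kappa>. \<Sum>k\<in>UNIV. (- s) ^ m / fact m * mpow B m $ k $ i * x $ k)" by (rule sum.swap)
      also have "\<dots> = (\<Sum>m\<le>\<kappa>. ?c m * s ^ m)"
        by (intro sum.cong refl)
          (simp add: matrix_vector_mult_def transpose_def sum_distrib_left sum_distrib_right power_minus[of s] mult_ac)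
      finally show ?thesis by (simp add: poly_sum poly_monom)
    qed
    have "poly ?q s = 0" if "0 < s" "s < t" for s
    proof -
      have "low (transpose (E s) *v x) $ i = 0" using z[OF that] by simp
      then show ?thesis using i val[of s] by (simp add: low_def)
    qed
    then have "{0<..<t} \<subseteq> {s. poly ?q s = 0}" by auto
    then have "infinite {s. poly ?q s = 0}" using t by (meson infinite_Ioo infinite_super)
    then have "?q = 0" using poly_roots_finite by blast
    then have "coeff ?q m = 0" by simp
    then have "?c m = 0" using m by (simp add: coeff_sum if_distrib cong: if_cong)
    then show ?thesis by simp
  qed
  have "x $ i = 0" for i
    by (rule blocks_zero[OF lev_le[of i]]) (use coeff lev_le in auto)
  then show ?thesis by (simp add: vec_eq_iff)
qed

text \<open>The form (C s x, x) is nondecreasing from 0. If it vanished at t, it would vanish on the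
  whole interval together with its derivative (P s x, x), and \<open>kalman\<close> would give x =
  0.\<close>

lemma C_spd0:
  assumes t: "0 < t" shows "spd (C t)"
  unfolding spd_def
proof (intro conjI allI impI C_sym)
  fix x :: "real^'n" assume x: "x \<noteq> 0"
  let ?f = "\<lambda>t. (C t *v x) \<bullet> x"
  have mono: "?f a \<le> ?f b" if "a \<le> b" for a b
    using that by (intro DERIV_nonneg_imp_nondecreasing[of a b ?f]) (use DERIV_C_inner P_nonneg in blast)+
  have f0: "?f 0 = 0" by (simp add: C_0)
  have "?f t \<noteq> 0"
  proof
    assume ft: "?f t = 0"
    have "low (transpose (E s) *v x) = 0" if s: "0 < s" "s < t" for s
    proof (rule ccontr)
      assume "low (transpose (E s) *v x) \<noteq> 0"
      then have pos: "0 < (P s *v x) \<bullet> x" unfolding P_quadratic by (rule A_pos)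
      have const: "?f u = 0" if "u \<in> {0<..<t}" for u using mono[of 0 u] mono[of u t] f0 ft that by auto
      have "(?f has_real_derivative 0) (at s)"
        by (rule has_field_derivative_transform_within_open[OF DERIV_const, of "{0<..<t}" _ 0]) (use s const in auto)
      then have "(P s *v x) \<bullet> x = 0" using DERIV_C_inner DERIV_unique by blast
      then show False using pos by simp
    qed
    then have "x = 0" by (rule kalman[OF t])
    then show False using x by simp
  qed
  moreover have "0 \<le> ?f t" using mono[of 0 t] f0 t by simp
  ultimately show "0 < ?f t" by simp
qed

lemma C_spd: "s < t \<Longrightarrow> spd (C t - C s)"
  using spd_congruence[OF C_spd0[of "t - s"] invertible_E[of s]] C_conjugate[of s "t - s"] by simp

text \<open>As \<open>A\<close> lives on level 0, only the columns of \<open>E\<close> at level 0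
  enter \<open>P\<close>. There the entry in row i is a monomial in time of degree lev i.\<close>

lemma P_scale: "P (m * s) $ i $ k = m ^ (lev i + lev k) * P s $ i $ k"
proof -
  have E: "E (m * s) $ i $ a = m ^ lev i * E s $ i $ a" if "lev a = 0" for i a
  proof -
    have "(- (m * s)) ^ l / fact l * mpow B l $ i $ a = m ^ lev i * ((- s) ^ l / fact l * mpow B l $ i $ a)" for l
    proof (cases "mpow B l $ i $ a = 0")
      case False
      then have l: "lev i = l" using mpow_entry[of l i a] that by simp
      have "(- (m * s)) ^ l = m ^ l * (- s) ^ l" unfolding power_mult_distrib[symmetric] by simp
      then show ?thesis unfolding l by simp
    qed simp
    then show ?thesis unfolding E_entry sum_distrib_left by (simp only:)
  qed
  have P: "P s $ i $ k = (\<Sum>b\<in>UNIV. \<Sum>a\<in>UNIV. E s $ i $ a * A $ a $ b * E s $ k $ b)" for s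
    unfolding P_def matrix_matrix_mult_def transpose_def vec_lambda_beta sum_distrib_right ..
  have "E (m * s) $ i $ a * A $ a $ b * E (m * s) $ k $ b = m ^ (lev i + lev k) * (E s $ i $ a * A $ a $ b * E s $ k $ b)" for a b
  proof (cases "A $ a $ b = 0")
    case False
    then have "lev a = 0" "lev b = 0" using A_entry[of a b] by simp_all
    then have 1: "E (m * s) $ i $ a = m ^ lev i * E s $ i $ a" and 2: "E (m * s) $ k $ b = m ^ lev k * E s $ k $ b"
      using E by blast+
    show ?thesis unfolding 1 2 power_add by (simp only: mult_ac)
  qed simp
  then show ?thesis unfolding P sum_distrib_left by (simp only:)
qed

lemma C_scale: "C m $ i $ k = m ^ (1 + lev i + lev k) * C 1 $ i $ k"
proof -
  have "C (m * t) $ i $ k = m ^ (1 + lev i + lev k) * C t $ i $ k" for t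
  proof (rule has_vector_derivative_eqI[where a=0 and D="\<lambda>t. m ^ (1 + lev i + lev k) * P t $ i $ k" and t=t
      and f="\<lambda>t. C (m * t) $ i $ k" and g="\<lambda>t. m ^ (1 + lev i + lev k) * C t $ i $ k"])
    fix t
    have C: "((\<lambda>t. C t $ i $ k) has_real_derivative P t $ i $ k) (at t)" for t
      by (rule DERIV_matrix_entry[OF C_deriv])
    have "((\<lambda>t. C (m * t) $ i $ k) has_real_derivative P (m * t) $ i $ k * m) (at t)"
      by (rule DERIV_chain2[OF C]) (auto intro!: derivative_eq_intros)
    then show "((\<lambda>t. C (m * t) $ i $ k) has_vector_derivative m ^ (1 + lev i + lev k) * P t $ i $ k) (at t)"
      by (simp add: P_scale has_real_derivative_iff_has_vector_derivative[symmetric] mult_ac)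
    show "((\<lambda>t. m ^ (1 + lev i + lev k) * C t $ i $ k) has_vector_derivative m ^ (1 + lev i + lev k) * P t $ i $ k) (at t)"
      unfolding has_real_derivative_iff_has_vector_derivative[symmetric] by (intro DERIV_cmult C)
  qed (simp add: C_0)
  from this[of 1] show ?thesis by simp
qed

text \<open>The sum of the dilation weights of the spatial coordinates, that is
  \<open>hom_dim p \<kappa> - 2\<close>.\<close>

definition N :: nat where "N = (\<Sum>i\<in>UNIV. 1 + 2 * lev (i::'n))"

text \<open>By \<open>C_scale\<close> the matrix \<open>C m\<close> arises from \<open>C 1\<close>
  by multiplying row i by m^(lev i) and column k by m^(1 + lev k).\<close>

lemma det_C: "det (C m) = det (C 1) * m ^ N"
proof -
  let ?U = "UNIV :: 'n set"
  let ?X = "(\<chi> i k. m ^ (1 + lev k) * C 1 $ i $ k) :: real^'n^'n"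
  have 1: "C m = (\<chi> i. m ^ lev i *s (?X $ i))"
    by (subst vec_eq_iff, subst vec_eq_iff) (simp add: C_scale[of m] power_add mult_ac)
  have 2: "transpose ?X = (\<chi> i. m ^ (1 + lev i) *s (transpose (C 1) $ i))"
    by (simp add: vec_eq_iff transpose_def)
  have "det (C m) = (\<Prod>i\<in>?U. m ^ lev i) * det ?X"
    using 1 det_rows_mul[of "\<lambda>i. m ^ lev i" "\<lambda>i. ?X $ i"] by simp
  also have "det ?X = det (transpose ?X)" by simp
  also have "\<dots> = (\<Prod>i\<in>?U. m ^ (1 + lev i)) * det (transpose (C 1))"
    unfolding 2 using det_rows_mul[of "\<lambda>i. m ^ (1 + lev i)" "\<lambda>i. transpose (C 1) $ i"] by simp
  finally have "det (C m) = (\<Prod>i\<in>?U. m ^ lev i) * (\<Prod>i\<in>?U. m ^ (1 + lev i)) * det (C 1)" by simp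
  also have "(\<Prod>i\<in>?U. m ^ lev i) * (\<Prod>i\<in>?U. m ^ (1 + lev i)) = (\<Prod>i\<in>?U. m ^ (1 + 2 * lev i))"
    unfolding prod.distrib[symmetric] by (intro prod.cong refl) (simp add: power_add mult_2 mult_ac)
  also have "\<dots> = m ^ N" by (simp add: N_def power_sum)
  finally show ?thesis by simp
qed

sublocale frame C P N
proof
  show "0 < N" unfolding N_def by (intro sum_pos) auto
qed (rule C_0 C_deriv continuous_on_P P_sym P_nonneg C_spd det_C; assumption?)+

end

section \<open>Transfer to the original coordinates\<close>

lemma AE_hyperplane:
  fixes a :: "'a::euclidean_space"
  assumes "a \<noteq> 0" shows "AE x in lborel. a \<bullet> x \<noteq> 0"
proof -
  have "{x. a \<bullet> x = 0} \<in> null_sets lebesgue"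
    using negligible_hyperplane[of a 0] assms by (simp add: negligible_iff_null_sets)
  then have "AE x in lebesgue. x \<notin> {x. a \<bullet> x = 0}" by (rule AE_not_in)
  then show ?thesis by (simp add: AE_completion_iff)
qed

lemma AE_lborel_slices:
  fixes S :: "('a::euclidean_space \<times> real) set"
  assumes [measurable]: "S \<in> sets borel" and AE: "\<And>t. t \<noteq> 0 \<Longrightarrow> AE x in lborel. (x, t) \<in> S"
  shows "AE z in lborel. z \<in> S"
proof -
  have slice: "(\<integral>\<^sup>+x. indicator (- S) (x, t) \<partial>lborel) = 0" if "t \<noteq> 0" for t
  proof -
    have "(\<integral>\<^sup>+x. indicator (- S) (x, t) \<partial>lborel) = (\<integral>\<^sup>+(x::'a). 0 \<partial>lborel)"
      using AE[OF that] by (intro nn_integral_cong_AE) (auto elim!: eventually_mono simp: indicator_def)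
    then show ?thesis by simp
  qed
  have "emeasure lborel (- S) = (\<integral>\<^sup>+z. indicator (- S) z \<partial>lborel)" by simp
  also have "\<dots> = (\<integral>\<^sup>+t. \<integral>\<^sup>+x. indicator (- S) (x, t) \<partial>lborel \<partial>lborel)"
    by (rule nn_integral_lborel_pair) measurable
  also have "\<dots> = (\<integral>\<^sup>+(t::real). 0 \<partial>lborel)"
    by (rule nn_integral_cong_AE) (use AE_lborel_singleton[of "0::real"] slice in \<open>auto elim!: eventually_mono\<close>)
  finally have "- S \<in> null_sets lborel" by (simp add: null_sets_def)
  from AE_not_in[OF this] show ?thesis by simp
qed

text \<open>A Gaussian is a density, so a linear map of determinant 1 carries it to the Gaussian of
  the congruent matrix without a factor.\<close>

lemma gauss_congruence:
  fixes M E :: "real^'n^'n"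
  assumes M: "spd M" and E: "det E = 1"
  shows "gauss (E ** M ** transpose E) (E *v v) = gauss M v"
proof -
  have inv: "invertible E" using E by (simp add: invertible_det_nz)
  have "spd (E ** M ** transpose E)" using M inv by (rule spd_congruence)
  note K = spd_invertible[OF this]
  have "transpose E ** transpose (matrix_inv E) = mat 1"
    unfolding matrix_transpose_mul[symmetric] matrix_inv_mult(2)[OF inv] by (rule transpose_mat)
  then have Einv: "transpose E *v (transpose (matrix_inv E) *v x) = x" for x
    unfolding matrix_vector_mul_assoc by (simp only: matrix_vector_mul_lid)
  let ?y = "transpose (matrix_inv E) *v (matrix_inv M *v v)"
  have "(E ** M ** transpose E) *v ?y = E *v v"
    by (simp add: matrix_vector_mul_assoc[symmetric] Einv matrix_inv_mult_vec[OF spd_invertible[OF M]]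
        del: transpose_matrix_vector)
  then have "matrix_inv (E ** M ** transpose E) *v (E *v v) = ?y"
    using matrix_inv_mult_vec(2)[OF K, of ?y] by simp
  moreover have "?y \<bullet> (E *v v) = (matrix_inv M *v v) \<bullet> v"
    by (subst inner_commute, subst inner_matrix_transpose) (simp add: Einv inner_commute del: transpose_matrix_vector)
  moreover have "det (E ** M ** transpose E) = det M" using E by (simp add: det_mul)
  ultimately show ?thesis by (simp add: gauss_def)
qed

section \<open>Kernel, ball and measure in the moving coordinates\<close>

context kolmogorov
begin

lemma C_reverse: "C (- t) = - (E (- t) ** C t ** transpose (E (- t)))"
  using C_conjugate[of "- t" t] by (simp add: C_0)

lemma invertible_C: "t \<noteq> 0 \<Longrightarrow> invertible (C t)"
proof (cases "0 < t")
  case False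
  assume "t \<noteq> 0"
  then have "spd (C (- t))" using False by (intro C_spd0) simp
  then have "spd (E t ** C (- t) ** transpose (E t))" using invertible_E by (rule spd_congruence)
  from matrix_inv_uminus(2)[OF spd_invertible[OF this]] show ?thesis using C_reverse[of "- t"] by simp
qed (auto intro: spd_invertible C_spd0)

text \<open>In the coordinates centred at \<open>z0\<close> and moving with the flow of the drift, the group law
  becomes a translation and \<open>\<Gamma>\<close> a Gaussian with covariance \<open>C\<close>; time is reversed.\<close>

definition frame_of :: "(real^'n) \<times> real \<Rightarrow> (real^'n) \<times> real \<Rightarrow> (real^'n) \<times> real" where
  "frame_of z0 z = (E (snd z0 - snd z) *v fst z - fst z0, snd z0 - snd z)"

definition of_frame :: "(real^'n) \<times> real \<Rightarrow> (real^'n) \<times> real \<Rightarrow> (real^'n) \<times> real" where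
  "of_frame z0 z = (E (- snd z) *v (fst z + fst z0), snd z0 - snd z)"

lemma of_frame_frame_of [simp]: "of_frame z0 (frame_of z0 z) = z"
  using E_inverse_vec(2)[of "snd z0 - snd z" "fst z"] by (simp add: of_frame_def frame_of_def)

lemma frame_of_of_frame [simp]: "frame_of z0 (of_frame z0 z) = z"
  using E_inverse_vec(1)[of "snd z" "fst z + fst z0"] by (simp add: of_frame_def frame_of_def)

lemma snd_frame_of: "snd (frame_of z0 z) = snd z0 - snd z"
  by (simp add: frame_of_def)

lemma continuous_on_of_frame: "continuous_on X (of_frame z0)"
proof -
  have "continuous_on X (\<lambda>z. E (- snd z))"
    by (rule continuous_on_compose2[OF continuous_on_E[of UNIV]]) (auto intro!: continuous_intros)
  then show ?thesis unfolding of_frame_def by (intro continuous_intros continuous_on_mult_vec)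
qed

lemma group_difference: "gmult B (ginv B z) \<zeta> = (fst \<zeta> - E (snd \<zeta> - snd z) *v fst z, snd \<zeta> - snd z)"
proof -
  have "E (snd \<zeta>) *v (- (E (- snd z) *v fst z)) = - (E (snd \<zeta> - snd z) *v fst z)"
    using E_add[of "snd \<zeta>" "- snd z"] by (simp add: matrix_mult_vec_minus matrix_vector_mul_assoc)
  then show ?thesis by (simp add: gmult_def ginv_def)
qed

text \<open>The map that carries the group difference to the difference of frame points conjugates
  \<open>C\<close> of the elapsed time to an increment of \<open>C\<close>; it has determinant
  1.\<close>

lemma fund_sol_frame: "fund_sol A B \<zeta> z = kern (frame_of z0 z) (frame_of z0 \<zeta>)"
proof (cases "snd z < snd \<zeta>")
  case True
  let ?s = "snd z0 - snd \<zeta>" and ?u = "snd \<zeta> - snd z"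
  let ?v = "fst \<zeta> - E ?u *v fst z"
  have 1: "E ?s ** C ?u ** transpose (E ?s) = C (snd z0 - snd z) - C ?s"
    using C_conjugate[of ?s ?u] by simp
  have 2: "E ?s *v ?v = fst (frame_of z0 \<zeta>) - fst (frame_of z0 z)"
    using E_add[of ?s ?u] by (simp add: frame_of_def matrix_vector_mult_diff_distrib matrix_vector_mul_assoc)
  have "spd (C ?u)" using True by (intro C_spd0) simp
  from gauss_congruence[OF this det_E, of ?s ?v]
  have "gauss (C ?u) ?v = kern (frame_of z0 z) (frame_of z0 \<zeta>)"
    unfolding 1 2 using True by (simp add: kern_def snd_frame_of)
  moreover have "fund_sol A B \<zeta> z = gauss (C ?u) ?v"
    using True by (simp add: fund_sol_def fund_sol0_def group_difference gauss_def)
  ultimately show ?thesis by simp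
next
  case False
  then show ?thesis by (simp add: fund_sol_def fund_sol0_def group_difference kern_def snd_frame_of)
qed

lemma fund_sol_pole: "fund_sol A B z0 z = psi (frame_of z0 z)"
proof -
  have "frame_of z0 z0 = (0, 0)" by (simp add: frame_of_def E_0)
  then have "fund_sol A B z0 z = kern (frame_of z0 z) (0, 0)" using fund_sol_frame[of z0 z z0] by simp
  then show ?thesis
    by (cases "0 < snd (frame_of z0 z)") (simp_all add: psi_eq_kern, simp add: psi_def kern_def)
qed

text \<open>The original kernel in frame coordinates, for both signs of time: only later is
  \<open>D\<close> shown to lie at positive frame time, where this agrees with
  \<open>W\<close>.\<close>

definition frame_W :: "(real^'n) \<times> real \<Rightarrow> real" where
  "frame_W z = W_kernel A B (E (- snd z) *v fst z, - snd z)"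

lemma W_kernel_frame: "W_kernel A B (gmult B (ginv B z0) \<zeta>) = frame_W (frame_of z0 \<zeta>)"
proof -
  have "E (snd \<zeta> - snd z0) *v (E (snd z0 - snd \<zeta>) *v fst \<zeta>) = fst \<zeta>"
    using E_inverse_vec(2)[of "snd z0 - snd \<zeta>" "fst \<zeta>"] by simp
  then show ?thesis
    by (simp add: frame_W_def group_difference frame_of_def matrix_vector_mult_diff_distrib)
qed

lemma frame_W_eq: "snd z \<noteq> 0 \<Longrightarrow> frame_W z =
    ((A *v (matrix_inv (C (- snd z)) *v (E (- snd z) *v fst z))) \<bullet> (matrix_inv (C (- snd z)) *v (E (- snd z) *v fst z))) / 4"
  by (simp add: frame_W_def W_kernel_def)

text \<open>Time reversal of the covariance: the inverse of C (- s) times E (- s) is minus the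
  transpose of E s times the inverse of C s. The sign drops out of the quadratic form, and the
  transpose turns \<open>A\<close> into \<open>P s\<close>.\<close>

lemma frame_W_upper:
  assumes s: "0 < snd z" shows "frame_W z = W z"
proof -
  let ?s = "snd z" let ?c = "matrix_inv (C ?s) *v fst z"
  let ?y = "- (transpose (E ?s) *v ?c)"
  have "transpose (E (- ?s)) ** transpose (E ?s) = mat 1"
    unfolding matrix_transpose_mul[symmetric] E_inverse by (rule transpose_mat)
  then have t: "transpose (E (- ?s)) *v (transpose (E ?s) *v x) = x" for x
    unfolding matrix_vector_mul_assoc by (simp only: matrix_vector_mul_lid)
  have "C (- ?s) *v ?y = E (- ?s) *v fst z"
    using s by (simp add: C_reverse matrix_mult_uminus matrix_mult_vec_minus matrix_vector_mul_assoc[symmetric] t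
        matrix_inv_mult_vec[OF invertible_C]
        del: transpose_matrix_vector)
  then have "matrix_inv (C (- ?s)) *v (E (- ?s) *v fst z) = ?y"
    using matrix_inv_mult_vec(2)[OF invertible_C[of "- ?s"], of ?y] s by simp
  then have "frame_W z = ((A *v ?y) \<bullet> ?y) / 4" using s by (simp add: frame_W_eq)
  also have "(A *v ?y) \<bullet> ?y = (P ?s *v ?c) \<bullet> ?c"
    by (simp add: matrix_mult_vec_minus P_quadratic)
  finally show ?thesis using s by (simp add: W_def)
qed

lemma frame_W_nonneg: "0 \<le> frame_W z"
proof (cases "snd z = 0")
  case False
  then show ?thesis using A_nonneg by (simp add: frame_W_eq)
qed (simp add: frame_W_def W_kernel_def)

lemma frame_W_measurable [measurable]: "frame_W \<in> borel_measurable borel"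
proof -
  let ?X = "{z :: (real^'n) \<times> real. snd z \<noteq> 0}"
  let ?m = "\<lambda>z. matrix_inv (C (- snd z)) *v (E (- snd z) *v fst z)"
  have X: "open ?X" by (intro open_Collect_neq continuous_intros)
  have E: "continuous_on ?X (\<lambda>z. E (- snd z))"
    by (rule continuous_on_compose2[OF continuous_on_E[of UNIV]]) (auto intro!: continuous_intros)
  have C: "continuous_on ?X (\<lambda>z. C (- snd z))"
    by (rule continuous_on_compose2[OF C_cont[of UNIV]]) (auto intro!: continuous_intros)
  have m: "continuous_on ?X ?m"
  proof (rule continuous_on_matrix_inv_vec[OF C])
    show "continuous_on ?X (\<lambda>z. E (- snd z) *v fst z)" by (intro continuous_on_mult_vec E continuous_intros)
    show "det (C (- snd z)) \<noteq> 0" if "z \<in> ?X" for z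
      using invertible_C[of "- snd z"] that by (simp add: invertible_det_nz)
  qed
  have "(\<lambda>z. if z \<in> ?X then ((A *v ?m z) \<bullet> ?m z) / 4 else 0) \<in> borel_measurable borel"
  proof (rule borel_measurable_continuous_on_if)
    show "?X \<in> sets borel" using X by (rule borel_open)
    show "continuous_on ?X (\<lambda>z. ((A *v ?m z) \<bullet> ?m z) / 4)"
      by (intro continuous_on_divide continuous_on_inner continuous_on_mult_vec[OF continuous_on_const] m continuous_on_const) simp
  qed auto
  moreover have "frame_W = (\<lambda>z. if z \<in> ?X then ((A *v ?m z) \<bullet> ?m z) / 4 else 0)"
  proof
    show "frame_W z = (if z \<in> ?X then ((A *v ?m z) \<bullet> ?m z) / 4 else 0)" for z
      by (cases "snd z = 0") (simp_all add: frame_W_eq, simp add: frame_W_def W_kernel_def)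
  qed
  ultimately show ?thesis by simp
qed

lemma exists_low: "\<exists>i::'n. lev i = 0"
proof (rule ccontr)
  assume no: "\<not> ?thesis"
  have "lev i \<noteq> 0" for i :: 'n using no by simp
  then have "low x = 0" for x unfolding low_def by (simp only: if_False zero_vec_def)
  then have "x = 0" for x :: "real^'n" using kalman[of 1 x] by simp
  from this[of 1] show False by simp
qed

text \<open>\<open>A\<close> is definite on level 0, so the kernel can vanish only where a chosen
  level 0 coordinate of an invertible linear image of x is zero. That is a hyperplane.\<close>

lemma frame_W_slice_pos:
  assumes s: "s \<noteq> 0" shows "AE x in lborel. 0 < frame_W (x, s)"
proof -
  obtain i :: 'n where i: "lev i = 0" using exists_low by blast
  let ?M = "matrix_inv (C (- s)) ** E (- s)"
  let ?a = "transpose ?M *v axis i 1"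
  have M: "?M *v x = matrix_inv (C (- s)) *v (E (- s) *v x)" for x by (simp add: matrix_vector_mul_assoc)
  have a: "?a \<bullet> x = (?M *v x) $ i" for x
  proof -
    have "?a \<bullet> x = (?M *v x) \<bullet> axis i 1" unfolding inner_matrix_transpose[of ?M] by (rule inner_commute)
    then show ?thesis by (simp only: inner_axis) simp
  qed
  have "?a \<noteq> 0"
  proof
    assume z: "?a = 0"
    let ?x = "E s *v (C (- s) *v axis i 1)"
    have "?M *v ?x = axis i 1"
      unfolding M using s by (simp add: E_inverse_vec matrix_inv_mult_vec[OF invertible_C])
    then have "?a \<bullet> ?x = 1" unfolding a by simp
    then show False unfolding z by simp
  qed
  from AE_hyperplane[OF this] show ?thesis
  proof (rule AE_mp[OF _ AE_I2[OF impI]])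
    fix x assume "?a \<bullet> x \<noteq> 0"
    then have "low (?M *v x) $ i \<noteq> 0" unfolding a using i by (simp add: low_def)
    then have "low (?M *v x) \<noteq> 0" by auto
    from A_pos[OF this] show "0 < frame_W (x, s)" using s by (simp add: frame_W_eq M)
  qed
qed

lemma frame_W_pos: "AE z in lborel. 0 < frame_W z"
proof -
  have "AE z in lborel. z \<in> {z. 0 < frame_W z}"
    by (rule AE_lborel_slices) (use frame_W_slice_pos in simp_all)
  then show ?thesis by simp
qed

text \<open>On each time slice the map is affine with determinant 1, and time is merely
  reflected.\<close>

lemma nn_integral_frame_of:
  assumes [measurable]: "H \<in> borel_measurable borel"
  shows "(\<integral>\<^sup>+z. H (frame_of z0 z) \<partial>lborel) = (\<integral>\<^sup>+z. H z \<partial>lborel)"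
proof -
  obtain x0 t0 where z0: "z0 = (x0, t0)" by (cases z0)
  have E: "continuous_on UNIV (\<lambda>z :: (real^'n) \<times> real. E (t0 - snd z))"
    by (rule continuous_on_compose2[OF continuous_on_E[of UNIV]]) (auto intro!: continuous_intros)
  have "continuous_on UNIV (frame_of z0)"
    unfolding frame_of_def z0 using E by (intro continuous_intros continuous_on_mult_vec) auto
  then have [measurable]: "frame_of z0 \<in> borel_measurable borel" by (rule borel_measurable_continuous_onI)
  have pair: "(\<lambda>x::real^'n. (x, s)) \<in> borel_measurable borel" for s :: real
    by (intro borel_measurable_continuous_onI continuous_intros)
  have slice: "(\<integral>\<^sup>+x. H (frame_of z0 (x, t)) \<partial>lborel) = (\<integral>\<^sup>+x. H (x, t0 - t) \<partial>lborel)" for t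
  proof -
    have [measurable]: "(\<lambda>x. H (x, t0 - t)) \<in> borel_measurable borel"
      using measurable_compose[OF pair assms] .
    have "(\<integral>\<^sup>+x. H (frame_of z0 (x, t)) \<partial>lborel) = (\<integral>\<^sup>+x. H (E (t0 - t) *v x + (- x0), t0 - t) \<partial>lborel)"
      by (simp add: frame_of_def z0)
    also have "\<dots> = (\<integral>\<^sup>+x. H (x + (- x0), t0 - t) \<partial>lborel)"
      using nn_integral_linear_change[of "E (t0 - t)" "\<lambda>x. H (x + (- x0), t0 - t)"] by (simp add: det_E)
    also have "\<dots> = (\<integral>\<^sup>+x. H (x, t0 - t) \<partial>lborel)"
      by (rule nn_integral_lborel_translation) measurable
    finally show ?thesis .
  qed
  have [measurable]: "(\<lambda>s. \<integral>\<^sup>+x. H (x, s) \<partial>lborel) \<in> borel_measurable borel"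
  proof -
    have "(\<lambda>(s, x). H (x, s)) \<in> borel_measurable (borel \<Otimes>\<^sub>M lborel)"
      using measurable_compose[OF _ assms, of "\<lambda>(s, x). (x, s)" "borel \<Otimes>\<^sub>M lborel"]
      by (simp add: borel_prod[symmetric] split_beta')
    from lborel.borel_measurable_nn_integral[OF this] show ?thesis .
  qed
  have "(\<integral>\<^sup>+z. H (frame_of z0 z) \<partial>lborel) = (\<integral>\<^sup>+t. \<integral>\<^sup>+x. H (frame_of z0 (x, t)) \<partial>lborel \<partial>lborel)"
    by (rule nn_integral_lborel_pair) measurable
  also have "\<dots> = (\<integral>\<^sup>+t. \<integral>\<^sup>+x. H (x, t0 - t) \<partial>lborel \<partial>lborel)" by (simp only: slice)
  also have "\<dots> = (\<integral>\<^sup>+s. \<integral>\<^sup>+x. H (x, s) \<partial>lborel \<partial>lborel)"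
    using nn_integral_real_affine[of "\<lambda>s. \<integral>\<^sup>+x. H (x, s) \<partial>lborel" "-1" t0] by simp
  also have "\<dots> = (\<integral>\<^sup>+z. H z \<partial>lborel)" by (rule nn_integral_lborel_pair[symmetric]) measurable
  finally show ?thesis .
qed

lemma L_ball_frame: "z \<in> L_ball A B z0 r \<longleftrightarrow> frame_of z0 z \<in> heat_ball r"
  by (simp add: L_ball_def heat_ball_def fund_sol_pole)

text \<open>Before the frame result applies, \<open>D\<close> has to be confined to positive frame
  time, and this too follows from the potential identity.\<close>

theorem L_ball_rigidity:
  assumes D: "open D" "bounded D" and r: "0 < r"
    and hyp: "\<And>z. z \<notin> D \<Longrightarrow>
      (\<integral>\<^sup>+\<zeta>\<in>D. ennreal (fund_sol A B \<zeta> z * W_kernel A B (gmult B (ginv B z0) \<zeta>)) \<partial>lborel)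
        = ennreal (r * fund_sol A B z0 z)"
  shows "D = L_ball A B z0 r"
proof -
  define D' where "D' = of_frame z0 -` D"
  have D'_iff: "frame_of z0 z \<in> D' \<longleftrightarrow> z \<in> D" for z by (simp add: D'_def)
  have op: "open D'" unfolding D'_def using D(1) continuous_on_of_frame[of UNIV z0] by (simp add: open_vimage)
  then have [measurable]: "D' \<in> sets borel" by simp
  have hyp': "(\<integral>\<^sup>+\<zeta>. ennreal (kern z \<zeta>) * ennreal (frame_W \<zeta>) * indicator D' \<zeta> \<partial>lborel) = ennreal (r * psi z)"
    if "z \<notin> D'" for z
  proof -
    let ?H = "\<lambda>\<zeta>. ennreal (kern z \<zeta>) * ennreal (frame_W \<zeta>) * indicator D' \<zeta>"
    have z: "frame_of z0 (of_frame z0 z) = z" by simp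
    have "ennreal (r * psi z) = ennreal (r * fund_sol A B z0 (of_frame z0 z))" by (simp add: fund_sol_pole)
    also have "\<dots> = (\<integral>\<^sup>+\<zeta>\<in>D. ennreal (fund_sol A B \<zeta> (of_frame z0 z) * W_kernel A B (gmult B (ginv B z0) \<zeta>)) \<partial>lborel)"
      using that by (intro hyp[symmetric]) (simp add: D'_def)
    also have "\<dots> = (\<integral>\<^sup>+\<zeta>. ?H (frame_of z0 \<zeta>) \<partial>lborel)"
    proof (rule nn_integral_cong)
      fix \<zeta>
      have "indicator D' (frame_of z0 \<zeta>) = (indicator D \<zeta> :: ennreal)" by (simp add: indicator_def D'_iff)
      then show "ennreal (fund_sol A B \<zeta> (of_frame z0 z) * W_kernel A B (gmult B (ginv B z0) \<zeta>)) * indicator D \<zeta>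
          = ?H (frame_of z0 \<zeta>)"
        unfolding fund_sol_frame[of \<zeta> _ z0] W_kernel_frame z by (simp add: ennreal_mult kern_nonneg frame_W_nonneg)
    qed
    also have "\<dots> = (\<integral>\<^sup>+\<zeta>. ?H \<zeta> \<partial>lborel)" by (rule nn_integral_frame_of) measurable
    finally show ?thesis by simp
  qed
  obtain K where K: "\<And>z. z \<in> D \<Longrightarrow> norm z \<le> K" using D(2) by (auto simp: bounded_iff)
  have time: "\<bar>snd z0 - snd z\<bar> \<le> K" if "z \<in> D'" for z
  proof -
    have "\<bar>snd (of_frame z0 z)\<bar> \<le> norm (of_frame z0 z)" using norm_snd_le[of "snd (of_frame z0 z)" "fst (of_frame z0 z)"] by simp
    also have "\<dots> \<le> K" using that by (intro K) (simp add: D'_def)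
    finally show ?thesis by (simp add: of_frame_def)
  qed
  \<comment> \<open>Boundedness of \<open>D\<close> leaves points outside it on the slice through
    z0, where the fundamental solution with pole z0 vanishes.\<close>
  obtain y where y: "(y, 0) \<notin> D'"
  proof -
    obtain b :: "real^'n" where "norm b = \<bar>K\<bar> + 1" by (rule vector_choose_size[of "\<bar>K\<bar> + 1"]) simp_all
    then have b: "K < norm b" by linarith
    have "norm b \<le> norm (b, snd z0)" by (rule norm_fst_le)
    then have "(b, snd z0) \<notin> D" using K[of "(b, snd z0)"] b by auto
    then have "frame_of z0 (b, snd z0) \<notin> D'" by (simp add: D'_iff)
    then show ?thesis using that by (simp add: frame_of_def)
  qed
  \<comment> \<open>Seen from \<open>(y, 0)\<close> the kernel is positive at all negative frame
    times and the density is positive almost everywhere, so a vanishing potential leaves only a null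
    set, which is empty because it is open.\<close>
  have lower: "D' \<inter> {z. snd z < 0} = {}"
  proof (rule open_AE_empty)
    show "open (D' \<inter> {z. snd z < 0})" by (intro open_Int op open_Collect_less continuous_intros)
    have "(\<integral>\<^sup>+\<zeta>. ennreal (kern (y, 0) \<zeta>) * ennreal (frame_W \<zeta>) * indicator D' \<zeta> \<partial>lborel) = 0"
      using hyp'[OF y] by (simp add: psi_def)
    then have "AE \<zeta> in lborel. ennreal (kern (y, 0) \<zeta>) * ennreal (frame_W \<zeta>) * indicator D' \<zeta> = 0"
      by (subst (asm) nn_integral_0_iff_AE) auto
    with frame_W_pos show "AE \<zeta> in lborel. \<zeta> \<notin> D' \<inter> {z. snd z < 0}"
    proof eventually_elim
      case (elim \<zeta>)
      show ?case
      proof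
        assume "\<zeta> \<in> D' \<inter> {z. snd z < 0}"
        then have "\<zeta> \<in> D'" "0 < kern (y, 0) \<zeta>" by (auto intro: kern_pos)
        then show False using elim by (auto simp: ennreal_eq_0_iff)
      qed
    qed
  qed
  have upper: "0 < snd z" if z: "z \<in> D'" for z
  proof (rule ccontr)
    assume "\<not> 0 < snd z"
    \<comment> \<open>An open set containing a point of nonpositive frame time also contains points
      of negative frame time.\<close>
    obtain e where e: "0 < e" "ball z e \<subseteq> D'" using op z open_contains_ball by blast
    have "dist z (fst z, snd z - e / 2) = e / 2" using e(1) by (cases z) (simp add: dist_Pair_Pair dist_real_def)
    then have "(fst z, snd z - e / 2) \<in> D'" using e by (intro subsetD[OF e(2)]) simp
    moreover have "snd z - e / 2 < 0" using e(1) \<open>\<not> 0 < snd z\<close> by simp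
    ultimately have "(fst z, snd z - e / 2) \<in> D' \<inter> {z. snd z < 0}" by simp
    then show False unfolding lower by simp
  qed
  have "D' = heat_ball r"
  proof (rule heat_ball_rigidity[OF r op upper])
    show "snd z < snd z0 + K + 1" if "z \<in> D'" for z using time[OF that] by linarith
    show "AE \<zeta> in lborel. 0 < snd \<zeta> \<longrightarrow> 0 < W \<zeta>"
      using frame_W_pos by eventually_elim (auto simp: frame_W_upper)
    show "pot D' z = ennreal (r * psi z)" if "z \<notin> D'" "0 < snd z" for z
    proof -
      have "pot D' z = (\<integral>\<^sup>+\<zeta>. ennreal (kern z \<zeta>) * ennreal (frame_W \<zeta>) * indicator D' \<zeta> \<partial>lborel)"
        unfolding pot_def by (intro nn_integral_cong) (auto simp: indicator_def frame_W_upper upper)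
      then show ?thesis using hyp'[OF that(1)] by simp
    qed
  qed
  then have "z \<in> D \<longleftrightarrow> z \<in> L_ball A B z0 r" for z using D'_iff[of z] by (simp only: L_ball_frame)
  then show ?thesis by (rule set_eqI)
qed

end

theorem theorem1p1:
  fixes A B :: "real^'n^'n" and idx :: "'n \<Rightarrow> nat" and p :: "nat \<Rightarrow> nat" and \<kappa> :: nat
    and z0 :: "(real^'n) \<times> real" and D :: "((real^'n) \<times> real) set" and r :: real and q :: ennreal
  assumes "kolmogorov_structure idx p \<kappa> A B"
    and "open D" and "bounded D" and "r > 0"
    and "\<And>z. z \<notin> D \<Longrightarrow>
      (\<integral>\<^sup>+\<zeta>\<in>D. ennreal (fund_sol A B \<zeta> z * W_kernel A B (gmult B (ginv B z0) \<zeta>)) \<partial>lborel)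
        = ennreal (r * fund_sol A B z0 z)"
    and "q > ennreal (real (hom_dim p \<kappa>) / 2)"
    and "in_Lp q lborel (\<lambda>\<zeta>. (indicat_real D \<zeta> - indicat_real (L_ball A B z0 r) \<zeta>)
           * W_kernel A B (gmult B (ginv B z0) \<zeta>))"
  shows "D = L_ball A B z0 r"
proof -
  interpret kolmogorov idx p \<kappa> A B using assms(1) by unfold_locales
  show ?thesis using assms(2-5) by (rule L_ball_rigidity)
qed

end
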